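(* Let $n\ge4$, $m\ge1$, and $L:=L_{D_n}(m\omega_{n-1})$ with the edge scalars $X^{\mathrm{orth}},Y^{\mathrm{orth}}$ defined in the context. Then $L$ is $D_n$-structured (whenever $\mathbf s\xrightarrow{i}\mathbf t$, $m_j(\mathbf t)=m_j(\mathbf s)+a_{ij}$ for all $j\neq i$, with $(a_{ij})$ the Cartan matrix of type $D_n$) and the scalars satisfy all DC relations. Consequently, the assignments $x_i.v_{\mathbf t}:=\sum_{\mathbf u:\mathbf t\xrightarrow{i}\mathbf u}X^{\mathrm{orth}}_{\mathbf u,\mathbf t}v_{\mathbf u}$, $y_i.v_{\mathbf t}:=\sum_{\mathbf s:\mathbf s\xrightarrow{i}\mathbf t}Y^{\mathrm{orth}}_{\mathbf s,\mathbf t}v_{\mathbf s}$, $h_i.v_{\mathbf t}:=m_i(\mathbf t)v_{\mathbf t}$ ($1\le i\le n$) define a representation of the simple Lie algebra $\mathfrak g(D_n)\cong\mathfrak{so}(2n,\mathbb C)$ on $V[L]$; this module is irreducible with highest weight $m\omega_{n-1}$, $\{v_{\mathbf t}\}$ is a weight basis ($v_{\mathbf t}$ of weight $\sum_i m_i(\mathbf t)\omega_i$), and $L$ with these scalars is its representation diagram.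
   Context: Type $D_n$ ($n\ge4$), Bourbaki numbering: nodes $1,\dots,n$; $a_{ii}=2$; $a_{ij}=a_{ji}=-1$ if $\{i,j\}=\{k,k+1\}$ with $1\le k\le n-2$ or $\{i,j\}=\{n-2,n\}$; all other $a_{ij}=0$. $x_i,y_i,h_i$ are Chevalley generators of $\mathfrak g(D_n)$, $\omega_i$ the fundamental weights. Even orthogonal ideal arrays: an array $\mathbf c$ of nonnegative integers $c_{p,q}$ indexed by $\{(p,q):1\le q\le p\le n-2\}\cup\{(n-1,q):1\le q\le\lceil (n-1)/2\rceil\}\cup\{(n,q):1\le q\le\lfloor(n-1)/2\rfloor\}$ such that, setting for $1\le q\le p\le n-1$: $g_{p,q}:=c_{p,q}$ if $p\le n-2$, $g_{n-1,q}:=c_{n-1,(q+1)/2}$ if $q$ odd and $g_{n-1,q}:=c_{n,q/2}$ if $q$ even, one has $g_{p+1,q}\le g_{p,q}\le g_{p+1,q+1}$ for all $1\le q\le p\le n-2$ and $g_{n-1,n-1}\le m$. $L_{D_n}(m\omega_{n-1})$ is the set of these arrays ordered componentwise; $\mathbf s\to\mathbf t$ is a covering iff they differ at exactly one position $(i,j')$ with $c_{i,j'}(\mathbf t)=c_{i,j'}(\mathbf s)+1$, and this edge gets color $i\in\{1,\dots,n\}$, written $\mathbf s\xrightarrow{i}\mathbf t$. Edge scalars: for an array $\mathbf d$ define two arrays $G(\mathbf d),G'(\mathbf d)$ indexed by $0\le p\le n$, $q\in C_p:=\{p-n+1,\dots,p\}$: both are $0$ when $q\le0$ and equal $g_{p,q}(\mathbf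 d)$ for $1\le q\le p\le n-1$; in column $n$: $G_{n,1}=0$, $G_{n,q}=c_{n,\lfloor q/2\rfloor}$ for $1<q<n$, $G_{n,n}=m$ if $n$ even and $G_{n,n}=c_{n,(n-1)/2}$ if $n$ odd; $G'_{n,1}=c_{n-1,1}$, $G'_{n,q}=c_{n-1,\lfloor(q+1)/2\rfloor}$ for $1<q<n$, $G'_{n,n}=c_{n-1,n/2}$ if $n$ even and $G'_{n,n}=m$ if $n$ odd. For an edge $\mathbf s\xrightarrow{i}\mathbf t$ at position $(i,j')$ let $H:=G(\mathbf t)$ and $(a,b):=(i,j')$ if $i\le n-2$; $H:=G(\mathbf t)$, $(a,b):=(n-1,2j'-1)$ if $i=n-1$; $H:=G'(\mathbf t)$, $(a,b):=(n-1,2j')$ if $i=n$. Put $$X:=-\frac{\prod_{k\in C_{a+1}}(H_{a,b}-H_{a+1,k}+b-k)}{\prod_{k\in C_a\setminus\{b\}}(H_{a,b}-H_{a,k}+b-k-1)},\quad Y:=\frac{\prod_{k\in C_{a-1}}(H_{a,b}-H_{a-1,k}+b-k-1)}{\prod_{k\in C_a\setminus\{b\}}(H_{a,b}-H_{a,k}+b-k)},$$ $\mathcal P_{\mathbf s,\mathbf t}:=XY$ (a positive rational) and $X^{\mathrm{orth}}_{\mathbf t,\mathbf s}:=Y^{\mathrm{orth}}_{\mathbf s,\mathbf t}:=\sqrt{\mathcal P_{\mathbf s,\mathbf t}}$. For a colored poset, the $i$-component of $\mathbf t$ is the set reachable from $\mathbf t$ by undirected paths of $i$-colored edges; with $l_i(\mathbf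 t)$ its length and $\rho_i(\mathbf t)$ the rank of $\mathbf t$ in it, $m_i(\mathbf t):=2\rho_i(\mathbf t)-l_i(\mathbf t)$. $V[L]$ has basis $\{v_{\mathbf t}\}_{\mathbf t\in L}$. DC relations: for every diamond $\mathbf r\xrightarrow{j}\mathbf s$, $\mathbf r\xrightarrow{i}\mathbf t$, $\mathbf s\xrightarrow{i}\mathbf u$, $\mathbf t\xrightarrow{j}\mathbf u$: $X_{\mathbf u,\mathbf s}Y_{\mathbf t,\mathbf u}=Y_{\mathbf r,\mathbf s}X_{\mathbf t,\mathbf r}$, $X_{\mathbf u,\mathbf t}Y_{\mathbf s,\mathbf u}=Y_{\mathbf r,\mathbf t}X_{\mathbf s,\mathbf r}$; and for each $\mathbf t$, $i$: $\sum_{\mathbf s\xrightarrow{i}\mathbf t}X_{\mathbf t,\mathbf s}Y_{\mathbf s,\mathbf t}-\sum_{\mathbf t\xrightarrow{i}\mathbf u}X_{\mathbf u,\mathbf t}Y_{\mathbf t,\mathbf u}=m_i(\mathbf t)$. The representation diagram of a weight basis is its supporting graph (edge $\mathbf s\xrightarrow{i}\mathbf t$ iff $x_i.v_{\mathbf s}$ has nonzero $v_{\mathbf t}$-coefficient or $y_i.v_{\mathbf t}$ has nonzero $v_{\mathbf s}$-coefficient) together with these coefficient pairs. *)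

theory Defs
  imports Complex_Main
begin

section \<open>Type D_n data (Bourbaki numbering)\<close>

definition cartanD :: "nat \<Rightarrow> nat \<Rightarrow> nat \<Rightarrow> int" where
  "cartanD n i j =
     (if i = j then 2
      else if (\<exists>k. 1 \<le> k \<and> k \<le> n - 2 \<and> {i, j} = {k, k + 1}) \<or> {i, j} = {n - 2, n} then -1
      else 0)"

text \<open>An array is a function on positions (p,q); it is required to vanish off the index set.\<close>
type_synonym arr = "nat \<times> nat \<Rightarrow> nat"

definition idx :: "nat \<Rightarrow> (nat \<times> nat) set" where
  "idx n = {(p, q). 1 \<le> q \<and> q \<le> p \<and> p \<le> n - 2}
         \<union> {(p, q). p = n - 1 \<and> 1 \<le> q \<and> q \<le> n div 2}
         \<union> {(p, q). p = n \<and> 1 \<le> q \<and> q \<le> (n - 1) div 2}"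
  (* n div 2 = ceiling((n-1)/2),  (n-1) div 2 = floor((n-1)/2) *)

text \<open>The entries g_{p,q}, for 1 <= q <= p <= n-1.\<close>
definition gD :: "nat \<Rightarrow> arr \<Rightarrow> nat \<Rightarrow> nat \<Rightarrow> nat" where
  "gD n c p q =
     (if p \<le> n - 2 then c (p, q)
      else if odd q then c (n - 1, (q + 1) div 2)
      else c (n, q div 2))"

definition is_arr :: "nat \<Rightarrow> nat \<Rightarrow> arr \<Rightarrow> bool" where
  "is_arr n m c \<longleftrightarrow>
     (\<forall>pq. pq \<notin> idx n \<longrightarrow> c pq = 0) \<and>
     (\<forall>p q. 1 \<le> q \<and> q \<le> p \<and> p \<le> n - 2 \<longrightarrow>
        gD n c (p + 1) q \<le> gD n c p q \<and> gD n c p q \<le> gD n c (p + 1) (q + 1)) \<and>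
     gD n c (n - 1) (n - 1) \<le> m"

definition LD :: "nat \<Rightarrow> nat \<Rightarrow> arr set" where
  "LD n m = {c. is_arr n m c}"

definition edgeD :: "nat \<Rightarrow> nat \<Rightarrow> nat \<Rightarrow> arr \<Rightarrow> arr \<Rightarrow> bool" where
  "edgeD n m i s t \<longleftrightarrow> s \<in> LD n m \<and> t \<in> LD n m \<and>
     (\<exists>j. (i, j) \<in> idx n \<and> t = s((i, j) := s (i, j) + 1))"

definition Cset :: "nat \<Rightarrow> nat \<Rightarrow> int set" where
  "Cset n p = {int p - int n + 1 .. int p}"

text \<open>The arrays G(d) and G'(d), for 0 <= p <= n, q in C_p.\<close>
definition GD :: "nat \<Rightarrow> nat \<Rightarrow> arr \<Rightarrow> nat \<Rightarrow> int \<Rightarrow> real" where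
  "GD n m d p q =
     (if q \<le> 0 then 0
      else if p \<le> n - 1 then real (gD n d p (nat q))
      else if q = 1 then 0
      else if q < int n then real (d (n, nat q div 2))
      else if even n then real m else real (d (n, (n - 1) div 2)))"

definition GD' :: "nat \<Rightarrow> nat \<Rightarrow> arr \<Rightarrow> nat \<Rightarrow> int \<Rightarrow> real" where
  "GD' n m d p q =
     (if q \<le> 0 then 0
      else if p \<le> n - 1 then real (gD n d p (nat q))
      else if q = 1 then real (d (n - 1, 1))
      else if q < int n then real (d (n - 1, nat (q + 1) div 2))
      else if even n then real (d (n - 1, n div 2)) else real m)"

definition Xfac :: "nat \<Rightarrow> (nat \<Rightarrow> int \<Rightarrow> real) \<Rightarrow> nat \<Rightarrow> int \<Rightarrow> real" where
  "Xfac n H a b =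
     - (\<Prod>k\<in>Cset n (a + 1). H a b - H (a + 1) k + of_int b - of_int k)
     / (\<Prod>k\<in>Cset n a - {b}. H a b - H a k + of_int b - of_int k - 1)"

definition Yfac :: "nat \<Rightarrow> (nat \<Rightarrow> int \<Rightarrow> real) \<Rightarrow> nat \<Rightarrow> int \<Rightarrow> real" where
  "Yfac n H a b =
     (\<Prod>k\<in>Cset n (a - 1). H a b - H (a - 1) k + of_int b - of_int k - 1)
     / (\<Prod>k\<in>Cset n a - {b}. H a b - H a k + of_int b - of_int k)"

text \<open>P for an edge into t whose raised position is (i,j').\<close>
definition Pcoef :: "nat \<Rightarrow> nat \<Rightarrow> arr \<Rightarrow> nat \<times> nat \<Rightarrow> real" where
  "Pcoef n m t pos =
     (let (i, j) = pos;
          H = (if i = n then GD' n m t else GD n m t);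
          a = (if i \<le> n - 2 then i else n - 1);
          b = (if i \<le> n - 2 then int j else if i = n - 1 then 2 * int j - 1 else 2 * int j)
      in Xfac n H a b * Yfac n H a b)"

definition edge_pos :: "arr \<Rightarrow> arr \<Rightarrow> nat \<times> nat" where
  "edge_pos s t = (THE pos. t = s(pos := s pos + 1))"

definition Xorth :: "nat \<Rightarrow> nat \<Rightarrow> arr \<Rightarrow> arr \<Rightarrow> real" where
  "Xorth n m t s = sqrt (Pcoef n m t (edge_pos s t))"

definition Yorth :: "nat \<Rightarrow> nat \<Rightarrow> arr \<Rightarrow> arr \<Rightarrow> real" where
  "Yorth n m s t = sqrt (Pcoef n m t (edge_pos s t))"

definition icomp :: "nat \<Rightarrow> nat \<Rightarrow> nat \<Rightarrow> arr \<Rightarrow> arr set" where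
  "icomp n m i t = {s. (\<lambda>x y. edgeD n m i x y \<or> edgeD n m i y x)\<^sup>*\<^sup>* t s}"

text \<open>Rank in L: total entry sum (every covering raises it by exactly one).\<close>
definition wtD :: "nat \<Rightarrow> arr \<Rightarrow> int" where
  "wtD n c = (\<Sum>pq\<in>idx n. int (c pq))"

definition rhoD :: "nat \<Rightarrow> nat \<Rightarrow> nat \<Rightarrow> arr \<Rightarrow> int" where
  "rhoD n m i t = wtD n t - Min (wtD n ` icomp n m i t)"

definition lenD :: "nat \<Rightarrow> nat \<Rightarrow> nat \<Rightarrow> arr \<Rightarrow> int" where
  "lenD n m i t = Max (wtD n ` icomp n m i t) - Min (wtD n ` icomp n m i t)"

definition mD :: "nat \<Rightarrow> nat \<Rightarrow> nat \<Rightarrow> arr \<Rightarrow> int" where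
  "mD n m i t = 2 * rhoD n m i t - lenD n m i t"

definition structuredD :: "nat \<Rightarrow> nat \<Rightarrow> bool" where
  "structuredD n m \<longleftrightarrow>
     (\<forall>i s t. i \<in> {1..n} \<and> edgeD n m i s t \<longrightarrow>
        (\<forall>j\<in>{1..n}. j \<noteq> i \<longrightarrow> mD n m j t = mD n m j s + cartanD n i j))"

definition DC_relations :: "nat \<Rightarrow> nat \<Rightarrow> (arr \<Rightarrow> arr \<Rightarrow> real) \<Rightarrow> (arr \<Rightarrow> arr \<Rightarrow> real) \<Rightarrow> bool" where
  "DC_relations n m X Y \<longleftrightarrow>
     (\<forall>i j r s t u. i \<in> {1..n} \<and> j \<in> {1..n} \<and> s \<noteq> t \<and>
        edgeD n m j r s \<and> edgeD n m i r t \<and> edgeD n m i s u \<and> edgeD n m j t u \<longrightarrow>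
        X u s * Y t u = Y r s * X t r \<and> X u t * Y s u = Y r t * X s r) \<and>
     (\<forall>t\<in>LD n m. \<forall>i\<in>{1..n}.
        (\<Sum>s\<in>{s. edgeD n m i s t}. X t s * Y s t)
        - (\<Sum>u\<in>{u. edgeD n m i t u}. X u t * Y t u) = of_int (mD n m i t))"

definition VL :: "nat \<Rightarrow> nat \<Rightarrow> (arr \<Rightarrow> complex) set" where
  "VL n m = {v. \<forall>x. x \<notin> LD n m \<longrightarrow> v x = 0}"

definition vb :: "arr \<Rightarrow> arr \<Rightarrow> complex" where
  "vb t = (\<lambda>x. if x = t then 1 else 0)"

type_synonym op = "(arr \<Rightarrow> complex) \<Rightarrow> (arr \<Rightarrow> complex)"

definition xop :: "nat \<Rightarrow> nat \<Rightarrow> nat \<Rightarrow> op" where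
  "xop n m i v = (\<lambda>u. if u \<in> LD n m
      then (\<Sum>t\<in>{t. edgeD n m i t u}. complex_of_real (Xorth n m u t) * v t) else 0)"

definition yop :: "nat \<Rightarrow> nat \<Rightarrow> nat \<Rightarrow> op" where
  "yop n m i v = (\<lambda>s. if s \<in> LD n m
      then (\<Sum>t\<in>{t. edgeD n m i s t}. complex_of_real (Yorth n m s t) * v t) else 0)"

definition hop :: "nat \<Rightarrow> nat \<Rightarrow> nat \<Rightarrow> op" where
  "hop n m i v = (\<lambda>t. if t \<in> LD n m then of_int (mD n m i t) * v t else 0)"

definition scaleV :: "complex \<Rightarrow> (arr \<Rightarrow> complex) \<Rightarrow> (arr \<Rightarrow> complex)" where
  "scaleV c v = (\<lambda>x. c * v x)"

definition opcomm :: "op \<Rightarrow> op \<Rightarrow> op" where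
  "opcomm A B = (\<lambda>v x. A (B v) x - B (A v) x)"

text \<open>A representation of g(D_n) on the space V: operators x_i, y_i, h_i (1 <= i <= n)
  preserving V and satisfying the Chevalley-Serre relations of type D_n on V.\<close>
definition serre_rep :: "nat \<Rightarrow> (arr \<Rightarrow> complex) set \<Rightarrow> (nat \<Rightarrow> op) \<Rightarrow> (nat \<Rightarrow> op) \<Rightarrow> (nat \<Rightarrow> op) \<Rightarrow> bool" where
  "serre_rep n V x y h \<longleftrightarrow>
     (\<forall>i\<in>{1..n}. \<forall>v\<in>V. x i v \<in> V \<and> y i v \<in> V \<and> h i v \<in> V) \<and>
     (\<forall>i\<in>{1..n}. \<forall>v\<in>V. \<forall>w\<in>V. \<forall>c::complex.
        x i (\<lambda>z. v z + w z) = (\<lambda>z. x i v z + x i w z) \<and> x i (scaleV c v) = scaleV c (x i v) \<and>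
        y i (\<lambda>z. v z + w z) = (\<lambda>z. y i v z + y i w z) \<and> y i (scaleV c v) = scaleV c (y i v) \<and>
        h i (\<lambda>z. v z + w z) = (\<lambda>z. h i v z + h i w z) \<and> h i (scaleV c v) = scaleV c (h i v)) \<and>
     (\<forall>i\<in>{1..n}. \<forall>j\<in>{1..n}. \<forall>v\<in>V.
        opcomm (h i) (h j) v = (\<lambda>_. 0) \<and>
        opcomm (h i) (x j) v = scaleV (of_int (cartanD n i j)) (x j v) \<and>
        opcomm (h i) (y j) v = scaleV (- of_int (cartanD n i j)) (y j v) \<and>
        opcomm (x i) (y j) v = (if i = j then h i v else (\<lambda>_. 0)) \<and>
        (i \<noteq> j \<longrightarrow>
           ((opcomm (x i)) ^^ nat (1 - cartanD n i j)) (x j) v = (\<lambda>_. 0) \<and>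
           ((opcomm (y i)) ^^ nat (1 - cartanD n i j)) (y j) v = (\<lambda>_. 0)))"

definition is_subspace :: "(arr \<Rightarrow> complex) set \<Rightarrow> bool" where
  "is_subspace W \<longleftrightarrow> (\<lambda>_. 0) \<in> W \<and> (\<forall>v\<in>W. \<forall>w\<in>W. (\<lambda>z. v z + w z) \<in> W) \<and>
     (\<forall>c. \<forall>v\<in>W. scaleV c v \<in> W)"

definition irreducible_rep :: "nat \<Rightarrow> (arr \<Rightarrow> complex) set \<Rightarrow> (nat \<Rightarrow> op) \<Rightarrow> (nat \<Rightarrow> op) \<Rightarrow> (nat \<Rightarrow> op) \<Rightarrow> bool" where
  "irreducible_rep n V x y h \<longleftrightarrow> V \<noteq> {\<lambda>_. 0} \<and>
     (\<forall>W. is_subspace W \<and> W \<subseteq> V \<and>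
        (\<forall>i\<in>{1..n}. \<forall>w\<in>W. x i w \<in> W \<and> y i w \<in> W \<and> h i w \<in> W)
        \<longrightarrow> W = {\<lambda>_. 0} \<or> W = V)"

text \<open>Highest weight lambda = sum_i lam i * omega_i: a nonzero vector killed by all x_i
  on which h_i acts by lam i.\<close>
definition has_highest_weight :: "nat \<Rightarrow> (arr \<Rightarrow> complex) set \<Rightarrow> (nat \<Rightarrow> op) \<Rightarrow> (nat \<Rightarrow> op) \<Rightarrow> (nat \<Rightarrow> int) \<Rightarrow> bool" where
  "has_highest_weight n V x h lam \<longleftrightarrow>
     (\<exists>v\<in>V. v \<noteq> (\<lambda>_. 0) \<and> (\<forall>i\<in>{1..n}. x i v = (\<lambda>_. 0) \<and> h i v = scaleV (of_int (lam i)) v))"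

end

theory Submission
  imports Defs
begin

text \<open>With the column \<open>n\<close> held fixed (or, for the color \<open>n\<close>, the column \<open>n - 1\<close>), an even orthogonal
  ideal array becomes a Gelfand--Tsetlin pattern whose top row has repeated entries, and
  \<open>P\<close> is the classical Gelfand--Tsetlin coefficient. Interlacing regroups that coefficient as
  \<open>- (l\<^sub>b - M\<^sub>b) (l\<^sub>b - U\<^sub>b - 1)\<close> times the product of
  \<open>(l\<^sub>b - M\<^sub>k) (l\<^sub>b - U\<^sub>k - 1) / ((l\<^sub>b - l\<^sub>k) (l\<^sub>b - l\<^sub>k - 1))\<close> over \<open>k \<noteq> b\<close>, where \<open>[M\<^sub>k, U\<^sub>k]\<close> are the
  disjoint ranges of the shifted entries \<open>l\<^sub>k\<close> of one column. So an \<open>i\<close>-component is a product of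
  chains, and \<open>m\<^sub>i\<close> is the sum of the residues of
  \<open>\<Prod>\<^sub>k (z - M\<^sub>k) (z - U\<^sub>k - 1) / ((z - l\<^sub>k) (z - l\<^sub>k - 1))\<close>. The diamond relations give the
  commutators of the \<open>x\<^sub>i\<close> and \<open>y\<^sub>k\<close>; the Serre relations then follow from
  \<open>\<ss>\<ll>\<^sub>2\<close>-theory, since \<open>x\<^sub>k\<close> is a lowest weight vector for the adjoint action of \<open>x\<^sub>i, y\<^sub>i, h\<^sub>i\<close>.
  For irreducibility, a vector killed by all \<open>x\<^sub>i\<close> is supported on the top array alone, and \<open>y\<^sub>i\<close>
  is the transpose of \<open>x\<^sub>i\<close>.\<close>

section \<open>Sums of residues\<close>

text \<open>Neighbouring ranges may touch, so poles of the rational function can collide and the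
  textbook residue formula would divide by zero. A collision occurs only where both poles are
  cancelled by zeros, and such poles are discarded before the residues are summed. The fork of the
  diagram puts the colors \<open>n - 1\<close> and \<open>n\<close> into one row of the pattern, on
  odd and even columns. The column held fixed occurs twice in the top row. This pins its own entries
  to ranges of a single point, which carry no residue, and it makes a change of one of them
  invisible to the other color, as the zero Cartan entry demands. Weights become second differences
  of row sums, in which the maxima and minima that define the ranges disappear; hence the Cartan
  matrix. Irreducibility avoids complete reducibility: as the two scalars of an edge coincide, the
  complement of a submodule under a symmetric bilinear form is stable under all \<open>x\<close>
  operators, which is enough to reach the top vector.\<close>

lemma partial_fractions:
  fixes x w :: "'i \<Rightarrow> 'a::field"
  assumes "finite I" "inj_on x I" "z \<notin> x ` I"
  shows "(\<Prod>i\<in>I. (z - w i) / (z - x i)) =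
    1 + (\<Sum>i\<in>I. (x i - w i) * (\<Prod>j\<in>I-{i}. (x i - w j) / (x i - x j)) / (z - x i))"
  using assms
proof (induction I arbitrary: z rule: finite_induct)
  case empty
  then show ?case by simp
next
  case (insert k I)
  define r where "r i = (x i - w i) * (\<Prod>j\<in>I-{i}. (x i - w j) / (x i - x j))" for i
  have inj: "inj_on x I" and nk: "x k \<notin> x ` I" using insert.prems insert.hyps by auto
  have zk: "z \<noteq> x k" and zI: "z \<notin> x ` I" using insert.prems by auto
  have IHz: "(\<Prod>i\<in>I. (z - w i) / (z - x i)) = 1 + (\<Sum>i\<in>I. r i / (z - x i))"
    using insert.IH[OF inj zI] by (simp add: r_def)
  \<comment> \<open>The expansion over \<open>I\<close> taken at the new pole \<open>z = x k\<close>
    evaluates the product that occurs in the residue there.\<close>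
  have IHk: "(\<Prod>i\<in>I. (x k - w i) / (x k - x i)) = 1 + (\<Sum>i\<in>I. r i / (x k - x i))"
    using insert.IH[OF inj nk] by (simp add: r_def)
  define d where "d = x k - w k"
  have xi: "x i \<noteq> x k" "z \<noteq> x i" if "i \<in> I" for i
  proof -
    have "x i \<in> x ` I" using that by (rule imageI)
    then show "x i \<noteq> x k" "z \<noteq> x i" using nk zI by metis+
  qed
  have r': "(x i - w i) * (\<Prod>j\<in>insert k I-{i}. (x i - w j) / (x i - x j))
      = r i * (1 + d / (x i - x k))" if "i \<in> I" for i
  proof -
    have "insert k I - {i} = insert k (I - {i})" using insert.hyps that by auto
    moreover have "(x i - w k) / (x i - x k) = 1 + d / (x i - x k)"
      using xi[OF that] by (simp add: d_def field_simps)
    ultimately show ?thesis using insert.hyps by (simp add: r_def)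
  qed
  have "(\<Sum>i\<in>insert k I. (x i - w i) * (\<Prod>j\<in>insert k I-{i}. (x i - w j) / (x i - x j)) / (z - x i))
      = d * (1 + (\<Sum>i\<in>I. r i / (x k - x i))) / (z - x k)
        + (\<Sum>i\<in>I. r i * (1 + d / (x i - x k)) / (z - x i))"
    using insert.hyps IHk by (simp add: r' d_def cong: sum.cong)
  also have "\<dots> = d / (z - x k) + (\<Sum>i\<in>I. r i * d / ((x k - x i) * (z - x k))
        + r i * (1 + d / (x i - x k)) / (z - x i))"
    by (simp add: sum.distrib distrib_left add_divide_distrib sum_distrib_left sum_divide_distrib mult.commute)
  also have "(\<Sum>i\<in>I. r i * d / ((x k - x i) * (z - x k)) + r i * (1 + d / (x i - x k)) / (z - x i))
      = (\<Sum>i\<in>I. (1 + d / (z - x k)) * (r i / (z - x i)))"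
  proof (rule sum.cong[OF refl])
    fix i assume "i \<in> I"
    \<comment> \<open>Only the distances from \<open>z\<close> to the two poles matter, which leaves
      an identity in two nonzero variables with nonzero difference.\<close>
    define A B where "A = z - x i" and "B = z - x k"
    have "A \<noteq> 0" "B \<noteq> 0" "A - B \<noteq> 0" using xi[OF \<open>i \<in> I\<close>] zk by (auto simp: A_def B_def)
    then have *: "r i * d / ((A - B) * B) + r i * (1 + d / (B - A)) / A = (1 + d / B) * (r i / A)"
      by (simp add: divide_simps) (simp add: algebra_simps)
    have "x k - x i = A - B" "x i - x k = B - A" by (auto simp: A_def B_def)
    then show "r i * d / ((x k - x i) * (z - x k)) + r i * (1 + d / (x i - x k)) / (z - x i)
      = (1 + d / (z - x k)) * (r i / (z - x i))"
      using * by (simp only: A_def[symmetric] B_def[symmetric])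
  qed
  also have "1 + (d / (z - x k) + \<dots>) = (1 + d / (z - x k)) * (1 + (\<Sum>i\<in>I. r i / (z - x i)))"
    by (simp only: sum_distrib_left[symmetric]) (simp add: algebra_simps)
  also have "1 + d / (z - x k) = (z - w k) / (z - x k)" using zk by (simp add: d_def field_simps)
  finally show ?case using insert.hyps IHz by simp
qed

text \<open>Over the complex numbers this compares the coefficients of \<open>1 / z\<close> at
  infinity in \<open>partial_fractions\<close>. Over any field, the expansion at
  \<open>z = x k\<close> shows that a new pole takes from the old residues exactly what it adds
  beyond \<open>x k - w k\<close>.\<close>

lemma sum_residues:
  fixes x w :: "'i \<Rightarrow> 'a::field"
  assumes "finite I" "inj_on x I"
  shows "(\<Sum>i\<in>I. (x i - w i) * (\<Prod>j\<in>I-{i}. (x i - w j) / (x i - x j))) = (\<Sum>i\<in>I. x i - w i)"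
  using assms
proof (induction I rule: finite_induct)
  case empty
  then show ?case by simp
next
  case (insert k I)
  define r where "r i = (x i - w i) * (\<Prod>j\<in>I-{i}. (x i - w j) / (x i - x j))" for i
  have inj: "inj_on x I" and nk: "x k \<notin> x ` I" using insert.prems insert.hyps by auto
  have IH: "(\<Sum>i\<in>I. r i) = (\<Sum>i\<in>I. x i - w i)" using insert.IH inj by (simp add: r_def)
  have IHk: "(\<Prod>i\<in>I. (x k - w i) / (x k - x i)) = 1 + (\<Sum>i\<in>I. r i / (x k - x i))"
    using partial_fractions[OF insert.hyps(1) inj nk, of w] by (simp add: r_def)
  define d where "d = x k - w k"
  have xi: "x i \<noteq> x k" if "i \<in> I" for i
    using nk imageI[OF that, of x] by metis
  have r': "(x i - w i) * (\<Prod>j\<in>insert k I-{i}. (x i - w j) / (x i - x j))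
      = r i - d * (r i / (x k - x i))" if "i \<in> I" for i
  proof -
    have "insert k I - {i} = insert k (I - {i})" using insert.hyps that by auto
    moreover have "(x i - w k) / (x i - x k) = 1 - d / (x k - x i)"
      using xi[OF that] by (simp add: d_def field_simps)
    ultimately have "(x i - w i) * (\<Prod>j\<in>insert k I-{i}. (x i - w j) / (x i - x j))
      = r i * (1 - d / (x k - x i))" using insert.hyps by (simp add: r_def)
    then show ?thesis by (simp add: right_diff_distrib)
  qed
  have "(\<Sum>i\<in>insert k I. (x i - w i) * (\<Prod>j\<in>insert k I-{i}. (x i - w j) / (x i - x j)))
      = d * (1 + (\<Sum>i\<in>I. r i / (x k - x i))) + (\<Sum>i\<in>I. r i - d * (r i / (x k - x i)))"
    using insert.hyps IHk by (simp add: r' d_def cong: sum.cong)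
  also have "\<dots> = d + (\<Sum>i\<in>I. r i)"
    by (simp add: sum_subtractf sum_distrib_left algebra_simps)
  finally show ?case using insert.hyps by (simp add: IH d_def)
qed

text \<open>The residue at \<open>z = l b\<close> of the product over \<open>K\<close> of
  \<open>(z - M k) * (z - U k - 1) / ((z - l k) * (z - l k - 1))\<close>. The residue at the other
  pole \<open>l b + 1\<close> is minus the same expression with \<open>l b\<close> raised by one, so
  edges into and out of an array correspond to the two kinds of poles.\<close>

definition chain_res :: "nat set \<Rightarrow> (nat \<Rightarrow> real) \<Rightarrow> (nat \<Rightarrow> real) \<Rightarrow> (nat \<Rightarrow> real) \<Rightarrow> nat \<Rightarrow> real" where
  "chain_res K M U l b = - ((l b - M b) * (l b - U b - 1)) *
     (\<Prod>k\<in>K-{b}. (l b - M k) * (l b - U k - 1) / ((l b - l k) * (l b - l k - 1)))"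

text \<open>The residues add up to the sum of the poles minus the sum of the zeros, that is
  \<open>l b + (l b + 1) - M b - (U b + 1)\<close> for each \<open>b\<close>. The work lies in poles
  \<open>l b + 1 = l k\<close> of touching ranges.\<close>

lemma sum_chain_res:
  assumes "finite K"
    and box: "\<And>k. k \<in> K \<Longrightarrow> M k \<le> l k \<and> l k \<le> U k"
    and gap: "\<And>k k'. k \<in> K \<Longrightarrow> k' \<in> K \<Longrightarrow> k < k' \<Longrightarrow> U k + 1 \<le> M k'"
  shows "(\<Sum>b\<in>K. chain_res K M U l b) - (\<Sum>b\<in>K. chain_res K M U (l(b := l b + 1)) b)
    = (\<Sum>b\<in>K. 2 * l b - M b - U b)"
proof -
  \<comment> \<open>Each pole is paired with the zero that can cancel it: \<open>l b\<close> with
    \<open>M b\<close>, and \<open>l b + 1\<close> with \<open>U b + 1\<close>.\<close>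
  define x where "x = (\<lambda>(b, up). if up then l b + 1 else l b)"
  define w where "w = (\<lambda>(b, up). if up then U b + 1 else M b)"
  define J where "J = K \<times> (UNIV :: bool set)"
  \<comment> \<open>If \<open>l b + 1 = l k\<close> with \<open>b < k\<close>, then
    \<open>box\<close> and \<open>gap\<close> force \<open>l b = U b\<close> and
    \<open>l k = M k\<close>, so both poles are cancelled. The uncancelled ones in \<open>I\<close>
    are therefore distinct.\<close>
  define I where "I = {i \<in> J. x i \<noteq> w i}"
  define R where "R i = (x i - w i) * (\<Prod>j\<in>J-{i}. (x i - w j) / (x i - x j))" for i
  have finJ: "finite J" using \<open>finite K\<close> by (simp add: J_def)
  have sep: "x i \<noteq> x j" if "i \<in> I" "j \<in> J" "i \<noteq> j" for i j
  proof -
    obtain b u where i: "i = (b, u)" by fastforce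
    obtain k v where j: "j = (k, v)" by fastforce
    have bk: "b \<in> K" "k \<in> K" using that by (auto simp: I_def J_def i j)
    have ne: "if u then l b < U b else M b < l b"
      using that(1) box[OF bk(1)] by (auto simp: I_def i x_def w_def)
    consider "b = k" | "b < k" | "k < b" by linarith
    then show ?thesis
    proof cases
      case 1
      then show ?thesis using that(3) by (auto simp: i j x_def)
    next
      case 2
      then show ?thesis using gap[OF bk 2] box[OF bk(1)] box[OF bk(2)] ne
        by (auto simp: i j x_def split: if_splits)
    next
      case 3
      then show ?thesis using gap[OF bk(2,1) 3] box[OF bk(1)] box[OF bk(2)] ne
        by (auto simp: i j x_def split: if_splits)
    qed
  qed
  have inj: "inj_on x I" by (rule inj_onI) (use sep I_def in blast)
  have "(\<Sum>i\<in>J. R i) = (\<Sum>i\<in>I. R i)"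
    by (rule sum.mono_neutral_right) (auto simp: finJ I_def R_def)
  also have "\<dots> = (\<Sum>i\<in>I. (x i - w i) * (\<Prod>j\<in>I-{i}. (x i - w j) / (x i - x j)))"
  proof (rule sum.cong[OF refl])
    fix i assume "i \<in> I"
    \<comment> \<open>A cancelled pair has \<open>x j = w j\<close>, and \<open>sep\<close> keeps
      its denominator nonzero, so its factor is 1.\<close>
    have "(\<Prod>j\<in>J-{i}. (x i - w j) / (x i - x j)) = (\<Prod>j\<in>I-{i}. (x i - w j) / (x i - x j))"
      by (rule prod.mono_neutral_right) (use finJ sep[OF \<open>i \<in> I\<close>] in \<open>auto simp: I_def\<close>)
    then show "R i = (x i - w i) * (\<Prod>j\<in>I-{i}. (x i - w j) / (x i - x j))" by (simp add: R_def)
  qed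
  also have "\<dots> = (\<Sum>i\<in>I. x i - w i)" by (rule sum_residues) (use finJ inj I_def in auto)
  also have "\<dots> = (\<Sum>i\<in>J. x i - w i)" by (rule sum.mono_neutral_left) (auto simp: finJ I_def)
  also have "\<dots> = (\<Sum>b\<in>K. 2 * l b - M b - U b)"
  proof -
    have "(\<Sum>i\<in>J. x i - w i) = (\<Sum>b\<in>K. \<Sum>u\<in>UNIV. x (b, u) - w (b, u))"
      by (simp add: J_def sum.cartesian_product)
    also have "\<dots> = (\<Sum>b\<in>K. 2 * l b - M b - U b)"
      by (rule sum.cong) (auto simp: UNIV_bool x_def w_def)
    finally show ?thesis .
  qed
  finally have total: "(\<Sum>i\<in>J. R i) = (\<Sum>b\<in>K. 2 * l b - M b - U b)" .
  have prodJ: "(\<Prod>j\<in>J-{(b, u)}. f j) = f (b, \<not> u) * (\<Prod>k\<in>K-{b}. f (k, False) * f (k, True))"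
    if "b \<in> K" for b u and f :: "nat \<times> bool \<Rightarrow> real"
  proof -
    have *: "J - {(b, u)} = insert (b, \<not> u) ((K - {b}) \<times> UNIV)" using that by (auto simp: J_def)
    have "(\<Prod>j\<in>(K-{b}) \<times> (UNIV::bool set). f j) = (\<Prod>k\<in>K-{b}. \<Prod>u\<in>UNIV. f (k, u))"
      by (simp add: prod.cartesian_product)
    also have "\<dots> = (\<Prod>k\<in>K-{b}. f (k, False) * f (k, True))"
      by (simp add: UNIV_bool mult.commute)
    finally show ?thesis using \<open>finite K\<close> by (subst *) (simp add: prod.insert)
  qed
  have "R (b, False) = chain_res K M U l b" if "b \<in> K" for b
    unfolding R_def chain_res_def prodJ[OF that]
    by (simp add: x_def w_def diff_diff_eq algebra_simps cong: prod.cong)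
  moreover have "R (b, True) = - chain_res K M U (l(b := l b + 1)) b" if "b \<in> K" for b
  proof -
    have "(\<Prod>k\<in>K-{b}. (l b + 1 - M k) * (l b - U k) / ((l b + 1 - (l(b := l b + 1)) k) * (l b - (l(b := l b + 1)) k)))
      = (\<Prod>k\<in>K-{b}. (l b + 1 - M k) * (l b - U k) / ((l b + 1 - l k) * (l b - l k)))"
      by (rule prod.cong) auto
    then show ?thesis
      unfolding R_def chain_res_def prodJ[OF that] by (simp add: x_def w_def)
  qed
  moreover have "(\<Sum>i\<in>J. R i) = (\<Sum>b\<in>K. \<Sum>u\<in>UNIV. R (b, u))"
    by (simp add: J_def sum.cartesian_product)
  ultimately have "(\<Sum>i\<in>J. R i) =
      (\<Sum>b\<in>K. chain_res K M U l b - chain_res K M U (l(b := l b + 1)) b)"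
    by (simp add: UNIV_bool)
  then show ?thesis using total by (simp add: sum_subtractf)
qed

text \<open>The range of any other \<open>k\<close> lies wholly on one side of \<open>l b\<close>,
  so the four differences in its factor share a sign; \<open>M b + 1 \<le> l b\<close> keeps
  \<open>l b - l k - 1\<close> positive for \<open>k < b\<close>. The leading product is negative,
  which the minus sign corrects.\<close>

lemma chain_res_pos:
  assumes "finite K" "b \<in> K"
    and box: "\<And>k. k \<in> K \<Longrightarrow> M k \<le> l k \<and> l k \<le> U k"
    and gap: "\<And>k k'. k \<in> K \<Longrightarrow> k' \<in> K \<Longrightarrow> k < k' \<Longrightarrow> U k + 1 \<le> M k'"
    and "M b + 1 \<le> l b"
  shows "0 < chain_res K M U l b"
proof -
  have "0 < (l b - M k) * (l b - U k - 1) / ((l b - l k) * (l b - l k - 1))" if "k \<in> K - {b}" for k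
  proof -
    have "k \<noteq> b" using that by auto
    then consider "k < b" | "b < k" by linarith
    then show ?thesis
    proof cases
      case 1
      have "0 < l b - M k" "0 < l b - U k - 1" "0 < l b - l k" "0 < l b - l k - 1"
        using gap[of k b] box[of k] box[of b] that \<open>b \<in> K\<close> assms(5) 1 by auto
      then show ?thesis by simp
    next
      case 2
      have "l b - M k < 0" "l b - U k - 1 < 0" "l b - l k < 0" "l b - l k - 1 < 0"
        using gap[of b k] box[of k] box[of b] that \<open>b \<in> K\<close> 2 by auto
      then show ?thesis by (simp add: mult_neg_neg)
    qed
  qed
  then have "0 < (\<Prod>k\<in>K-{b}. (l b - M k) * (l b - U k - 1) / ((l b - l k) * (l b - l k - 1)))"
    by (intro prod_pos) auto
  moreover have "(l b - M b) * (l b - U b - 1) < 0"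
    using assms(5) box[OF \<open>b \<in> K\<close>] by (intro mult_pos_neg) auto
  ultimately show ?thesis by (simp add: chain_res_def mult_neg_pos)
qed

section \<open>Gelfand--Tsetlin coefficients\<close>

text \<open>What remains of \<open>X Y\<close> once the factors with \<open>k \<le> 0\<close> cancel; \<open>p\<close>, \<open>q\<close>, \<open>l\<close> are the entries
  of the rows \<open>a + 1\<close>, \<open>a - 1\<close>, \<open>a\<close>, each shifted by its index.\<close>

definition gt_coef ::
  "nat \<Rightarrow> (nat \<Rightarrow> real) \<Rightarrow> (nat \<Rightarrow> real) \<Rightarrow> (nat \<Rightarrow> real) \<Rightarrow> nat \<Rightarrow> real" where
  "gt_coef a p q l b = - ((\<Prod>k=1..a+1. l b - p k) * (\<Prod>k=1..a-1. l b - q k - 1))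
     / (\<Prod>k\<in>{1..a}-{b}. (l b - l k) * (l b - l k - 1))"

text \<open>The rows above and below are shifted by their own index, so comparing position
  \<open>k\<close> with \<open>q (k - 1)\<close> or \<open>p (k + 1)\<close> costs a unit.\<close>

definition box_lo :: "(nat \<Rightarrow> real) \<Rightarrow> (nat \<Rightarrow> real) \<Rightarrow> nat \<Rightarrow> real" where
  "box_lo p q k = (if k = 1 then p 1 else max (p k) (q (k - 1) + 1))"

definition box_hi :: "nat \<Rightarrow> (nat \<Rightarrow> real) \<Rightarrow> (nat \<Rightarrow> real) \<Rightarrow> nat \<Rightarrow> real" where
  "box_hi a p q k = (if k = a then p (a + 1) - 1 else min (p (k + 1) - 1) (q k))"

lemma prod_first_Suc: "(\<Prod>k=1..Suc a. f k) = f 1 * (\<Prod>k=1..a. f (Suc k))"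
  for f :: "nat \<Rightarrow> 'a::comm_monoid_mult"
  by (induction a) (simp_all add: ac_simps)

lemma sum_first_Suc: "(\<Sum>k=1..Suc a. f k) = f 1 + (\<Sum>k=1..a. f (Suc k))"
  for f :: "nat \<Rightarrow> 'a::comm_monoid_add"
  by (induction a) (simp_all add: ac_simps)

text \<open>\<open>box_lo p q (k + 1)\<close> and \<open>box_hi a p q k + 1\<close> are the maximum
  and the minimum of the same two numbers \<open>p (k + 1)\<close> and \<open>q k + 1\<close>, and a
  product over both forgets which is which. The first lower and the last upper bound have no
  partner.\<close>

lemma prod_box:
  assumes "1 \<le> a"
  shows "(\<Prod>k=1..a+1. z - p k) * (\<Prod>k=1..a-1. z - q k - 1)
    = (\<Prod>k=1..a. (z - box_lo p q k) * (z - box_hi a p q k - 1))"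
proof -
  obtain a' where a: "a = Suc a'" using assms by (cases a) auto
  have lo: "(\<Prod>k=1..a. z - box_lo p q k) = (z - p 1) * (\<Prod>k=1..a'. z - box_lo p q (Suc k))"
    unfolding a prod_first_Suc by (simp add: box_lo_def)
  have hi: "(\<Prod>k=1..a. z - box_hi a p q k - 1) = (\<Prod>k=1..a'. z - box_hi a p q k - 1) * (z - p (a + 1))"
    unfolding a by (simp add: box_hi_def)
  have p: "(\<Prod>k=1..a+1. z - p k) = (z - p 1) * (\<Prod>k=1..a'. z - p (Suc k)) * (z - p (a + 1))"
    unfolding a using prod_first_Suc[of "\<lambda>k. z - p k" "Suc a'"] by (simp add: ac_simps)
  have pair: "(\<Prod>k=1..a'. z - box_lo p q (Suc k)) * (\<Prod>k=1..a'. z - box_hi a p q k - 1)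
     = (\<Prod>k=1..a'. z - p (Suc k)) * (\<Prod>k=1..a'. z - q k - 1)"
    unfolding prod.distrib[symmetric]
    by (rule prod.cong) (auto simp: box_lo_def box_hi_def a max_def min_def mult.commute diff_diff_eq)
  have q: "(\<Prod>k=1..a-1. z - q k - 1) = (\<Prod>k=1..a'. z - q k - 1)" by (simp add: a)
  have "x * A * y * Q = (x * B) * (C * y)" if "B * C = A * Q" for x y A B C Q :: real
    using that by algebra
  then show ?thesis unfolding prod.distrib lo hi p q using pair by blast
qed

text \<open>The pairing of \<open>prod_box\<close>, now additive. Inside a pair the units cancel;
  the final \<open>- 1\<close> comes from the unpaired bound \<open>p (a + 1) - 1\<close>.\<close>

lemma sum_box:
  assumes "1 \<le> a"
  shows "(\<Sum>k=1..a. box_lo p q k + box_hi a p q k) = (\<Sum>k=1..a+1. p k) + (\<Sum>k=1..a-1. q k) - 1"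
proof -
  obtain a' where a: "a = Suc a'" using assms by (cases a) auto
  have "(\<Sum>k=1..a. box_lo p q k) = p 1 + (\<Sum>k=1..a'. box_lo p q (Suc k))"
    unfolding a sum_first_Suc by (simp add: box_lo_def)
  moreover have "(\<Sum>k=1..a. box_hi a p q k) = (\<Sum>k=1..a'. box_hi a p q k) + p (a + 1) - 1"
    unfolding a by (simp add: box_hi_def)
  moreover have "(\<Sum>k=1..a+1. p k) = p 1 + (\<Sum>k=1..a'. p (Suc k)) + p (a + 1)"
    unfolding a using sum_first_Suc[of p "Suc a'"] by (simp add: ac_simps)
  moreover have "(\<Sum>k=1..a'. box_lo p q (Suc k)) + (\<Sum>k=1..a'. box_hi a p q k)
     = (\<Sum>k=1..a'. p (Suc k)) + (\<Sum>k=1..a'. q k)"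
    unfolding sum.distrib[symmetric]
    by (rule sum.cong) (auto simp: box_lo_def box_hi_def a max_def min_def)
  ultimately show ?thesis by (simp add: sum.distrib a)
qed

lemma gt_coef_eq_chain_res:
  assumes "b \<in> {1..a}"
  shows "gt_coef a p q l b = chain_res {1..a} (box_lo p q) (box_hi a p q) l b"
proof -
  have "1 \<le> a" using assms by auto
  have "(\<Prod>k=1..a+1. l b - p k) * (\<Prod>k=1..a-1. l b - q k - 1)
    = (l b - box_lo p q b) * (l b - box_hi a p q b - 1) *
      (\<Prod>k\<in>{1..a}-{b}. (l b - box_lo p q k) * (l b - box_hi a p q k - 1))"
    unfolding prod_box[OF \<open>1 \<le> a\<close>] using assms by (subst prod.remove[of _ b]) auto
  then show ?thesis by (simp add: gt_coef_def chain_res_def prod_dividef)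
qed

section \<open>Changing one entry of a coefficient\<close>

lemma prod_fun_upd_mult:
  fixes f :: "'k \<Rightarrow> 'b \<Rightarrow> 'a::comm_monoid_mult"
  assumes "finite K" "k \<in> K"
  shows "(\<Prod>i\<in>K. f i ((g(k := y)) i)) * f k (g k) = (\<Prod>i\<in>K. f i (g i)) * f k y"
proof -
  have "(\<Prod>i\<in>K-{k}. f i ((g(k := y)) i)) = (\<Prod>i\<in>K-{k}. f i (g i))" by (rule prod.cong) auto
  then show ?thesis using assms by (simp add: prod.remove[of K k] ac_simps)
qed

text \<open>A numerator factor is exchanged. The cross-multiplied form stays valid when the old
  factor is zero.\<close>

lemma gt_coef_upd_above:
  assumes "k \<in> {1..a+1}"
  shows "gt_coef a (p(k := y)) q l b * (l b - p k) = gt_coef a p q l b * (l b - y)"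
proof -
  have "- (A * B) / C * x = - (A' * B) / C * y" if "A * x = A' * y" for A A' B C x y :: real
  proof -
    have "- (A * B) / C * x = - (A * x) * (B / C)" "- (A' * B) / C * y = - (A' * y) * (B / C)" by simp_all
    then show ?thesis by (simp only: that)
  qed
  then show ?thesis unfolding gt_coef_def
    using prod_fun_upd_mult[of "{1..a+1}" k "\<lambda>i v. l b - v" p y] assms by blast
qed

lemma gt_coef_upd_below:
  assumes "k \<in> {1..a-1}"
  shows "gt_coef a p (q(k := y)) l b * (l b - q k - 1) = gt_coef a p q l b * (l b - y - 1)"
proof -
  have "- (B * A) / C * x = - (B * A') / C * y" if "A * x = A' * y" for A A' B C x y :: real
  proof -
    have "- (B * A) / C * x = - (A * x) * (B / C)" "- (B * A') / C * y = - (A' * y) * (B / C)" by simp_all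
    then show ?thesis by (simp only: that)
  qed
  then show ?thesis unfolding gt_coef_def
    using prod_fun_upd_mult[of "{1..a-1}" k "\<lambda>i v. l b - v - 1" q y] assms by blast
qed

text \<open>Here the entry sits in the denominator, so the old and new factors trade places compared
  with the two rules for neighbouring rows, and both must be nonzero.\<close>

lemma gt_coef_upd_same:
  assumes "k \<in> {1..a}" "k \<noteq> b" "(l b - l k) * (l b - l k - 1) \<noteq> 0" "(l b - y) * (l b - y - 1) \<noteq> 0"
  shows "gt_coef a p q (l(k := y)) b * ((l b - y) * (l b - y - 1))
    = gt_coef a p q l b * ((l b - l k) * (l b - l k - 1))"
proof -
  define D where "D g = (\<Prod>i\<in>{1..a}-{b}. (l b - g i) * (l b - g i - 1))" for g :: "nat \<Rightarrow> real"
  define N where "N = (\<Prod>k=1..a+1. l b - p k) * (\<Prod>k=1..a-1. l b - q k - 1)"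
  have D: "D (l(k := y)) * ((l b - l k) * (l b - l k - 1)) = D l * ((l b - y) * (l b - y - 1))"
    unfolding D_def
    using prod_fun_upd_mult[of "{1..a}-{b}" k "\<lambda>i v. (l b - v) * (l b - v - 1)" l y] assms(1,2) by auto
  have g: "gt_coef a p q (l(k := y)) b = - N / D (l(k := y))" "gt_coef a p q l b = - N / D l"
    using assms(2) by (simp_all add: gt_coef_def D_def N_def)
  have "D (l(k := y)) = D l * ((l b - y) * (l b - y - 1)) / ((l b - l k) * (l b - l k - 1))"
    by (subst D[symmetric], subst nonzero_mult_div_cancel_right) (use assms(3) in auto)
  moreover have "- N / (D0 * Y / X) * Y = - N / D0 * X" if "Y \<noteq> 0" for D0 X Y :: real
    using that by simp
  ultimately show ?thesis unfolding g using assms(4) by metis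
qed

section \<open>Cancellation of the factors with nonpositive index\<close>

lemma prod_int_eq: "(\<Prod>k\<in>{1..int K}. f k) = (\<Prod>k=1..K. f (int k))"
  for f :: "int \<Rightarrow> 'a::comm_monoid_mult"
  by (rule prod.reindex_bij_witness[of _ int nat]) auto

lemma prod_Cset:
  fixes f :: "int \<Rightarrow> real"
  assumes "p \<le> n"
  shows "(\<Prod>k\<in>Cset n p. f k) = (\<Prod>k=1..p. f (int k)) * (\<Prod>k\<in>{int p - int n + 1..0}. f k)"
proof -
  have "Cset n p = {1..int p} \<union> {int p - int n + 1..0}" using assms by (auto simp: Cset_def)
  then have "(\<Prod>k\<in>Cset n p. f k) = (\<Prod>k\<in>{1..int p}. f k) * (\<Prod>k\<in>{int p - int n + 1..0}. f k)"
    by (simp add: prod.union_disjoint)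
  then show ?thesis by (simp add: prod_int_eq)
qed

lemma prod_Cset_remove:
  fixes f :: "int \<Rightarrow> real"
  assumes "p \<le> n" "b \<in> {1..p}"
  shows "(\<Prod>k\<in>Cset n p - {int b}. f k) =
    (\<Prod>k\<in>{1..p} - {b}. f (int k)) * (\<Prod>k\<in>{int p - int n + 1..0}. f k)"
proof -
  have disj: "({1..int p} - {int b}) \<inter> {int p - int n + 1..0} = {}" by auto
  have "Cset n p - {int b} = ({1..int p} - {int b}) \<union> {int p - int n + 1..0}"
    using assms by (auto simp: Cset_def)
  then have "(\<Prod>k\<in>Cset n p - {int b}. f k) =
      (\<Prod>k\<in>{1..int p} - {int b}. f k) * (\<Prod>k\<in>{int p - int n + 1..0}. f k)"
    by (simp only: prod.union_disjoint[OF _ _ disj] finite_Diff finite_atLeastAtMost_int)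
  moreover have "(\<Prod>k\<in>{1..int p} - {int b}. f k) = (\<Prod>k\<in>{1..p} - {b}. f (int k))"
    by (rule prod.reindex_bij_witness[of _ int nat]) auto
  ultimately show ?thesis by simp
qed

text \<open>For \<open>k \<le> 0\<close> the entries vanish, so those factors depend on
  \<open>x\<close> and \<open>k\<close> alone and form the tails \<open>Z\<close>. Numerator and
  denominator each collect \<open>(x - 1) * Z (int a - int n + 2) * Z (int a - int n + 1)\<close>.
  The bounds \<open>1 \<le> H a (int b)\<close> and \<open>1 \<le> b\<close> give
  \<open>x \<ge> 2\<close>, so all of this is positive and cancels.\<close>

lemma Xfac_Yfac_eq_gt_coef:
  fixes H :: "nat \<Rightarrow> int \<Rightarrow> real"
  assumes H0: "\<And>p k. k \<le> 0 \<Longrightarrow> H p k = 0" and b: "b \<in> {1..a}" and a: "a < n" and ge: "1 \<le> H a (int b)"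
  shows "Xfac n H a (int b) * Yfac n H a (int b) =
    gt_coef a (\<lambda>k. H (a + 1) (int k) + k) (\<lambda>k. H (a - 1) (int k) + k) (\<lambda>k. H a (int k) + k) b"
proof -
  define x where "x = H a (int b) + real b"
  have x: "2 \<le> x" using ge b by (auto simp: x_def)
  define Z where "Z lo = (\<Prod>k\<in>{lo..0::int}. x - of_int k)" for lo
  have Z: "0 < Z lo" for lo unfolding Z_def by (rule prod_pos) (use x in auto)
  \<comment> \<open>Moving the index by one turns \<open>x - k - 1\<close> into \<open>x - k\<close>
    and pushes one factor, that of \<open>k = 1\<close>, beyond the tail.\<close>
  have Zs: "(\<Prod>k\<in>{lo..0::int}. x - of_int k - 1) = (x - 1) * Z (lo + 1)" if "lo \<le> 0" for lo
  proof -
    have "(\<Prod>k\<in>{lo..0::int}. x - of_int k - 1) = (\<Prod>k\<in>{lo + 1..1::int}. x - of_int k)"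
      by (rule prod.reindex_bij_witness[of _ "\<lambda>k. k - 1" "\<lambda>k. k + 1"]) auto
    also have "{lo + 1..1} = insert 1 {lo + 1..0}" using that by auto
    finally show ?thesis by (simp add: Z_def)
  qed
  define N1 where "N1 = (\<Prod>k=1..a+1. x - (H (a + 1) (int k) + k))"
  define N2 where "N2 = (\<Prod>k=1..a-1. x - (H (a - 1) (int k) + k) - 1)"
  define D1 where "D1 = (\<Prod>k\<in>{1..a} - {b}. x - (H a (int k) + k) - 1)"
  define D2 where "D2 = (\<Prod>k\<in>{1..a} - {b}. x - (H a (int k) + k))"
  have "(\<Prod>k\<in>Cset n (a + 1). H a (int b) - H (a + 1) k + of_int (int b) - of_int k)
      = N1 * Z (int a - int n + 2)"
    using a by (subst prod_Cset) (auto simp: N1_def Z_def x_def H0 algebra_simps)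
  moreover have "(\<Prod>k\<in>Cset n (a - 1). H a (int b) - H (a - 1) k + of_int (int b) - of_int k - 1)
      = N2 * ((x - 1) * Z (int a - int n + 1))"
  proof -
    have "int (a - 1) - int n + 1 = int a - int n" using b by auto
    moreover have "(\<Prod>k\<in>{int a - int n..0}. H a (int b) - H (a - 1) k + of_int (int b) - of_int k - 1)
        = (\<Prod>k\<in>{int a - int n..0}. x - of_int k - 1)"
      by (rule prod.cong) (auto simp: H0 x_def)
    moreover have "(\<Prod>k=1..a-1. H a (int b) - H (a - 1) (int k) + of_int (int b) - of_int (int k) - 1) = N2"
      unfolding N2_def by (rule prod.cong) (auto simp: x_def)
    ultimately show ?thesis using a Zs[of "int a - int n"] by (subst prod_Cset) simp_all
  qed
  moreover have "(\<Prod>k\<in>Cset n a - {int b}. H a (int b) - H a k + of_int (int b) - of_int k - 1)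
      = D1 * ((x - 1) * Z (int a - int n + 2))"
  proof -
    have "(\<Prod>k\<in>{int a - int n + 1..0}. H a (int b) - H a k + of_int (int b) - of_int k - 1)
        = (\<Prod>k\<in>{int a - int n + 1..0}. x - of_int k - 1)"
      by (rule prod.cong) (auto simp: H0 x_def)
    moreover have "(\<Prod>k\<in>{1..a} - {b}. H a (int b) - H a (int k) + of_int (int b) - of_int (int k) - 1) = D1"
      unfolding D1_def by (rule prod.cong) (auto simp: x_def)
    moreover have "int a - int n + 1 + 1 = int a - int n + 2" by simp
    ultimately show ?thesis using a b Zs[of "int a - int n + 1"] by (subst prod_Cset_remove) simp_all
  qed
  moreover have "(\<Prod>k\<in>Cset n a - {int b}. H a (int b) - H a k + of_int (int b) - of_int k)
      = D2 * Z (int a - int n + 1)"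
    using a b by (subst prod_Cset_remove) (auto simp: D2_def Z_def x_def H0 algebra_simps)
  ultimately have "Xfac n H a (int b) * Yfac n H a (int b) =
      - (N1 * Z (int a - int n + 2)) / (D1 * ((x - 1) * Z (int a - int n + 2))) *
      ((N2 * ((x - 1) * Z (int a - int n + 1))) / (D2 * Z (int a - int n + 1)))"
    by (simp only: Xfac_def Yfac_def)
  also have "\<dots> = - (N1 * N2) / (D2 * D1)"
  proof -
    have "- (N1 * z) / (D1 * (y * z)) * ((N2 * (y * w)) / (D2 * w)) = - (N1 * N2) / (D2 * D1)"
      if "z \<noteq> 0" "y \<noteq> 0" "w \<noteq> 0" for y z w :: real using that by simp
    then show ?thesis using Z[of "int a - int n + 2"] Z[of "int a - int n + 1"] x by fastforce
  qed
  finally show ?thesis by (simp add: gt_coef_def N1_def N2_def D1_def D2_def x_def prod.distrib)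
qed

section \<open>Congruence rules and the ratio identities behind the diamonds\<close>

lemma chain_res_cong:
  assumes "b \<in> K" "\<And>k. k \<in> K \<Longrightarrow> M k = M' k" "\<And>k. k \<in> K \<Longrightarrow> U k = U' k"
    "\<And>k. k \<in> K \<Longrightarrow> l k = l' k"
  shows "chain_res K M U l b = chain_res K M' U' l' b"
proof -
  have "(\<Prod>k\<in>K-{b}. (l b - M k) * (l b - U k - 1) / ((l b - l k) * (l b - l k - 1))) =
    (\<Prod>k\<in>K-{b}. (l' b - M' k) * (l' b - U' k - 1) / ((l' b - l' k) * (l' b - l' k - 1)))"
    using assms by (intro prod.cong) auto
  then show ?thesis using assms by (simp add: chain_res_def)
qed



lemma gt_coef_cong:
  assumes "b \<in> {1..a}" "\<And>k. k \<in> {1..a+1} \<Longrightarrow> p k = p' k" "\<And>k. k \<in> {1..a-1} \<Longrightarrow> q k = q' k"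
    "\<And>k. k \<in> {1..a} \<Longrightarrow> l k = l' k"
  shows "gt_coef a p q l b = gt_coef a p' q' l' b"
proof -
  have "(\<Prod>k=1..a+1. l b - p k) = (\<Prod>k=1..a+1. l' b - p' k)"
    "(\<Prod>k=1..a-1. l b - q k - 1) = (\<Prod>k=1..a-1. l' b - q' k - 1)"
    "(\<Prod>k\<in>{1..a}-{b}. (l b - l k) * (l b - l k - 1)) = (\<Prod>k\<in>{1..a}-{b}. (l' b - l' k) * (l' b - l' k - 1))"
    using assms by (auto intro!: prod.cong)
  then show ?thesis by (simp only: gt_coef_def)
qed

text \<open>\<open>x\<close> and \<open>y\<close> are two shifted entries of one row;
  \<open>P'\<close> and \<open>Q'\<close> are their coefficients after the other entry has dropped
  by one. Without the common factor \<open>x - y\<close> the corrections are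
  \<open>(x - y - 1) / (x - y + 1)\<close> and the same with \<open>x\<close> and \<open>y\<close>
  exchanged, and these are inverse to each other.\<close>

lemma ratio_same_row:
  fixes x y :: real
  assumes "P' * ((x - (y - 1)) * (x - (y - 1) - 1)) = P * ((x - y) * (x - y - 1))"
    and "Q' * ((y - (x - 1)) * (y - (x - 1) - 1)) = Q * ((y - x) * (y - x - 1))"
    and "x \<noteq> y" "x \<noteq> y - 1" "y \<noteq> x - 1"
  shows "P * Q = P' * Q'"
proof -
  have *: "P' * (x - y + 1) = P * (x - y - 1)" "Q' * (y - x + 1) = Q * (y - x - 1)"
    using assms(1,2,3) by (auto simp: algebra_simps) (algebra+)
  have "P' * Q' * ((x - y + 1) * (y - x + 1)) = (P' * (x - y + 1)) * (Q' * (y - x + 1))" by simp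
  also have "\<dots> = P * Q * ((x - y - 1) * (y - x - 1))" unfolding * by simp
  also have "(x - y - 1) * (y - x - 1) = (x - y + 1) * (y - x + 1)" by algebra
  finally have "P' * Q' * ((x - y + 1) * (y - x + 1)) = P * Q * ((x - y + 1) * (y - x + 1))" .
  moreover have "(x - y + 1) * (y - x + 1) \<noteq> 0" using assms(4,5) by auto
  ultimately show ?thesis by (metis mult_right_cancel)
qed

text \<open>Here \<open>y\<close> lies one row above \<open>x\<close>, so each enters the numerator
  of the other's coefficient; again the two corrections are inverse to each other.\<close>

lemma ratio_adjacent_rows:
  fixes x y :: real
  assumes "P' * (x - y) = P * (x - (y - 1))" "Q' * (y - x - 1) = Q * (y - (x - 1) - 1)"
    and "x \<noteq> y" "y \<noteq> x + 1"
  shows "P * Q = P' * Q'"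
proof -
  have "P' * Q' * ((x - y) * (y - x - 1)) = (P' * (x - y)) * (Q' * (y - x - 1))" by simp
  also have "\<dots> = P * Q * ((x - (y - 1)) * (y - (x - 1) - 1))" unfolding assms(1,2) by simp
  also have "(x - (y - 1)) * (y - (x - 1) - 1) = (x - y) * (y - x - 1)" by algebra
  finally show ?thesis using assms(3,4) by simp
qed

lemma ratio_top_row:
  fixes x y :: real
  assumes "P1 * (x - y) = P * (x - (y - 1))" "P2 * (x - (y + 1)) = P1 * (x - y)"
    "P3 * ((x - (y - 1)) * (x - (y - 1) - 1)) = P2 * ((x - y) * (x - y - 1))"
    and ne: "x \<noteq> y" "x \<noteq> y - 1" "x \<noteq> y + 1"
  shows "P3 = P"
proof -
  have "P3 * ((x - (y - 1)) * (x - (y - 1) - 1)) = P2 * (x - (y + 1)) * (x - y)"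
    unfolding assms(3) by algebra
  also have "\<dots> = P * (x - (y - 1)) * (x - y)" unfolding assms(2,1) by simp
  also have "\<dots> = P * ((x - (y - 1)) * (x - (y - 1) - 1))" by algebra
  finally show ?thesis using ne by simp
qed



section \<open>Serre relations from weights\<close>

text \<open>Linearity on all functions, not only on \<open>VL n m\<close>: the commutator calculus
  then carries no membership conditions.\<close>

definition linear_op :: "op \<Rightarrow> bool" where
  "linear_op A \<longleftrightarrow> (\<forall>v w x. A (\<lambda>z. v z + w z) x = A v x + A w x) \<and> (\<forall>c v x. A (\<lambda>z. c * v z) x = c * A v x)"

lemma linear_op_add: "linear_op A \<Longrightarrow> A (\<lambda>z. v z + w z) x = A v x + A w x"
  and linear_op_scale: "linear_op A \<Longrightarrow> A (\<lambda>z. c * v z) x = c * A v x"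
  by (simp_all add: linear_op_def)

lemma linear_op_zero: "linear_op A \<Longrightarrow> A (\<lambda>z. 0) x = 0"
  using linear_op_scale[of A 0 "\<lambda>z. 0"] by simp

lemma linear_op_diff: "linear_op A \<Longrightarrow> A (\<lambda>z. v z - w z) x = A v x - A w x"
  using linear_op_add[of A v "\<lambda>z. (-1) * w z" x] linear_op_scale[of A "-1" w x] by simp

lemma linear_op_opcomm: "linear_op A \<Longrightarrow> linear_op B \<Longrightarrow> linear_op (opcomm A B)"
proof -
  assume A: "linear_op A" and B: "linear_op B"
  have "A (B (\<lambda>z. v z + w z)) x = A (B v) x + A (B w) x" "A (B (\<lambda>z. c * v z)) x = c * A (B v) x"
    if "linear_op A" "linear_op B" for A B v w c x
  proof -
    have "B (\<lambda>z. v z + w z) = (\<lambda>z. B v z + B w z)" "B (\<lambda>z. c * v z) = (\<lambda>z. c * B v z)"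
      using that(2) by (simp_all add: linear_op_def fun_eq_iff)
    then show "A (B (\<lambda>z. v z + w z)) x = A (B v) x + A (B w) x" "A (B (\<lambda>z. c * v z)) x = c * A (B v) x"
      using that(1) by (simp_all add: linear_op_def)
  qed
  then show ?thesis using A B unfolding linear_op_def opcomm_def by (simp add: algebra_simps)
qed

lemma linear_op_funpow: "linear_op A \<Longrightarrow> linear_op B \<Longrightarrow> linear_op ((opcomm A ^^ k) B)"
  by (induction k) (auto intro: linear_op_opcomm)

lemma opcomm_swap: "opcomm A B v x = - opcomm B A v x"
  by (simp add: opcomm_def)

lemma opcomm_jacobi:
  assumes "linear_op a" "linear_op b" "linear_op c"
  shows "opcomm a (opcomm b c) v x = opcomm (opcomm a b) c v x + opcomm b (opcomm a c) v x"
  by (simp add: opcomm_def linear_op_diff assms)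

lemma opcomm_scale_right:
  assumes "linear_op A" "\<And>v x. B v x = c * C v x"
  shows "opcomm A B v x = c * opcomm A C v x"
proof -
  have "B v = (\<lambda>z. c * C v z)" for v using assms(2) by (simp add: fun_eq_iff)
  then show ?thesis using linear_op_scale[OF assms(1)] by (simp add: opcomm_def right_diff_distrib)
qed

lemma opcomm_scale_left:
  assumes "linear_op B" "\<And>v x. A v x = c * C v x"
  shows "opcomm A B v x = c * opcomm C B v x"
proof -
  have "A v = (\<lambda>z. c * C v z)" for v using assms(2) by (simp add: fun_eq_iff)
  then show ?thesis using linear_op_scale[OF assms(1)] by (simp add: opcomm_def right_diff_distrib)
qed

text \<open>Under the adjoint action of an $\mathfrak{sl}_2$-triple $x, y, h$, the operator $w$ is a lowest
  weight vector of weight $-N$, so $\mathrm{ad}(x)^{N+1} w$ must vanish once $\mathrm{ad}(x)$ acts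
  nilpotently.\<close>

lemma serre_from_lowest_weight:
  assumes lin: "linear_op x" "linear_op y" "linear_op h" "linear_op w"
    and xy: "\<And>v z. opcomm x y v z = h v z"
    and hx: "\<And>v z. opcomm h x v z = 2 * x v z"
    and hw: "\<And>v z. opcomm h w v z = - of_nat N * w v z"
    and yw: "\<And>v z. opcomm y w v z = 0"
    and nil: "\<And>v z. (opcomm x ^^ K) w v z = 0"
  shows "(opcomm x ^^ (N + 1)) w v z = 0"
proof -
  define W where "W k = (opcomm x ^^ k) w" for k
  have W: "linear_op (W k)" for k unfolding W_def using lin by (intro linear_op_funpow)
  have WS: "W (Suc k) = opcomm x (W k)" for k by (simp add: W_def)
  have hW: "opcomm h (W k) v z = (2 * of_nat k - of_nat N) * W k v z" for k v z
  proof (induction k arbitrary: v z)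
    case 0
    then show ?case using hw by (simp add: W_def)
  next
    case (Suc k)
    have "opcomm h (W (Suc k)) v z = opcomm (opcomm h x) (W k) v z + opcomm x (opcomm h (W k)) v z"
      unfolding WS using lin W by (intro opcomm_jacobi) auto
    also have "opcomm (opcomm h x) (W k) v z = 2 * opcomm x (W k) v z"
      by (rule opcomm_scale_left[OF W hx])
    also have "opcomm x (opcomm h (W k)) v z = (2 * of_nat k - of_nat N) * opcomm x (W k) v z"
      by (rule opcomm_scale_right[OF lin(1) Suc.IH])
    finally show ?case by (simp add: WS algebra_simps)
  qed
  have yx: "opcomm y x v z = - 1 * h v z" for v z using xy[of v z] opcomm_swap[of y x v z] by simp
  \<comment> \<open>The ladder formula of the triple. Its coefficient vanishes only for
    \<open>k = N\<close>, so from any higher level the vanishing of \<open>W (Suc k)\<close> passes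
    down to \<open>W k\<close>.\<close>
  have yW: "opcomm y (W (Suc k)) v z = of_nat (Suc k) * (of_nat N - of_nat k) * W k v z" for k v z
  proof (induction k arbitrary: v z)
    case 0
    have y0: "opcomm y (W 0) v z = 0 * W 0 v z" for v z using yw by (simp add: W_def)
    have "opcomm y (W (Suc 0)) v z = opcomm (opcomm y x) (W 0) v z + opcomm x (opcomm y (W 0)) v z"
      unfolding WS using lin W by (intro opcomm_jacobi) auto
    also have "opcomm (opcomm y x) (W 0) v z = - 1 * opcomm h (W 0) v z"
      by (rule opcomm_scale_left[OF W yx])
    also have "opcomm x (opcomm y (W 0)) v z = 0 * opcomm x (W 0) v z"
      by (rule opcomm_scale_right[OF lin(1) y0])
    finally show ?case by (simp add: hW)
  next
    case (Suc k)
    have "opcomm y (W (Suc (Suc k))) v z =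
        opcomm (opcomm y x) (W (Suc k)) v z + opcomm x (opcomm y (W (Suc k))) v z"
      unfolding WS[of "Suc k"] using lin W by (intro opcomm_jacobi) auto
    also have "opcomm (opcomm y x) (W (Suc k)) v z = - 1 * opcomm h (W (Suc k)) v z"
      by (rule opcomm_scale_left[OF W yx])
    also have "opcomm x (opcomm y (W (Suc k))) v z = of_nat (Suc k) * (of_nat N - of_nat k) * opcomm x (W k) v z"
      by (rule opcomm_scale_right[OF lin(1) Suc.IH])
    finally show ?case by (simp add: hW WS[symmetric] algebra_simps)
  qed
  have up: "W (K + d) v z = 0" for d v z
  proof (induction d arbitrary: v z)
    case 0
    then show ?case using nil by (simp add: W_def)
  next
    case (Suc d)
    then have "W (K + d) = (\<lambda>v z. 0)" by (simp add: fun_eq_iff)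
    then show ?case using linear_op_zero[OF lin(1)] by (simp add: WS opcomm_def)
  qed
  \<comment> \<open>The descent starts at \<open>N + 1 + K\<close>, which is beyond \<open>K\<close>
    where nilpotency applies, and stops at \<open>N + 1\<close>, just above the zero
    coefficient.\<close>
  have "\<forall>v z. W k v z = 0" if "k \<le> N + 1 + K" "N + 1 \<le> k" for k
    using that
  proof (induction k rule: inc_induct)
    case base
    then show ?case using up[of "N + 1"] by (simp add: add.commute)
  next
    case (step k)
    show ?case
    proof (intro allI)
      fix v z
      have zero: "W (Suc k) = (\<lambda>v z. 0)" using step.IH step.prems by (simp add: fun_eq_iff)
      have "opcomm y (W (Suc k)) v z = 0" unfolding zero opcomm_def using linear_op_zero[OF lin(2)] by simp
      moreover have "(of_nat (Suc k) :: complex) \<noteq> 0" unfolding of_nat_eq_0_iff by simp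
      moreover have "(of_nat N :: complex) - of_nat k \<noteq> 0" using step.prems by simp
      ultimately show "W k v z = 0" using yW[of k v z] by simp
    qed
  qed
  then show ?thesis by (simp add: W_def del: funpow.simps)
qed

section \<open>Separation of subspaces\<close>

text \<open>A vector outside a subspace is detected by a functional that kills the subspace.
  Induction on the coordinates: if some \<open>w1\<close> in \<open>W\<close> has value 1 at the new
  coordinate, everything is reduced modulo \<open>w1\<close> to vectors that vanish there.\<close>

lemma separating_functional:
  fixes W :: "('a \<Rightarrow> 'b::field) set"
  assumes "finite S"
    and "\<And>v w. v \<in> W \<Longrightarrow> w \<in> W \<Longrightarrow> (\<lambda>z. v z + w z) \<in> W" "\<And>c v. v \<in> W \<Longrightarrow> (\<lambda>z. c * v z) \<in> W"
    and "\<And>v x. v \<in> W \<Longrightarrow> x \<notin> S \<Longrightarrow> v x = 0"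
    and "\<And>x. x \<notin> S \<Longrightarrow> u x = 0" "u \<notin> W" "(\<lambda>_. 0) \<in> W"
  shows "\<exists>g. (\<forall>w\<in>W. (\<Sum>x\<in>S. w x * g x) = 0) \<and> (\<Sum>x\<in>S. u x * g x) \<noteq> 0"
  using assms
proof (induction S arbitrary: W u rule: finite_induct)
  case empty
  then have "u = (\<lambda>_. 0)" by (simp add: fun_eq_iff)
  then show ?case using empty by simp
next
  case (insert s S W u)
  note add = insert.prems(1) and scale = insert.prems(2) and supp = insert.prems(3)
  show ?case
  proof (cases "\<forall>w\<in>W. w s = 0")
    case True
    show ?thesis
    proof (cases "u s = 0")
      case False
      have "(\<Sum>x\<in>insert s S. w x * (if x = s then 1 else 0)) = w s" for w :: "'a \<Rightarrow> 'b"
        using insert.hyps by (simp add: sum.delta' if_distrib cong: if_cong)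
      then show ?thesis using True False by (intro exI[of _ "\<lambda>x. if x = s then 1 else 0"]) simp
    next
      case u0: True
      have "v x = 0" if "v \<in> W" "x \<notin> S" for v x using True supp that by (cases "x = s") auto
      moreover have "u x = 0" if "x \<notin> S" for x using u0 insert.prems(4) that by (cases "x = s") auto
      ultimately have "\<exists>g. (\<forall>w\<in>W. (\<Sum>x\<in>S. w x * g x) = 0) \<and> (\<Sum>x\<in>S. u x * g x) \<noteq> 0"
        using insert.IH[of W u] add scale insert.prems(5,6) by blast
      then obtain g where "\<forall>w\<in>W. (\<Sum>x\<in>S. w x * g x) = 0" "(\<Sum>x\<in>S. u x * g x) \<noteq> 0" by blast
      then show ?thesis using True u0 insert.hyps by (intro exI[of _ g]) simp
    qed
  next
    case False
    then obtain w0 where w0: "w0 \<in> W" "w0 s \<noteq> 0" by blast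
    define w1 where "w1 = (\<lambda>z. (1 / w0 s) * w0 z)"
    have w1: "w1 \<in> W" unfolding w1_def by (rule scale[OF w0(1)])
    have w1s: "w1 s = 1" using w0(2) by (simp add: w1_def)
    define W' where "W' = {w \<in> W. w s = 0}"
    \<comment> \<open>\<open>u\<close> reduced modulo \<open>w1\<close>, so that its value at
      \<open>s\<close> is 0; membership in \<open>W\<close> is unaffected.\<close>
    define u' where "u' = (\<lambda>z. u z + (- u s) * w1 z)"
    have "u' \<notin> W"
    proof
      assume "u' \<in> W"
      then have "(\<lambda>z. u' z + u s * w1 z) \<in> W" using add scale w1 by blast
      moreover have "(\<lambda>z. u' z + u s * w1 z) = u" by (simp add: u'_def)
      ultimately show False using insert.prems by simp
    qed
    then have "u' \<notin> W'" by (simp add: W'_def)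
    moreover have "(\<lambda>z. v z + w z) \<in> W'" if "v \<in> W'" "w \<in> W'" for v w
      using that add by (simp add: W'_def)
    moreover have "(\<lambda>z. c * v z) \<in> W'" if "v \<in> W'" for c v
      using that scale by (simp add: W'_def)
    moreover have "v x = 0" if "v \<in> W'" "x \<notin> S" for v x
      using that supp by (cases "x = s") (auto simp: W'_def)
    moreover have "u' x = 0" if "x \<notin> S" for x
      using that w1s supp[OF w1] insert.prems(4) by (cases "x = s") (auto simp: u'_def)
    moreover have "(\<lambda>_. 0) \<in> W'" using insert.prems(6) by (simp add: W'_def)
    ultimately have "\<exists>g. (\<forall>w\<in>W'. (\<Sum>x\<in>S. w x * g x) = 0) \<and> (\<Sum>x\<in>S. u' x * g x) \<noteq> 0"
      using insert.IH[of W' u'] by blast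
    then obtain g where g: "\<And>w. w \<in> W' \<Longrightarrow> (\<Sum>x\<in>S. w x * g x) = 0" "(\<Sum>x\<in>S. u' x * g x) \<noteq> 0" by blast
    \<comment> \<open>The value at \<open>s\<close> is chosen so that \<open>w1\<close> pairs to
      zero; then pairing with \<open>g'\<close> factors through the reduction modulo
      \<open>w1\<close>.\<close>
    define g' where "g' = g(s := - (\<Sum>x\<in>S. w1 x * g x))"
    have red: "(\<Sum>x\<in>insert s S. w x * g' x) = (\<Sum>x\<in>S. (w x + (- w s) * w1 x) * g x)" for w
    proof -
      have "(\<Sum>x\<in>S. w x * g' x) = (\<Sum>x\<in>S. w x * g x)"
        by (rule sum.cong) (use insert.hyps in \<open>auto simp: g'_def\<close>)
      moreover have "(\<Sum>x\<in>S. (w x + (- w s) * w1 x) * g x) = (\<Sum>x\<in>S. w x * g x) - w s * (\<Sum>x\<in>S. w1 x * g x)"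
        by (simp add: sum_distrib_left sum_subtractf[symmetric] algebra_simps)
      ultimately show ?thesis using insert.hyps by (simp add: g'_def)
    qed
    show ?thesis
    proof (intro exI[of _ g'] conjI ballI)
      fix w assume "w \<in> W"
      then have "(\<lambda>z. w z + (- w s) * w1 z) \<in> W" by (rule add[OF _ scale[OF w1]])
      then have "(\<lambda>z. w z + (- w s) * w1 z) \<in> W'" using w1s by (simp add: W'_def)
      then show "(\<Sum>x\<in>insert s S. w x * g' x) = 0" unfolding red using g(1) by blast
    next
      show "(\<Sum>x\<in>insert s S. u x * g' x) \<noteq> 0" unfolding red using g(2) by (simp add: u'_def)
    qed
  qed
qed

section \<open>Interlacing of orthogonal arrays\<close>

locale orth_array =
  fixes n m :: nat
  assumes n_ge: "4 \<le> n"
begin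

lemma n_simps [simp]: "\<not> n \<le> n - 2" "\<not> n - 1 \<le> n - 2" "\<not> n - Suc 0 \<le> n - 2"
    "n \<noteq> 0" "n \<noteq> Suc 0" "n \<noteq> 1" "n - Suc 0 \<noteq> 0"
  using n_ge by auto

section \<open>Colored cells as positions of a triangular pattern\<close>

definition row :: "nat \<Rightarrow> nat" where
  "row i = (if i \<le> n - 2 then i else n - 1)"

text \<open>The two colors of the fork share row \<open>n - 1\<close>: \<open>n - 1\<close> owns the
  odd columns and \<open>n\<close> the even ones.\<close>

definition col :: "nat \<Rightarrow> nat \<Rightarrow> nat" where
  "col i j = (if i \<le> n - 2 then j else if i = n - 1 then 2 * j - 1 else 2 * j)"

definition cells :: "nat \<Rightarrow> nat set" where
  "cells i = {j. (i, j) \<in> idx n}"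

text \<open>One formula for both \<open>GD\<close> and \<open>GD'\<close>, selected by the color. In
  row \<open>n\<close> the entries of the other fork color are repeated in adjacent pairs, with a
  leading 0 for color \<open>n - 1\<close>, and a closing \<open>m\<close> where the last place has
  no partner.\<close>

definition entry :: "nat \<Rightarrow> arr \<Rightarrow> nat \<Rightarrow> nat \<Rightarrow> nat" where
  "entry i c p k =
     (if p \<le> n - 1 then gD n c p k
      else if i = n then (if k = n \<and> odd n then m else c (n - 1, (k + 1) div 2))
      else if k = 1 then 0
      else if k = n \<and> even n then m else c (n, k div 2))"

lemma entry_eq_GD:
  assumes "1 \<le> k" "k \<le> n"
  shows "(if i = n then GD' n m c p (int k) else GD n m c p (int k)) = real (entry i c p k)"
proof -
  have "nat (int k) = k" "nat (int k + 1) = k + 1" by auto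
  moreover have "odd n \<Longrightarrow> n div 2 = (n - 1) div 2" "even n \<Longrightarrow> (n + 1) div 2 = n div 2"
    by (auto elim: oddE)
  ultimately show ?thesis using assms by (auto simp: entry_def GD_def GD'_def)
qed

lemma idx_cases:
  assumes "(i, j) \<in> idx n"
  obtains "i \<le> n - 2" "1 \<le> j" "j \<le> i" "row i = i" "col i j = j"
  | "i = n - 1" "1 \<le> j" "j \<le> n div 2" "row i = n - 1" "col i j = 2 * j - 1"
  | "i = n" "1 \<le> j" "j \<le> (n - 1) div 2" "row i = n - 1" "col i j = 2 * j"
proof -
  consider "1 \<le> j" "j \<le> i" "i \<le> n - 2" | "i = n - 1" "1 \<le> j" "j \<le> n div 2"
    | "i = n" "1 \<le> j" "j \<le> (n - 1) div 2"
    using assms by (auto simp: idx_def)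
  then show thesis using that by cases (auto simp: row_def col_def)
qed

lemma idx_bounds:
  assumes "(i, j) \<in> idx n"
  shows "1 \<le> i" "i \<le> n" "1 \<le> j" "1 \<le> row i" "row i \<le> n - 1" "1 \<le> col i j" "col i j \<le> row i"
  using assms n_ge by (cases rule: idx_cases; linarith)+

lemma finite_idx: "finite (idx n)"
proof -
  have "idx n \<subseteq> {0..n} \<times> {0..n}" using n_ge by (auto simp: idx_def)
  then show ?thesis by (rule finite_subset) auto
qed

lemma gD_cell:
  assumes "(i, j) \<in> idx n"
  shows "gD n c (row i) (col i j) = c (i, j)"
  using assms n_ge by (cases rule: idx_cases) (auto simp: gD_def)

lemma odd_col: "1 \<le> j \<Longrightarrow> odd (2 * j - 1 :: nat)"
  by simp

lemma idx_parity:
  assumes "(i, j) \<in> idx n" "row i = n - 1"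
  shows "i = n - 1 \<and> odd (col i j) \<or> i = n \<and> even (col i j)"
proof (cases rule: idx_cases[OF assms(1)])
  case 1
  then show ?thesis using assms(2) by simp
next
  case 2
  then show ?thesis using odd_col[of j] by metis
next
  case 3
  then show ?thesis by simp
qed

lemma col_eq_iff:
  assumes "(i, j) \<in> idx n" "(i', j') \<in> idx n"
  shows "row i = row i' \<and> col i j = col i' j' \<longleftrightarrow> i = i' \<and> j = j'"
proof
  assume *: "row i = row i' \<and> col i j = col i' j'"
  show "i = i' \<and> j = j'"
  proof (cases "row i = n - 1")
    case True
    then have "i = n - 1 \<and> i' = n - 1 \<or> i = n \<and> i' = n"
      using idx_parity[OF assms(1)] idx_parity[OF assms(2)] * by metis
    moreover have "1 \<le> j" "1 \<le> j'" using idx_bounds assms by auto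
    ultimately show ?thesis using * n_ge by (auto simp: col_def split: if_splits)
  next
    case False
    then show ?thesis using * by (auto simp: row_def col_def split: if_splits)
  qed
qed auto

text \<open>With \<open>col_eq_iff\<close> this identifies \<open>idx n\<close> with the triangle of
  all \<open>1 \<le> q \<le> p \<le> n - 1\<close>, so an array can be handled through
  \<open>gD\<close> alone.\<close>

lemma cell_exists:
  assumes "1 \<le> q" "q \<le> p" "p \<le> n - 1"
  obtains i j where "(i, j) \<in> idx n" "row i = p" "col i j = q"
proof (cases "p \<le> n - 2")
  case True
  show ?thesis by (rule that[of p q]) (use assms True in \<open>auto simp: idx_def row_def col_def\<close>)
next
  case False
  then have p: "p = n - 1" using assms by auto
  show ?thesis
  proof (cases "odd q")
    case True
    then obtain r where q: "q = 2 * r + 1" by (auto elim: oddE)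
    show ?thesis by (rule that[of "n - 1" "r + 1"])
      (use assms p q n_ge in \<open>auto simp: idx_def row_def col_def\<close>)
  next
    case False
    then obtain r where q: "q = 2 * r" by (auto elim: evenE)
    show ?thesis by (rule that[of n r])
      (use assms p q n_ge in \<open>auto simp: idx_def row_def col_def\<close>)
  qed
qed

lemma gD_upd:
  assumes "(i, j) \<in> idx n" "1 \<le> q" "q \<le> p" "p \<le> n - 1"
  shows "gD n (c((i, j) := v)) p q = (if p = row i \<and> q = col i j then v else gD n c p q)"
proof -
  obtain i' j' where ij: "(i', j') \<in> idx n" "row i' = p" "col i' j' = q"
    using cell_exists assms by metis
  have "gD n (c((i, j) := v)) p q = (c((i, j) := v)) (i', j')"
    using gD_cell[OF ij(1), of "c((i, j) := v)"] ij by simp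
  moreover have "gD n c p q = c (i', j')" using gD_cell[OF ij(1), of c] ij by simp
  ultimately show ?thesis using col_eq_iff[OF ij(1) assms(1)] ij by auto
qed

lemma LD_outside: "c \<in> LD n m \<Longrightarrow> pq \<notin> idx n \<Longrightarrow> c pq = 0"
  unfolding LD_def is_arr_def by blast

lemma LD_D:
  assumes "c \<in> LD n m" "1 \<le> q" "q \<le> p" "p \<le> n - 2"
  shows "gD n c (p + 1) q \<le> gD n c p q" "gD n c p q \<le> gD n c (p + 1) (q + 1)"
  using assms by (auto simp: LD_def is_arr_def)

text \<open>The entry at \<open>(p - 1, q)\<close> separates the two.\<close>

lemma LD_row_mono_Suc:
  assumes "c \<in> LD n m" "1 \<le> q" "q < p" "p \<le> n - 1"
  shows "gD n c p q \<le> gD n c p (q + 1)"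
proof -
  have "q \<le> p - 1" "p - 1 \<le> n - 2" "p - 1 + 1 = p" using assms by auto
  then show ?thesis using LD_D[OF assms(1,2), of "p - 1"] by (metis order_trans)
qed

lemma LD_row_mono:
  assumes "c \<in> LD n m" "1 \<le> q" "q \<le> q'" "q' \<le> p" "p \<le> n - 1"
  shows "gD n c p q \<le> gD n c p q'"
  using assms(3,4)
proof (induction q' rule: dec_induct)
  case (step k)
  then show ?case using LD_row_mono_Suc[OF assms(1), of k p] assms by auto
qed simp

lemma LD_le_m:
  assumes "c \<in> LD n m" "1 \<le> q" "q \<le> p" "p \<le> n - 1"
  shows "gD n c p q \<le> m"
  using assms(4,2,3)
proof (induction p arbitrary: q rule: inc_induct)
  case base
  have "gD n c (n - 1) q \<le> gD n c (n - 1) (n - 1)"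
    using LD_row_mono[OF assms(1), of q "n - 1" "n - 1"] base by auto
  also have "\<dots> \<le> m" using assms(1) by (auto simp: LD_def is_arr_def)
  finally show ?case .
next
  case (step p)
  have "gD n c p q \<le> gD n c (Suc p) (q + 1)" using LD_D(2)[OF assms(1), of q p] step by auto
  also have "\<dots> \<le> m" using step by auto
  finally show ?case .
qed

lemma entry_cell:
  assumes "(i, j) \<in> idx n"
  shows "entry i c (row i) (col i j) = c (i, j)"
  using gD_cell[OF assms] idx_bounds[OF assms] by (simp add: entry_def)

lemma row_bounds: "i \<in> {1..n} \<Longrightarrow> 1 \<le> row i \<and> row i \<le> n - 1 \<and> row i \<le> i"
  using n_ge by (auto simp: row_def)

text \<open>The condition \<open>odd k \<longleftrightarrow> i = n\<close> says that column
  \<open>k\<close> of row \<open>n - 1\<close> belongs to the other fork color. Place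
  \<open>k\<close> of row \<open>n\<close> is then the first copy of that entry; otherwise it is the
  second copy of the entry to its left.\<close>

lemma entry_top:
  assumes "i = n - 1 \<or> i = n" "1 \<le> k"
  shows "entry i c n k =
    (if k = n \<and> (odd k \<longleftrightarrow> i = n) then m
     else if odd k \<longleftrightarrow> i = n then gD n c (n - 1) k
     else if k = 1 then 0 else gD n c (n - 1) (k - 1))"
proof (cases "odd k")
  case True
  then obtain r where "k = 2 * r + 1" by (auto elim: oddE)
  then show ?thesis using assms n_ge by (auto simp: entry_def gD_def)
next
  case False
  then obtain r where "k = 2 * r" by (auto elim: evenE)
  then show ?thesis using assms n_ge by (auto simp: entry_def gD_def)
qed

lemma entry_above_top:
  assumes i: "i = n - 1 \<or> i = n" and k: "1 \<le> k" "k \<le> n - 1"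
  shows "entry i c n k =
        (if odd k \<longleftrightarrow> i = n then gD n c (n - 1) k else if k = 1 then 0 else gD n c (n - 1) (k - 1))"
    and "entry i c n (k + 1) = (if odd k \<longleftrightarrow> i = n then gD n c (n - 1) k
        else if k + 1 = n then m else gD n c (n - 1) (k + 1))"
  using entry_top[OF i k(1)] entry_top[OF i, of "k + 1"] k n_ge
  by (cases "odd k \<longleftrightarrow> i = n"; auto)+

lemma entry_low: "p \<le> n - 1 \<Longrightarrow> entry i c p k = gD n c p k"
  by (simp add: entry_def)

text \<open>For the fork colors the row above consists of neighbours from row \<open>n - 1\<close>
  itself, so interlacing reduces to monotonicity of that row between 0 and \<open>m\<close>.\<close>

lemma entry_interlace_above:
  assumes "c \<in> LD n m" "i \<in> {1..n}" "k \<in> {1..row i}"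
  shows "entry i c (row i + 1) k \<le> entry i c (row i) k"
    "entry i c (row i) k \<le> entry i c (row i + 1) (k + 1)"
proof -
  have "entry i c (row i + 1) k \<le> entry i c (row i) k \<and>
    entry i c (row i) k \<le> entry i c (row i + 1) (k + 1)"
  proof (cases "i \<le> n - 2")
    case True
    then have "row i = i" "i \<le> n - 1" "i + 1 \<le> n - 1" using n_ge by (auto simp: row_def)
    then show ?thesis using LD_D[OF assms(1), of k i] assms(3) True
      by (simp only: entry_low atLeastAtMost_iff)
  next
    case False
    then have row: "row i = n - 1" by (simp add: row_def)
    have k: "1 \<le> k" "k \<le> n - 1" using assms row by auto
    have i: "i = n - 1 \<or> i = n" using False assms(2) by auto
    have mono: "gD n c (n - 1) q \<le> gD n c (n - 1) (Suc q)" if "1 \<le> q" "q < n - 1" for q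
      using LD_row_mono_Suc[OF assms(1) that] by simp
    have top: "gD n c (n - 1) k \<le> m" using LD_le_m[OF assms(1)] k by simp
    have n: "n - 1 + 1 = n" using n_ge by simp
    have "gD n c (n - 1) (k - 1) \<le> gD n c (n - 1) k" if "k \<noteq> 1" using mono[of "k - 1"] k that by auto
    moreover have "gD n c (n - 1) k \<le> gD n c (n - 1) (k + 1)" if "k + 1 \<noteq> n" using mono[of k] k that by auto
    moreover note entry_above_top[OF i k, of c]
    ultimately show ?thesis
      unfolding row n entry_low[OF order_refl] using top
      by (smt (verit, best) le0 order_refl)
  qed
  then show "entry i c (row i + 1) k \<le> entry i c (row i) k"
    "entry i c (row i) k \<le> entry i c (row i + 1) (k + 1)" by auto
qed

lemma entry_interlace_below:
  assumes "c \<in> LD n m" "i \<in> {1..n}" "1 \<le> k" "k < row i"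
  shows "entry i c (row i) k \<le> entry i c (row i - 1) k"
    "entry i c (row i - 1) k \<le> entry i c (row i) (k + 1)"
proof -
  have *: "k \<le> row i - 1" "row i - 1 \<le> n - 2" "row i - 1 + 1 = row i"
    using assms row_bounds[OF assms(2)] by auto
  then have "row i - 1 \<le> n - 1" "row i \<le> n - 1" using row_bounds[OF assms(2)] by auto
  then show "entry i c (row i) k \<le> entry i c (row i - 1) k"
    "entry i c (row i - 1) k \<le> entry i c (row i) (k + 1)"
    using LD_D[OF assms(1,3) *(1,2)] unfolding *(3) by (simp_all only: entry_low)
qed

section \<open>The range of one entry when its neighbours are fixed\<close>

definition lo :: "nat \<Rightarrow> arr \<Rightarrow> nat \<Rightarrow> nat" where
  "lo i c k = (if k = 1 then entry i c (row i + 1) 1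
     else max (entry i c (row i + 1) k) (entry i c (row i - 1) (k - 1)))"

definition up :: "nat \<Rightarrow> arr \<Rightarrow> nat \<Rightarrow> nat" where
  "up i c k = (if k = row i then entry i c (row i + 1) (row i + 1)
     else min (entry i c (row i + 1) (k + 1)) (entry i c (row i - 1) k))"

lemma lo_geD: "entry i c (row i + 1) k \<le> lo i c k" "k \<noteq> 1 \<Longrightarrow> entry i c (row i - 1) (k - 1) \<le> lo i c k"
  unfolding lo_def by simp_all

lemma up_leD: "up i c k \<le> entry i c (row i + 1) (k + 1)" "k \<noteq> row i \<Longrightarrow> up i c k \<le> entry i c (row i - 1) k"
  unfolding up_def by simp_all

lemma lo_up:
  assumes "c \<in> LD n m" "i \<in> {1..n}" "k \<in> {1..row i}"
  shows "lo i c k \<le> entry i c (row i) k" "entry i c (row i) k \<le> up i c k"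
proof -
  show "lo i c k \<le> entry i c (row i) k"
    using entry_interlace_above(1)[OF assms] entry_interlace_below(2)[OF assms(1,2), of "k - 1"] assms(3)
    by (auto simp: lo_def)
  show "entry i c (row i) k \<le> up i c k"
    using entry_interlace_above(2)[OF assms] entry_interlace_below(1)[OF assms(1,2), of k] assms(3)
    by (auto simp: up_def)
qed

text \<open>For consecutive columns the two bounds are the minimum and the maximum of the same two
  neighbours; longer distances pass through the entries in between.\<close>

lemma up_le_lo:
  assumes "c \<in> LD n m" "i \<in> {1..n}" "k \<in> {1..row i}" "k' \<in> {1..row i}" "k < k'"
  shows "up i c k \<le> lo i c k'"
proof -
  have "Suc k \<le> k'" using assms by simp
  then have "k' \<le> row i \<Longrightarrow> up i c k \<le> lo i c k'"
  proof (induction k' rule: dec_induct)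
    case base
    then show ?case using assms(3) by (auto simp: up_def lo_def)
  next
    case (step l)
    have "up i c k \<le> lo i c l" using step by auto
    also have "\<dots> \<le> up i c l" using lo_up[OF assms(1,2), of l] step assms(3) by force
    also have "\<dots> \<le> lo i c (Suc l)" using step by (auto simp: up_def lo_def)
    finally show ?case .
  qed
  then show ?thesis using assms(4) by simp
qed

lemma gD_cong:
  assumes "\<forall>p q. p \<noteq> i \<longrightarrow> c' (p, q) = c (p, q)" "if p \<le> n - 2 then p \<noteq> i else i \<le> n - 2"
  shows "gD n c' p k = gD n c p k"
proof (cases "p \<le> n - 2")
  case True
  then show ?thesis using assms by (simp add: gD_def)
next
  case False
  then have "n - 1 \<noteq> i" "n \<noteq> i" using assms(2) n_ge by auto
  then show ?thesis using assms(1) False by (simp add: gD_def)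
qed

text \<open>This is the point of having two arrays: the row above color \<open>n - 1\<close> reads
  only column \<open>n\<close> of the array, and conversely, so the neighbouring rows stay constant
  along edges of color \<open>i\<close>.\<close>

lemma entry_neighbour_cong:
  assumes "i \<in> {1..n}" and eq: "\<forall>p q. p \<noteq> i \<longrightarrow> c' (p, q) = c (p, q)"
  shows "entry i c' (row i + 1) k = entry i c (row i + 1) k"
    "entry i c' (row i - 1) k = entry i c (row i - 1) k"
proof -
  have "entry i c' (row i + 1) k = entry i c (row i + 1) k \<and>
    entry i c' (row i - 1) k = entry i c (row i - 1) k"
  proof (cases "i \<le> n - 2")
    case True
    then have row: "row i = i" by (simp add: row_def)
    have low: "i + 1 \<le> n - 1" "i - 1 \<le> n - 1" "i - 1 \<noteq> i" "i - 1 \<le> n - 2"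
      using True n_ge assms(1) by auto
    show ?thesis unfolding row entry_low[OF low(1)] entry_low[OF low(2)]
      using gD_cong[OF eq, of "i + 1"] gD_cong[OF eq, of "i - 1"] True low by simp
  next
    case False
    have row: "row i + 1 = n" "row i - 1 = n - 2" using False n_ge by (auto simp: row_def)
    have n: "\<not> n \<le> n - 1" "n - 2 \<le> n - 1" "n - 2 \<noteq> i" "n - 1 \<noteq> n" using False n_ge by auto
    have i: "i = n - 1 \<or> i = n" using assms(1) False by auto
    have "entry i c' n k = entry i c n k"
      using i by (elim disjE) (use n(1,4) eq in \<open>simp_all add: entry_def\<close>)
    then show ?thesis unfolding row entry_low[OF n(2)]
      using gD_cong[OF eq, of "n - 2"] n(3) by simp
  qed
  then show "entry i c' (row i + 1) k = entry i c (row i + 1) k"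
    "entry i c' (row i - 1) k = entry i c (row i - 1) k" by auto
qed

lemma lo_up_cong:
  assumes "i \<in> {1..n}" "\<forall>p q. p \<noteq> i \<longrightarrow> c' (p, q) = c (p, q)"
  shows "lo i c' k = lo i c k" "up i c' k = up i c k"
  using entry_neighbour_cong[OF assms] by (simp_all add: lo_def up_def)

text \<open>Positions without a cell of color \<open>i\<close> exist only for the fork colors, and
  there both copies in row \<open>n\<close> squeeze the entry to a range of one point.\<close>

lemma entry_frozen:
  assumes "i \<in> {1..n}" "b \<in> {1..row i}" "b \<notin> col i ` cells i"
  shows "entry i c (row i + 1) b = entry i c (row i) b"
    "entry i c (row i + 1) (b + 1) = entry i c (row i) b"
proof -
  have "\<not> i \<le> n - 2" using assms by (auto simp: cells_def idx_def row_def col_def image_def)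
  then have row: "row i = n - 1" and i: "i = n - 1 \<or> i = n" using assms(1) by (auto simp: row_def)
  have parity: "if i = n then odd b else even b"
  proof (rule ccontr)
    obtain i' j' where *: "(i', j') \<in> idx n" "row i' = n - 1" "col i' j' = b"
      using cell_exists[of b "n - 1"] assms(2) row by auto
    assume "\<not> ?thesis"
    moreover have "i' = n - 1 \<and> odd b \<or> i' = n \<and> even b"
      using idx_parity[OF *(1,2)] unfolding *(3) .
    ultimately have "i = i'" using i n_ge by (auto split: if_splits)
    then show False using assms(3) * by (auto simp: cells_def)
  qed
  have "odd b \<longleftrightarrow> i = n" using parity by (cases "i = n") auto
  moreover have b: "1 \<le> b" "b \<le> n - 1" using assms(2) row by auto
  ultimately have "entry i c n b = gD n c (n - 1) b" "entry i c n (b + 1) = gD n c (n - 1) b"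
    using entry_above_top[OF i b, of c] by auto
  moreover have "row i + 1 = n" using row n_ge by simp
  ultimately show "entry i c (row i + 1) b = entry i c (row i) b"
    "entry i c (row i + 1) (b + 1) = entry i c (row i) b"
    by (simp_all only: row entry_low[OF order_refl])
qed

text \<open>The bounds do not see entries of color \<open>i\<close>, so those of the modified array
  are already those of \<open>c\<close>.\<close>

lemma LD_updD:
  assumes "c((i, j) := v) \<in> LD n m" and ij: "(i, j) \<in> idx n"
  shows "lo i c (col i j) \<le> v" "v \<le> up i c (col i j)"
proof -
  have i: "i \<in> {1..n}" and b: "col i j \<in> {1..row i}" using idx_bounds[OF ij] by auto
  have cong: "lo i (c((i, j) := v)) (col i j) = lo i c (col i j)"
    "up i (c((i, j) := v)) (col i j) = up i c (col i j)"
    by (rule lo_up_cong[OF i]; simp)+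
  have entry: "entry i (c((i, j) := v)) (row i) (col i j) = v"
    using entry_cell[OF ij, of "c((i, j) := v)"] by simp
  show "lo i c (col i j) \<le> v"
    using lo_up(1)[OF assms(1) i b] unfolding cong entry .
  show "v \<le> up i c (col i j)"
    using lo_up(2)[OF assms(1) i b] unfolding cong entry .
qed

lemma LD_updI:
  assumes c: "c \<in> LD n m" and ij: "(i, j) \<in> idx n"
  and v: "lo i c (col i j) \<le> v" "v \<le> up i c (col i j)"
  shows "c((i, j) := v) \<in> LD n m"
proof -
  let ?a = "row i" and ?b = "col i j"
  note bd = idx_bounds[OF ij]
  have low: "?a - 1 \<le> n - 1" using bd by simp
  have 1: "gD n c (?a + 1) ?b \<le> v" "v \<le> gD n c (?a + 1) (?b + 1)" if "?a \<le> n - 2"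
  proof -
    have "?a + 1 \<le> n - 1" using that n_ge by simp
    note low = entry_low[OF this]
    show "gD n c (?a + 1) ?b \<le> v"
      using lo_geD(1)[of i c ?b] v(1) unfolding low by (rule order_trans)
    show "v \<le> gD n c (?a + 1) (?b + 1)"
      using v(2) up_leD(1)[of i c ?b] unfolding low by (rule order_trans)
  qed
  have 2: "gD n c (?a - 1) (?b - 1) \<le> v" if "?b \<noteq> 1"
    using lo_geD(2)[of ?b i c, OF that] v(1) unfolding entry_low[OF low] by (rule order_trans)
  have 3: "v \<le> gD n c (?a - 1) ?b" if "?b \<noteq> ?a"
    using v(2) up_leD(2)[of ?b i c, OF that] unfolding entry_low[OF low] by (rule order_trans)
  \<comment> \<open>The cap on the corner entry is hidden in \<open>up\<close>: the last entry of
    row \<open>n\<close> equals \<open>m\<close> for exactly the color that owns the corner.\<close>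
  have 4: "v \<le> m" if "?a = n - 1" "?b = n - 1"
  proof -
    have "i = n - 1 \<and> odd (n - 1) \<or> i = n \<and> even (n - 1)"
      using idx_parity[OF ij that(1)] unfolding that(2) .
    then have "entry i c n n = m" using n_ge entry_top[of i n c] by auto
    moreover have "?a + 1 = n" using that n_ge by simp
    ultimately have "up i c ?b = m" using that by (simp add: up_def)
    then show ?thesis using v by simp
  qed
  have "is_arr n m (c((i, j) := v))"
    unfolding is_arr_def
  proof (intro conjI allI impI)
    fix pq assume "pq \<notin> idx n"
    then show "(c((i, j) := v)) pq = 0" using LD_outside[OF c] ij by auto
  next
    fix p q assume pq: "1 \<le> q \<and> q \<le> p \<and> p \<le> n - 2"
    have le: "1 \<le> q" "q \<le> p" "p \<le> n - 1" "q \<le> p + 1" "q + 1 \<le> p + 1" "1 \<le> q + 1" "p + 1 \<le> n - 1"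
      using pq n_ge by auto
    note eqs = gD_upd[OF ij le(1,2,3)] gD_upd[OF ij le(1,4,7)] gD_upd[OF ij le(6,5,7)]
    show "gD n (c((i, j) := v)) (p + 1) q \<le> gD n (c((i, j) := v)) p q"
    proof -
      have "gD n c (p + 1) q \<le> v" if "p = ?a" "q = ?b" using 1(1) pq that by simp
      moreover have "v \<le> gD n c p q" if "p + 1 = ?a" "q = ?b"
      proof -
        have "?b \<noteq> ?a" "?a - 1 = p" using that le by auto
        then show ?thesis using 3 that by simp
      qed
      ultimately show ?thesis using LD_D(1)[OF c, of q p] pq unfolding eqs by simp
    qed
    show "gD n (c((i, j) := v)) p q \<le> gD n (c((i, j) := v)) (p + 1) (q + 1)"
    proof -
      have "v \<le> gD n c (p + 1) (q + 1)" if "p = ?a" "q = ?b" using 1(2) pq that by simp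
      moreover have "gD n c p q \<le> v" if "p + 1 = ?a" "q + 1 = ?b"
      proof -
        have "?b \<noteq> 1" "?a - 1 = p" "?b - 1 = q" using that le by auto
        then show ?thesis using 2 by simp
      qed
      ultimately show ?thesis using LD_D(2)[OF c, of q p] pq unfolding eqs by simp
    qed
  next
    have le: "1 \<le> n - 1" using n_ge by simp
    show "gD n (c((i, j) := v)) (n - 1) (n - 1) \<le> m"
      unfolding gD_upd[OF ij le order_refl order_refl] using 4 LD_le_m[OF c le order_refl order_refl] by simp
  qed
  then show ?thesis by (simp add: LD_def)
qed

lemma LD_upd_iff:
  assumes "c \<in> LD n m" and "(i, j) \<in> idx n"
  shows "c((i, j) := v) \<in> LD n m \<longleftrightarrow> lo i c (col i j) \<le> v \<and> v \<le> up i c (col i j)"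
  using LD_updI[OF assms] LD_updD[OF _ assms(2)] by blast

section \<open>Edge scalars as residues\<close>

text \<open>Adding the column index makes weakly increasing rows strictly increasing and touching
  ranges disjoint.\<close>

definition shifted :: "nat \<Rightarrow> arr \<Rightarrow> nat \<Rightarrow> nat \<Rightarrow> real" where
  "shifted i c p k = real (entry i c p k) + real k"

lemma Pcoef_eq_gt_coef:
  assumes "(i, j) \<in> idx n" "1 \<le> d (i, j)"
  shows "Pcoef n m d (i, j) =
    gt_coef (row i) (shifted i d (row i + 1)) (shifted i d (row i - 1)) (shifted i d (row i)) (col i j)"
proof -
  define H where "H = (if i = n then GD' n m d else GD n m d)"
  note bd = idx_bounds[OF assms(1)]
  have H: "H p (int k) = real (entry i d p k)" if "k \<in> {1..n}" for p k
    using entry_eq_GD[of k i d p] that by (auto simp: H_def)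
  have bij: "(if i \<le> n - 2 then int j else if i = n - 1 then 2 * int j - 1 else 2 * int j) = int (col i j)"
    using bd(3) by (simp add: col_def)
  have "Pcoef n m d (i, j) = Xfac n H (row i) (int (col i j)) * Yfac n H (row i) (int (col i j))"
    unfolding Pcoef_def by (simp only: Let_def prod.case bij H_def[symmetric] row_def[symmetric])
  also have "\<dots> = gt_coef (row i) (\<lambda>k. H (row i + 1) (int k) + k) (\<lambda>k. H (row i - 1) (int k) + k)
     (\<lambda>k. H (row i) (int k) + k) (col i j)"
  proof (rule Xfac_Yfac_eq_gt_coef)
    show "H p k = 0" if "k \<le> 0" for p k using that by (auto simp: H_def GD_def GD'_def)
    show "col i j \<in> {1..row i}" "row i < n" using bd n_ge by auto
    have "col i j \<in> {1..n}" using bd by auto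
    then show "1 \<le> H (row i) (int (col i j))"
      using assms(2) entry_cell[OF assms(1), of d] by (simp add: H)
  qed
  also have "\<dots> = gt_coef (row i) (shifted i d (row i + 1)) (shifted i d (row i - 1)) (shifted i d (row i)) (col i j)"
  proof -
    have sh: "H p (int k) + k = shifted i d p k" if "k \<in> {1..n}" for p k
      using H[OF that] by (simp add: shifted_def)
    have "col i j \<in> {1..n}" "\<And>k. k \<in> {1..row i + 1} \<Longrightarrow> k \<in> {1..n}" "\<And>k. k \<in> {1..row i - 1} \<Longrightarrow> k \<in> {1..n}"
      "\<And>k. k \<in> {1..row i} - {col i j} \<Longrightarrow> k \<in> {1..n}"
      using bd n_ge by auto
    then show ?thesis by (simp only: gt_coef_def sh cong: prod.cong)
  qed
  finally show ?thesis .
qed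

definition lo_s :: "nat \<Rightarrow> arr \<Rightarrow> nat \<Rightarrow> real" where
  "lo_s i c k = real (lo i c k) + real k"

definition up_s :: "nat \<Rightarrow> arr \<Rightarrow> nat \<Rightarrow> real" where
  "up_s i c k = real (up i c k) + real k"

lemma box_shifted:
  assumes "k \<in> {1..row i}"
  shows "box_lo (shifted i c (row i + 1)) (shifted i c (row i - 1)) k = lo_s i c k"
    "box_hi (row i) (shifted i c (row i + 1)) (shifted i c (row i - 1)) k = up_s i c k"
proof -
  obtain k' where k': "k = Suc k'" using assms by (cases k) auto
  show "box_lo (shifted i c (row i + 1)) (shifted i c (row i - 1)) k = lo_s i c k"
    by (simp add: box_lo_def lo_s_def lo_def shifted_def k' max_def)
  show "box_hi (row i) (shifted i c (row i + 1)) (shifted i c (row i - 1)) k = up_s i c k"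
    by (simp add: box_hi_def up_s_def up_def shifted_def min_def)
qed

lemma Pcoef_eq_chain_res:
  assumes "(i, j) \<in> idx n" "1 \<le> d (i, j)"
  shows "Pcoef n m d (i, j) =
    chain_res {1..row i} (lo_s i d) (up_s i d) (shifted i d (row i)) (col i j)"
proof -
  have "col i j \<in> {1..row i}" using idx_bounds[OF assms(1)] by simp
  then show ?thesis
    unfolding Pcoef_eq_gt_coef[of i j d, OF assms]
    by (simp only: gt_coef_eq_chain_res chain_res_cong[OF _ box_shifted refl])
qed

lemma shifted_box:
  assumes "c \<in> LD n m" "i \<in> {1..n}"
  shows "k \<in> {1..row i} \<Longrightarrow> lo_s i c k \<le> shifted i c (row i) k \<and> shifted i c (row i) k \<le> up_s i c k"
    and "k \<in> {1..row i} \<Longrightarrow> k' \<in> {1..row i} \<Longrightarrow> k < k' \<Longrightarrow> up_s i c k + 1 \<le> lo_s i c k'"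
proof -
  show "k \<in> {1..row i} \<Longrightarrow> lo_s i c k \<le> shifted i c (row i) k \<and> shifted i c (row i) k \<le> up_s i c k"
    using lo_up[OF assms, of k] by (simp add: lo_s_def up_s_def shifted_def)
  assume "k \<in> {1..row i}" "k' \<in> {1..row i}" "k < k'"
  then have "up i c k + k + 1 \<le> lo i c k' + k'" using up_le_lo[OF assms, of k k'] by simp
  then show "up_s i c k + 1 \<le> lo_s i c k'" unfolding lo_s_def up_s_def by linarith
qed

definition raise :: "arr \<Rightarrow> nat \<times> nat \<Rightarrow> arr" where
  "raise c pos = c(pos := c pos + 1)"

definition lower :: "arr \<Rightarrow> nat \<times> nat \<Rightarrow> arr" where
  "lower c pos = c(pos := c pos - 1)"

lemma lower_raise [simp]: "lower (raise c pos) pos = c"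
  by (simp add: lower_def raise_def)

lemma raise_lower: "1 \<le> c pos \<Longrightarrow> raise (lower c pos) pos = c"
  by (simp add: lower_def raise_def)

lemma raise_in_LD_iff:
  assumes "c \<in> LD n m" "(i, j) \<in> idx n"
  shows "raise c (i, j) \<in> LD n m \<longleftrightarrow> c (i, j) < up i c (col i j)"
proof -
  have "lo i c (col i j) \<le> c (i, j)"
    using lo_up(1)[OF assms(1), of i "col i j"] idx_bounds[OF assms(2)] entry_cell[OF assms(2), of c] by simp
  then show ?thesis using LD_upd_iff[OF assms, of "c (i, j) + 1"] by (auto simp: raise_def)
qed

lemma lower_in_LD_iff:
  assumes "c \<in> LD n m" "(i, j) \<in> idx n"
  shows "1 \<le> c (i, j) \<and> lower c (i, j) \<in> LD n m \<longleftrightarrow> lo i c (col i j) < c (i, j)"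
proof -
  have "c (i, j) \<le> up i c (col i j)"
    using lo_up(2)[OF assms(1), of i "col i j"] idx_bounds[OF assms(2)] entry_cell[OF assms(2), of c] by simp
  then show ?thesis using LD_upd_iff[OF assms, of "c (i, j) - 1"] by (auto simp: lower_def)
qed

text \<open>\<open>1 \<le> c pos\<close> excludes the truncated subtraction, for which
  \<open>lower c pos\<close> would be \<open>c\<close> itself.\<close>

definition lowerable :: "arr \<Rightarrow> nat \<times> nat \<Rightarrow> bool" where
  "lowerable c pos \<longleftrightarrow> pos \<in> idx n \<and> c \<in> LD n m \<and> 1 \<le> c pos \<and> lower c pos \<in> LD n m"

lemma Pcoef_pos:
  assumes "lowerable c (i, j)"
  shows "0 < Pcoef n m c (i, j)"
proof -
  have ij: "(i, j) \<in> idx n" and c: "c \<in> LD n m" "1 \<le> c (i, j)" "lower c (i, j) \<in> LD n m"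
    using assms by (auto simp: lowerable_def)
  note bd = idx_bounds[OF ij]
  have i: "i \<in> {1..n}" using bd by auto
  have "lo i c (col i j) + 1 \<le> c (i, j)" using lower_in_LD_iff[OF c(1) ij] c by auto
  then have "lo_s i c (col i j) + 1 \<le> shifted i c (row i) (col i j)"
    by (simp add: lo_s_def shifted_def entry_cell[OF ij])
  then show ?thesis unfolding Pcoef_eq_chain_res[of i j c, OF ij c(2)]
    using bd shifted_box[OF c(1) i] by (intro chain_res_pos) auto
qed

text \<open>Extension by zero lets sums over edges run over the fixed set \<open>cells i\<close>. It
  agrees with the residue, which vanishes when an entry is at its lower bound.\<close>

definition coef :: "arr \<Rightarrow> nat \<times> nat \<Rightarrow> real" where
  "coef c pos = (if lowerable c pos then sqrt (Pcoef n m c pos) else 0)"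

lemma cells_finite: "finite (cells i)"
proof -
  have "cells i \<subseteq> snd ` idx n" by (force simp: cells_def)
  then show ?thesis using finite_idx by (auto intro: finite_subset)
qed

lemma inj_on_col: "inj_on (col i) (cells i)"
  by (rule inj_onI) (use col_eq_iff in \<open>auto simp: cells_def\<close>)

text \<open>Edges exist only at cells of color \<open>i\<close>, while the residues run over the
  whole row. The difference is harmless: an entry that cannot be lowered has \<open>l = M\<close>,
  one that cannot be raised has \<open>l = U\<close>, and a frozen one has both.\<close>

lemma coef_sum:
  assumes t: "t \<in> LD n m" and i: "i \<in> {1..n}"
  shows "(\<Sum>j\<in>cells i. (coef t (i, j))\<^sup>2) - (\<Sum>j\<in>cells i. (coef (raise t (i, j)) (i, j))\<^sup>2) =
    (\<Sum>b=1..row i. 2 * shifted i t (row i) b - lo_s i t b - up_s i t b)"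
proof -
  let ?K = "{1..row i}" and ?l = "shifted i t (row i)"
  define A where "A b = chain_res ?K (lo_s i t) (up_s i t) ?l b" for b
  define B where "B b = chain_res ?K (lo_s i t) (up_s i t) (?l(b := ?l b + 1)) b" for b
  have A: "(coef t (i, j))\<^sup>2 = A (col i j)" if "j \<in> cells i" for j
  proof (cases "lowerable t (i, j)")
    case True
    then have "1 \<le> t (i, j)" "(i, j) \<in> idx n" by (auto simp: lowerable_def)
    then show ?thesis using True Pcoef_pos[OF True] Pcoef_eq_chain_res[of i j t] by (simp add: coef_def A_def)
  next
    case False
    have ij: "(i, j) \<in> idx n" using that by (simp add: cells_def)
    have "\<not> lo i t (col i j) < t (i, j)"
      using False lower_in_LD_iff[OF t ij] t ij by (auto simp: lowerable_def)
    then have "lo i t (col i j) = t (i, j)"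
      using lo_up(1)[OF t i, of "col i j"] idx_bounds[OF ij] by (simp add: entry_cell[OF ij])
    then have "?l (col i j) = lo_s i t (col i j)" by (simp add: shifted_def lo_s_def entry_cell[OF ij])
    then show ?thesis using False by (simp add: coef_def A_def chain_res_def)
  qed
  have B: "(coef (raise t (i, j)) (i, j))\<^sup>2 = B (col i j)" if "j \<in> cells i" for j
  proof (cases "raise t (i, j) \<in> LD n m")
    case True
    have ij: "(i, j) \<in> idx n" using that by (simp add: cells_def)
    note bd = idx_bounds[OF ij]
    have ge: "1 \<le> raise t (i, j) (i, j)" by (simp add: raise_def)
    have low: "lowerable (raise t (i, j)) (i, j)"
      using True t ij ge by (simp add: lowerable_def)
    have "Pcoef n m (raise t (i, j)) (i, j) = B (col i j)"
      unfolding Pcoef_eq_chain_res[of i j "raise t (i, j)", OF ij ge] B_def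
    proof (rule chain_res_cong)
      show "col i j \<in> ?K" using bd by simp
      fix k assume k: "k \<in> ?K"
      show "lo_s i (raise t (i, j)) k = lo_s i t k" "up_s i (raise t (i, j)) k = up_s i t k"
        using lo_up_cong[OF i, of "raise t (i, j)" t k] by (simp_all add: lo_s_def up_s_def raise_def)
      have "row i \<le> n - 1" using bd by simp
      then show "shifted i (raise t (i, j)) (row i) k = (?l(col i j := ?l (col i j) + 1)) k"
        using gD_upd[OF ij, of k "row i" t "t (i, j) + 1"] k gD_cell[OF ij, of t]
        by (simp add: shifted_def raise_def entry_low)
    qed
    then show ?thesis using low Pcoef_pos[OF low] by (simp add: coef_def)
  next
    case False
    have ij: "(i, j) \<in> idx n" using that by (simp add: cells_def)
    have "up i t (col i j) = t (i, j)"
      using False raise_in_LD_iff[OF t ij] lo_up(2)[OF t i, of "col i j"] idx_bounds[OF ij] t ij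
      by (simp add: entry_cell[OF ij])
    then have "?l (col i j) = up_s i t (col i j)" by (simp add: shifted_def up_s_def entry_cell[OF ij])
    then have "B (col i j) = 0" by (simp add: B_def chain_res_def)
    then show ?thesis using False by (simp add: coef_def lowerable_def)
  qed
  have sub: "col i ` cells i \<subseteq> ?K" using idx_bounds by (auto simp: cells_def)
  have frz: "A b = 0 \<and> B b = 0" if b: "b \<in> ?K - col i ` cells i" for b
  proof -
    have "lo i t b = entry i t (row i) b" "up i t b = entry i t (row i) b"
      using entry_frozen[OF i, of b t] lo_up[OF t i, of b] lo_geD(1)[of i t b] up_leD(1)[of i t b] b by auto
    then have "?l b = lo_s i t b" "?l b = up_s i t b" by (simp_all add: shifted_def lo_s_def up_s_def)
    then show ?thesis by (simp add: A_def B_def chain_res_def)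
  qed
  have "(\<Sum>j\<in>cells i. (coef t (i, j))\<^sup>2) = (\<Sum>b\<in>col i ` cells i. A b)"
    by (simp add: sum.reindex[OF inj_on_col] A)
  moreover have "\<dots> = (\<Sum>b\<in>?K. A b)"
    using sub frz by (intro sum.mono_neutral_left) auto
  moreover have "(\<Sum>j\<in>cells i. (coef (raise t (i, j)) (i, j))\<^sup>2) = (\<Sum>b\<in>col i ` cells i. B b)"
    by (simp add: sum.reindex[OF inj_on_col] B)
  moreover have "\<dots> = (\<Sum>b\<in>?K. B b)"
    using sub frz by (intro sum.mono_neutral_left) auto
  moreover have "(\<Sum>b\<in>?K. A b) - (\<Sum>b\<in>?K. B b) = (\<Sum>b\<in>?K. 2 * ?l b - lo_s i t b - up_s i t b)"
    unfolding A_def B_def using shifted_box[OF t i] by (intro sum_chain_res) auto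
  ultimately show ?thesis by simp
qed

section \<open>Components and weights\<close>

lemma LD_le_m_pos: "c \<in> LD n m \<Longrightarrow> pos \<in> idx n \<Longrightarrow> c pos \<le> m"
  using LD_le_m[of c "col (fst pos) (snd pos)" "row (fst pos)"]
    gD_cell[of "fst pos" "snd pos" c] idx_bounds[of "fst pos" "snd pos"] by simp

lemma finite_LD: "finite (LD n m)"
proof (rule finite_subset)
  show "LD n m \<subseteq> {f. \<forall>x. (x \<in> idx n \<longrightarrow> f x \<in> {0..m}) \<and> (x \<notin> idx n \<longrightarrow> f x = 0)}"
    using LD_le_m_pos LD_outside by auto
  show "finite {f. \<forall>x. (x \<in> idx n \<longrightarrow> f x \<in> {0..m}) \<and> (x \<notin> idx n \<longrightarrow> f x = (0::nat))}"
    by (rule finite_set_of_finite_funs) (auto simp: finite_idx)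
qed

lemma edgeD_iff:
  "edgeD n m i s t \<longleftrightarrow> s \<in> LD n m \<and> t \<in> LD n m \<and> (\<exists>j\<in>cells i. t = raise s (i, j))"
  by (auto simp: edgeD_def cells_def raise_def)

lemma edge_pos_raise: "edge_pos s (raise s pos) = pos"
  unfolding edge_pos_def raise_def
proof (rule the_equality)
  fix pos' assume "s(pos := s pos + 1) = s(pos' := s pos' + 1)"
  then have "(s(pos := s pos + 1)) pos = (s(pos' := s pos' + 1)) pos" by (rule fun_cong)
  then show "pos' = pos" by (auto split: if_splits)
qed simp

lemma wtD_diff:
  assumes "\<forall>p q. p \<noteq> i \<longrightarrow> c (p, q) = c' (p, q)"
  shows "wtD n c = wtD n c' + (\<Sum>j\<in>cells i. int (c (i, j)) - int (c' (i, j)))"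
proof -
  have "wtD n c - wtD n c' = (\<Sum>pq\<in>idx n. int (c pq) - int (c' pq))"
    by (simp add: wtD_def sum_subtractf)
  also have "\<dots> = (\<Sum>pq\<in>Pair i ` cells i. int (c pq) - int (c' pq))"
    using assms by (intro sum.mono_neutral_right finite_idx) (auto simp: cells_def image_def)
  also have "\<dots> = (\<Sum>j\<in>cells i. int (c (i, j)) - int (c' (i, j)))"
    by (subst sum.reindex) (auto simp: inj_on_def)
  finally show ?thesis by simp
qed

lemma icomp_agree:
  assumes "c \<in> icomp n m i t" "t \<in> LD n m"
  shows "c \<in> LD n m \<and> (\<forall>p q. p \<noteq> i \<longrightarrow> c (p, q) = t (p, q))"
proof -
  have "(\<lambda>x y. edgeD n m i x y \<or> edgeD n m i y x)\<^sup>*\<^sup>* t c" using assms(1) by (simp add: icomp_def)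
  then show ?thesis
  proof (induction rule: rtranclp_induct)
    case base
    then show ?case using assms(2) by simp
  next
    case (step y z)
    then show ?case by (auto simp: edgeD_def)
  qed
qed

lemma icomp_step:
  assumes "edgeD n m i t t' \<or> edgeD n m i t' t" "c \<in> icomp n m i t'"
  shows "c \<in> icomp n m i t"
  using assms by (auto simp: icomp_def intro: converse_rtranclp_into_rtranclp)

lemma icomp_refl: "t \<in> icomp n m i t"
  by (simp add: icomp_def)

lemma cell_box:
  assumes "t \<in> LD n m" "(i, j) \<in> idx n"
  shows "lo i t (col i j) \<le> t (i, j)" "t (i, j) \<le> up i t (col i j)"
  using lo_up[OF assms(1), of i "col i j"] idx_bounds[OF assms(2)] entry_cell[OF assms(2), of t] by auto

text \<open>The bounds stay constant while entries of color \<open>i\<close> move, so the cells can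
  be filled one at a time; the total gap to the upper bounds decreases.\<close>

lemma icomp_top:
  assumes "t \<in> LD n m" "i \<in> {1..n}"
  shows "\<exists>c\<in>icomp n m i t. \<forall>j\<in>cells i. c (i, j) = up i t (col i j)"
  using assms(1)
proof (induction "\<Sum>j\<in>cells i. up i t (col i j) - t (i, j)" arbitrary: t rule: less_induct)
  case less
  show ?case
  proof (cases "\<forall>j\<in>cells i. t (i, j) = up i t (col i j)")
    case True
    then show ?thesis using icomp_refl by blast
  next
    case False
    then obtain j where j: "j \<in> cells i" "t (i, j) \<noteq> up i t (col i j)" by blast
    then have ij: "(i, j) \<in> idx n" by (simp add: cells_def)
    have lt: "t (i, j) < up i t (col i j)" using cell_box(2)[OF less.prems ij] j by simp
    define t' where "t' = raise t (i, j)"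
    have t': "t' \<in> LD n m" using raise_in_LD_iff[OF less.prems ij] lt by (simp add: t'_def)
    have up': "up i t' k = up i t k" for k
      by (rule lo_up_cong[OF assms(2)]) (simp add: t'_def raise_def)
    have "(\<Sum>j\<in>cells i. up i t' (col i j) - t' (i, j)) < (\<Sum>j\<in>cells i. up i t (col i j) - t (i, j))"
      unfolding up'
    proof (rule sum_strict_mono_ex1[OF cells_finite])
      show "\<forall>k\<in>cells i. up i t (col i k) - t' (i, k) \<le> up i t (col i k) - t (i, k)"
        by (auto simp: t'_def raise_def)
      show "\<exists>k\<in>cells i. up i t (col i k) - t' (i, k) < up i t (col i k) - t (i, k)"
        using j(1) lt by (intro bexI[of _ j]) (auto simp: t'_def raise_def)
    qed
    then obtain c where c: "c \<in> icomp n m i t'" "\<forall>j\<in>cells i. c (i, j) = up i t' (col i j)"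
      using less.hyps t' by blast
    moreover have "edgeD n m i t t'" using less.prems t' j(1) by (auto simp: edgeD_iff t'_def)
    ultimately show ?thesis using icomp_step up' by metis
  qed
qed

lemma icomp_bot:
  assumes "t \<in> LD n m" "i \<in> {1..n}"
  shows "\<exists>c\<in>icomp n m i t. \<forall>j\<in>cells i. c (i, j) = lo i t (col i j)"
  using assms(1)
proof (induction "\<Sum>j\<in>cells i. t (i, j) - lo i t (col i j)" arbitrary: t rule: less_induct)
  case less
  show ?case
  proof (cases "\<forall>j\<in>cells i. t (i, j) = lo i t (col i j)")
    case True
    then show ?thesis using icomp_refl by blast
  next
    case False
    then obtain j where j: "j \<in> cells i" "t (i, j) \<noteq> lo i t (col i j)" by blast
    then have ij: "(i, j) \<in> idx n" by (simp add: cells_def)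
    have lt: "lo i t (col i j) < t (i, j)" using cell_box(1)[OF less.prems ij] j by simp
    define t' where "t' = lower t (i, j)"
    have t': "t' \<in> LD n m" "1 \<le> t (i, j)"
      using lower_in_LD_iff[OF less.prems ij] lt by (simp_all add: t'_def)
    have lo': "lo i t' k = lo i t k" for k
      by (rule lo_up_cong[OF assms(2)]) (simp add: t'_def lower_def)
    have "(\<Sum>j\<in>cells i. t' (i, j) - lo i t' (col i j)) < (\<Sum>j\<in>cells i. t (i, j) - lo i t (col i j))"
      unfolding lo'
    proof (rule sum_strict_mono_ex1[OF cells_finite])
      show "\<forall>k\<in>cells i. t' (i, k) - lo i t (col i k) \<le> t (i, k) - lo i t (col i k)"
        by (auto simp: t'_def lower_def)
      show "\<exists>k\<in>cells i. t' (i, k) - lo i t (col i k) < t (i, k) - lo i t (col i k)"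
        using j(1) lt by (intro bexI[of _ j]) (auto simp: t'_def lower_def)
    qed
    then obtain c where c: "c \<in> icomp n m i t'" "\<forall>j\<in>cells i. c (i, j) = lo i t' (col i j)"
      using less.hyps t' by blast
    moreover have "edgeD n m i t' t"
      using less.prems t' j(1) raise_lower[of t "(i, j)"] unfolding edgeD_iff t'_def by metis
    ultimately show ?thesis using icomp_step lo' by metis
  qed
qed

text \<open>Twice the rank minus the length is twice the total of \<open>t\<close> minus the totals
  of the highest and lowest arrays of the component, which fill all upper and all lower
  bounds.\<close>

lemma mD_eq_sum_cells:
  assumes t: "t \<in> LD n m" and i: "i \<in> {1..n}"
  shows "mD n m i t =
    (\<Sum>j\<in>cells i. 2 * int (t (i, j)) - int (lo i t (col i j)) - int (up i t (col i j)))"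
proof -
  let ?W = "wtD n ` icomp n m i t"
  have fin: "finite ?W"
    by (rule finite_imageI, rule finite_subset[OF _ finite_LD]) (use icomp_agree t in blast)
  have wt: "wtD n c = wtD n t + (\<Sum>j\<in>cells i. int (c (i, j)) - int (t (i, j)))"
    if "c \<in> icomp n m i t" for c
    using icomp_agree[OF that t] by (intro wtD_diff) auto
  have box: "lo i t (col i j) \<le> c (i, j)" "c (i, j) \<le> up i t (col i j)"
    if "c \<in> icomp n m i t" "j \<in> cells i" for c j
  proof -
    note c = icomp_agree[OF that(1) t]
    have "lo i c (col i j) = lo i t (col i j)" "up i c (col i j) = up i t (col i j)"
      using c by (auto intro!: lo_up_cong[OF i])
    then show "lo i t (col i j) \<le> c (i, j)" "c (i, j) \<le> up i t (col i j)"
      using cell_box[of c i j] c that(2) by (auto simp: cells_def)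
  qed
  obtain hi where hi: "hi \<in> icomp n m i t" "\<forall>j\<in>cells i. hi (i, j) = up i t (col i j)"
    using icomp_top[OF t i] by blast
  obtain bt where bt: "bt \<in> icomp n m i t" "\<forall>j\<in>cells i. bt (i, j) = lo i t (col i j)"
    using icomp_bot[OF t i] by blast
  have "Max ?W = wtD n hi"
  proof (rule Max_eqI[OF fin])
    fix w assume "w \<in> ?W"
    then obtain c where c: "c \<in> icomp n m i t" "w = wtD n c" by blast
    show "w \<le> wtD n hi" unfolding c(2) wt[OF c(1)] wt[OF hi(1)]
      using box(2)[OF c(1)] hi(2) by (intro add_left_mono sum_mono) auto
  qed (use hi in blast)
  moreover have "Min ?W = wtD n bt"
  proof (rule Min_eqI[OF fin])
    fix w assume "w \<in> ?W"
    then obtain c where c: "c \<in> icomp n m i t" "w = wtD n c" by blast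
    show "wtD n bt \<le> w" unfolding c(2) wt[OF c(1)] wt[OF bt(1)]
      using box(1)[OF c(1)] bt(2) by (intro add_left_mono sum_mono) auto
  qed (use bt in blast)
  ultimately have "mD n m i t = - (\<Sum>j\<in>cells i. int (hi (i, j)) - int (t (i, j)))
      - (\<Sum>j\<in>cells i. int (bt (i, j)) - int (t (i, j)))"
    by (simp add: mD_def rhoD_def lenD_def wt[OF hi(1)] wt[OF bt(1)])
  also have "\<dots> = (\<Sum>j\<in>cells i. 2 * int (t (i, j)) - int (lo i t (col i j)) - int (up i t (col i j)))"
    unfolding sum_negf[symmetric] sum_subtractf[symmetric]
    by (rule sum.cong) (use hi bt in auto)
  finally show ?thesis .
qed

section \<open>Weights as second differences of row sums\<close>

definition row_sum :: "nat \<Rightarrow> arr \<Rightarrow> nat \<Rightarrow> int" where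
  "row_sum i c p = (\<Sum>k=1..p. int (entry i c p k))"

lemma chain_sum_cells:
  assumes t: "t \<in> LD n m" and i: "i \<in> {1..n}"
  shows "(\<Sum>b=1..row i. 2 * shifted i t (row i) b - lo_s i t b - up_s i t b) = of_int (mD n m i t)"
proof -
  let ?f = "\<lambda>b. 2 * shifted i t (row i) b - lo_s i t b - up_s i t b"
  have "(\<Sum>b=1..row i. ?f b) = (\<Sum>b\<in>col i ` cells i. ?f b)"
  proof (rule sum.mono_neutral_right)
    show "col i ` cells i \<subseteq> {1..row i}" using idx_bounds by (auto simp: cells_def)
    show "\<forall>b\<in>{1..row i} - col i ` cells i. ?f b = 0"
    proof
      fix b assume b: "b \<in> {1..row i} - col i ` cells i"
      have "lo i t b = entry i t (row i) b" "up i t b = entry i t (row i) b"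
        using entry_frozen[OF i, of b t] lo_up[OF t i, of b] lo_geD(1)[of i t b] up_leD(1)[of i t b] b by auto
      then show "?f b = 0" by (simp add: shifted_def lo_s_def up_s_def)
    qed
  qed simp
  also have "\<dots> = (\<Sum>j\<in>cells i. ?f (col i j))" by (simp add: sum.reindex[OF inj_on_col])
  also have "\<dots> = of_int (mD n m i t)"
    unfolding mD_eq_sum_cells[OF t i] of_int_sum
    by (rule sum.cong) (auto simp: shifted_def lo_s_def up_s_def cells_def entry_cell)
  finally show ?thesis .
qed

lemma sum_shifted: "(\<Sum>k=1..p. shifted i c p k) = of_int (row_sum i c p) + (\<Sum>k=1..p. real k)"
  by (simp add: shifted_def row_sum_def sum.distrib)

text \<open>By \<open>sum_box\<close> the bounds add up to plain row sums. The index shifts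
  contribute \<open>-1\<close> to the second difference, and the \<open>- 1\<close> of
  \<open>sum_box\<close> compensates it.\<close>

lemma mD_eq_row_sums:
  assumes t: "t \<in> LD n m" and i: "i \<in> {1..n}"
  shows "mD n m i t = 2 * row_sum i t (row i) - row_sum i t (row i + 1) - row_sum i t (row i - 1)"
proof -
  have "1 \<le> row i" using row_bounds[OF i] by simp
  then obtain a where a: "row i = Suc a" by (cases "row i") auto
  have "of_int (mD n m i t) = 2 * (\<Sum>b=1..row i. shifted i t (row i) b) - (\<Sum>b=1..row i. lo_s i t b + up_s i t b)"
    unfolding chain_sum_cells[OF t i, symmetric] sum_distrib_left sum_subtractf[symmetric]
    by (rule sum.cong) auto
  also have "(\<Sum>b=1..row i. lo_s i t b + up_s i t b) =
      (\<Sum>b=1..row i. box_lo (shifted i t (row i + 1)) (shifted i t (row i - 1)) b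
       + box_hi (row i) (shifted i t (row i + 1)) (shifted i t (row i - 1)) b)"
    by (rule sum.cong) (simp_all only: box_shifted)
  also have "\<dots> = (\<Sum>k=1..row i+1. shifted i t (row i + 1) k) + (\<Sum>k=1..row i-1. shifted i t (row i - 1) k) - 1"
    by (rule sum_box) fact
  finally have "real_of_int (mD n m i t) =
      of_int (2 * row_sum i t (row i) - row_sum i t (row i + 1) - row_sum i t (row i - 1))"
    unfolding sum_shifted by (simp add: a)
  then show ?thesis by (simp only: of_int_eq_iff)
qed

lemma gD_raise:
  assumes "(i', j') \<in> idx n" "k \<in> {1..p}" "p \<le> n - 1"
  shows "gD n (raise c (i', j')) p k = gD n c p k + (if p = row i' \<and> k = col i' j' then 1 else 0)"
  using gD_upd[OF assms(1), of k p c "c (i', j') + 1"] gD_cell[OF assms(1), of c] assms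
  by (simp add: raise_def)

text \<open>A frozen entry of column \<open>b\<close> occurs in row \<open>n\<close> at
  \<open>b\<close> and \<open>b + 1\<close>. The four cases are the closing \<open>m\<close>, a
  first copy, the leading 0 and a second copy.\<close>

lemma entry_raise_top:
  assumes ij: "(i', j') \<in> idx n" and i: "i = n - 1 \<or> i = n" and k: "k \<in> {1..n}"
  shows "entry i (raise c (i', j')) n k = entry i c n k +
    (if row i' = n - 1 \<and> (odd (col i' j') \<longleftrightarrow> i = n) \<and> (k = col i' j' \<or> k = col i' j' + 1) then 1 else 0)"
proof -
  let ?b = "col i' j'"
  have b: "1 \<le> ?b" "?b \<le> n - 1" using idx_bounds[OF ij] by auto
  have k1: "1 \<le> k" using k by simp
  consider "k = n" "odd k \<longleftrightarrow> i = n" | "k \<noteq> n" "odd k \<longleftrightarrow> i = n" | "\<not> (odd k \<longleftrightarrow> i = n)" "k = 1"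
    | "\<not> (odd k \<longleftrightarrow> i = n)" "k \<noteq> 1" by blast
  then show ?thesis
  proof cases
    case 1
    have "k \<noteq> ?b" using 1 b n_ge by auto
    moreover have "k = ?b + 1 \<Longrightarrow> odd k \<longleftrightarrow> \<not> odd ?b" by simp
    ultimately have "\<not> ((odd ?b \<longleftrightarrow> i = n) \<and> (k = ?b \<or> k = ?b + 1))" using 1(2) by blast
    moreover have "entry i c' n k = m" for c'
      using entry_top[OF i k1, of c'] 1 by simp
    ultimately show ?thesis by auto
  next
    case 2
    then have "k \<in> {1..n - 1}" using k by auto
    note g = gD_raise[OF ij this order_refl, of c]
    have "(odd ?b \<longleftrightarrow> i = n) \<and> (k = ?b \<or> k = ?b + 1) \<longleftrightarrow> k = ?b" using 2 by auto
    moreover have "entry i c' n k = gD n c' (n - 1) k" for c'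
      using entry_top[OF i k1, of c'] 2 by simp
    ultimately show ?thesis using g by auto
  next
    case 3
    then have "\<not> ((odd ?b \<longleftrightarrow> i = n) \<and> (k = ?b \<or> k = ?b + 1))" using b by auto
    moreover have "entry i c' n k = 0" for c'
      using entry_top[OF i k1, of c'] 3 by auto
    ultimately show ?thesis by auto
  next
    case 4
    then have "k - 1 \<in> {1..n - 1}" using k by auto
    note g = gD_raise[OF ij this order_refl, of c]
    have "k - 1 = ?b \<longleftrightarrow> k = ?b + 1" "odd (?b + 1) \<longleftrightarrow> \<not> odd ?b" using k1 by auto
    then have "(odd ?b \<longleftrightarrow> i = n) \<and> (k = ?b \<or> k = ?b + 1) \<longleftrightarrow> k - 1 = ?b" using 4(1) by metis
    moreover have "entry i c' n k = gD n c' (n - 1) (k - 1)" for c'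
      using entry_top[OF i k1, of c'] 4 by auto
    ultimately show ?thesis using g by auto
  qed
qed

lemma row_sum_raise:
  assumes ij: "(i', j') \<in> idx n" and "p \<le> n - 1"
  shows "row_sum i (raise c (i', j')) p = row_sum i c p + (if p = row i' then 1 else 0)"
proof -
  have "row_sum i (raise c (i', j')) p =
      (\<Sum>k=1..p. int (entry i c p k) + (if k = col i' j' then if p = row i' then 1 else 0 else 0))"
    unfolding row_sum_def by (rule sum.cong) (use assms in \<open>auto simp: entry_low gD_raise\<close>)
  also have "\<dots> = row_sum i c p + (if col i' j' \<in> {1..p} then if p = row i' then 1 else 0 else 0)"
    unfolding row_sum_def sum.distrib by (subst sum.delta) auto
  finally show ?thesis using idx_bounds[OF ij] by auto
qed

lemma row_sum_raise_top:
  assumes ij: "(i', j') \<in> idx n" and i: "i = n - 1 \<or> i = n"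
  shows "row_sum i (raise c (i', j')) n =
    row_sum i c n + (if row i' = n - 1 \<and> (odd (col i' j') \<longleftrightarrow> i = n) then 2 else 0)"
proof -
  let ?P = "row i' = n - 1 \<and> (odd (col i' j') \<longleftrightarrow> i = n)"
  have b: "col i' j' \<in> {1..n}" "col i' j' + 1 \<in> {1..n}" using idx_bounds[OF ij] by auto
  have "row_sum i (raise c (i', j')) n = (\<Sum>k=1..n. int (entry i c n k)
      + ((if k = col i' j' then if ?P then 1 else 0 else 0) + (if k = col i' j' + 1 then if ?P then 1 else 0 else 0)))"
    unfolding row_sum_def by (rule sum.cong) (auto simp: entry_raise_top[OF ij i])
  also have "\<dots> = row_sum i c n + (if ?P then 2 else 0)"
    unfolding row_sum_def sum.distrib by (subst (1 2) sum.delta) (use b in auto)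
  finally show ?thesis .
qed

text \<open>Distinct nodes are joined exactly when their rows are adjacent: the ends of the fork
  share a row, hence are not joined, and both neighbour row \<open>n - 2\<close>.\<close>

lemma cartanD_eq:
  assumes "i \<in> {1..n}" "k \<in> {1..n}"
  shows "cartanD n i k =
    (if i = k then 2 else if row i + 1 = row k \<or> row k + 1 = row i then -1 else 0)"
proof -
  have "(\<exists>l. 1 \<le> l \<and> l \<le> n - 2 \<and> {i, k} = {l, l + 1}) \<longleftrightarrow> k = i + 1 \<and> i \<le> n - 2 \<or> i = k + 1 \<and> k \<le> n - 2"
    using assms by (auto simp: doubleton_eq_iff)
  moreover have "{i, k} = {n - 2, n} \<longleftrightarrow> i = n - 2 \<and> k = n \<or> i = n \<and> k = n - 2"
    by (auto simp: doubleton_eq_iff)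
  moreover have "row i + 1 = row k \<longleftrightarrow> k = i + 1 \<and> i \<le> n - 2 \<or> i = n - 2 \<and> k = n"
    if "i \<in> {1..n}" "k \<in> {1..n}" for i k
    using that n_ge by (cases "i \<le> n - 2"; cases "k \<le> n - 2") (auto simp: row_def)
  ultimately show ?thesis using assms by (auto simp: cartanD_def)
qed

lemma cartanD_sym: "cartanD n i k = cartanD n k i"
  by (auto simp: cartanD_def insert_commute)

text \<open>One row sum moves by 1, so its second difference moves by 2 in place and by -1 next to
  it. For the two ends of the fork the shared row contributes 2, and the two copies in row
  \<open>n\<close> take 2 away.\<close>

lemma mD_raise:
  assumes s: "s \<in> LD n m" and t: "raise s (i, j) \<in> LD n m" and ij: "(i, j) \<in> idx n" and k: "k \<in> {1..n}"
  shows "mD n m k (raise s (i, j)) = mD n m k s + cartanD n i k"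
proof -
  have i: "i \<in> {1..n}" using idx_bounds[OF ij] by simp
  note rk = row_bounds[OF k]
  have rows: "row k \<le> n - 1" "row k - 1 \<le> n - 1" "row k - 1 \<noteq> row k" using rk by auto
  note sums = row_sum_raise[OF ij rows(1), of k s] row_sum_raise[OF ij rows(2), of k s]
  show ?thesis
  proof (cases "row k = n - 1")
    case False
    then have le: "row k + 1 \<le> n - 1" using rows by simp
    have "k \<le> n - 2" using False by (auto simp: row_def split: if_splits)
    then have "i = k \<longleftrightarrow> row i = row k" using False by (auto simp: row_def)
    then show ?thesis
      unfolding mD_eq_row_sums[OF s k] mD_eq_row_sums[OF t k] sums row_sum_raise[OF ij le] cartanD_eq[OF i k]
      using rk by auto
  next
    case True
    then have kn: "k = n - 1 \<or> k = n" using k by (auto simp: row_def split: if_splits)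
    have n: "row k + 1 = n" using True n_ge by simp
    have 1: "row i = n - 1 \<Longrightarrow> (odd (col i j) \<longleftrightarrow> k = n) \<longleftrightarrow> i \<noteq> k"
      using idx_parity[OF ij] kn n_ge by auto
    note unf = mD_eq_row_sums[OF s k] mD_eq_row_sums[OF t k] sums n row_sum_raise_top[OF ij kn] cartanD_eq[OF i k]
    show ?thesis
    proof (cases "row i = n - 1")
      case True': True
      have "row k - 1 \<noteq> row i" "row i + 1 \<noteq> row k" "row k + 1 \<noteq> row i" "row k = row i"
        using True True' rk by auto
      then show ?thesis unfolding unf using 1[OF True'] True' by simp
    next
      case False
      have ne: "row k \<noteq> row i" "i \<noteq> k" using True False by auto
      have "row k + 1 \<noteq> row i" using n row_bounds[OF i] n_ge by auto
      moreover have "row k - 1 = row i \<longleftrightarrow> row i + 1 = row k" using rk by auto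
      ultimately show ?thesis unfolding unf using ne False by simp
    qed
  qed
qed

section \<open>Diamond relations\<close>

lemma gD_lower:
  assumes "(i', j') \<in> idx n" "k \<in> {1..p}" "p \<le> n - 1" "1 \<le> c (i', j')"
  shows "real (gD n (lower c (i', j')) p k) =
    real (gD n c p k) - (if p = row i' \<and> k = col i' j' then 1 else 0)"
  using gD_raise[where c="lower c (i', j')", OF assms(1-3)] raise_lower[of c "(i', j')"] assms(4) by simp

lemma shifted_lower:
  assumes "(i', j') \<in> idx n" "k \<in> {1..p}" "p \<le> n - 1" "1 \<le> c (i', j')"
  shows "shifted i (lower c (i', j')) p k =
    (if p = row i' then (shifted i c p)(col i' j' := real (c (i', j')) + real (col i' j') - 1)
     else shifted i c p) k"
  using gD_lower[where c=c, OF assms] gD_cell[OF assms(1), of c] assms(3) by (simp add: shifted_def entry_low)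

lemma shifted_lower_top:
  assumes "(i', j') \<in> idx n" "i = n - 1 \<or> i = n" "k \<in> {1..n}" "1 \<le> c (i', j')"
  shows "shifted i (lower c (i', j')) n k = shifted i c n k -
    (if row i' = n - 1 \<and> (odd (col i' j') \<longleftrightarrow> i = n) \<and> (k = col i' j' \<or> k = col i' j' + 1) then 1 else 0)"
  using entry_raise_top[where c="lower c (i', j')", OF assms(1-3)] raise_lower[of c "(i', j')"] assms(4)
  by (auto simp: shifted_def)

lemma shifted_cell: "(i, j) \<in> idx n \<Longrightarrow> shifted i' c (row i) (col i j) = real (c (i, j)) + real (col i j)"
  using idx_bounds[of i j] by (simp add: shifted_def entry_low gD_cell)

lemma Pcoef_lower_far:
  assumes ij: "(i, j) \<in> idx n" and ij': "(i', j') \<in> idx n" and c: "1 \<le> c (i, j)" "1 \<le> c (i', j')"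
    and far: "row i' \<noteq> row i" "row i' \<noteq> row i + 1" "row i' + 1 \<noteq> row i"
  shows "Pcoef n m (lower c (i', j')) (i, j) = Pcoef n m c (i, j)"
proof -
  note bd = idx_bounds[OF ij]
  have "(i, j) \<noteq> (i', j')" using far by auto
  then have c': "1 \<le> lower c (i', j') (i, j)" using c by (auto simp: lower_def)
  show ?thesis
    unfolding Pcoef_eq_gt_coef[where d="lower c (i', j')", OF ij c'] Pcoef_eq_gt_coef[where d=c, OF ij c(1)]
  proof (rule gt_coef_cong)
    show "col i j \<in> {1..row i}" using bd by simp
    show "shifted i (lower c (i', j')) (row i - 1) k = shifted i c (row i - 1) k" if "k \<in> {1..row i - 1}" for k
    proof -
      have "row i - 1 \<noteq> row i'" "row i - 1 \<le> n - 1" using bd far by auto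
      then show ?thesis using shifted_lower[where c=c and i=i, OF ij' that _ c(2)] by simp
    qed
    show "shifted i (lower c (i', j')) (row i) k = shifted i c (row i) k" if "k \<in> {1..row i}" for k
      using shifted_lower[where c=c and i=i, OF ij' that _ c(2)] bd far by simp
    show "shifted i (lower c (i', j')) (row i + 1) k = shifted i c (row i + 1) k" if "k \<in> {1..row i + 1}" for k
    proof (cases "row i = n - 1")
      case True
      then have i: "i = n - 1 \<or> i = n" using idx_parity[OF ij] by auto
      have n: "row i + 1 = n" using True n_ge by simp
      show ?thesis using shifted_lower_top[where c=c and i=i and k=k, OF ij' i _ c(2)] that far(1) True unfolding n by simp
    next
      case False
      then have "row i + 1 \<le> n - 1" using bd by simp
      then show ?thesis using shifted_lower[where c=c and i=i, OF ij' that _ c(2)] far by simp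
    qed
  qed
qed

lemma Pcoef_lower_same:
  assumes ij: "(i, j) \<in> idx n" and ij': "(i, j') \<in> idx n" and c: "1 \<le> c (i, j)" "1 \<le> c (i, j')"
    and "j \<noteq> j'" and x: "x = real (c (i, j)) + real (col i j)" and y: "y = real (c (i, j')) + real (col i j')"
    and ne: "x \<noteq> y" "x \<noteq> y - 1" "y \<noteq> x - 1"
  shows "Pcoef n m (lower c (i, j')) (i, j) * ((x - (y - 1)) * (x - (y - 1) - 1)) =
    Pcoef n m c (i, j) * ((x - y) * (x - y - 1))"
proof -
  note bd = idx_bounds[OF ij]
  have i: "i \<in> {1..n}" using bd by simp
  have bb: "col i j' \<noteq> col i j" using col_eq_iff[OF ij ij'] \<open>j \<noteq> j'\<close> by auto
  have c': "1 \<le> lower c (i, j') (i, j)" using c \<open>j \<noteq> j'\<close> by (simp add: lower_def)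
  let ?l = "shifted i c (row i)"
  have l: "?l (col i j) = x" "?l (col i j') = y" using shifted_cell[OF ij] shifted_cell[OF ij'] x y by auto
  have "Pcoef n m (lower c (i, j')) (i, j) =
    gt_coef (row i) (shifted i c (row i + 1)) (shifted i c (row i - 1)) (?l(col i j' := y - 1)) (col i j)"
    unfolding Pcoef_eq_gt_coef[where d="lower c (i, j')", OF ij c']
  proof (rule gt_coef_cong)
    show "col i j \<in> {1..row i}" using bd by simp
    show "shifted i (lower c (i, j')) (row i + 1) k = shifted i c (row i + 1) k" for k
      using entry_neighbour_cong(1)[OF i, of "lower c (i, j')" c k] by (simp add: shifted_def lower_def)
    show "shifted i (lower c (i, j')) (row i - 1) k = shifted i c (row i - 1) k" for k
      using entry_neighbour_cong(2)[OF i, of "lower c (i, j')" c k] by (simp add: shifted_def lower_def)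
    show "shifted i (lower c (i, j')) (row i) k = (?l(col i j' := y - 1)) k" if "k \<in> {1..row i}" for k
      using shifted_lower[where c=c and i=i, OF ij' that _ c(2)] bd y by simp
  qed
  then show ?thesis
    unfolding Pcoef_eq_gt_coef[where d=c, OF ij c(1)]
    using gt_coef_upd_same[of "col i j'" "row i" "col i j" ?l "y - 1"] l idx_bounds[OF ij'] bb ne by simp
qed

lemma Pcoef_lower_above:
  assumes ij: "(i, j) \<in> idx n" and ij': "(i', j') \<in> idx n" and c: "1 \<le> c (i, j)" "1 \<le> c (i', j')"
    and r: "row i' = row i + 1"
    and x: "x = real (c (i, j)) + real (col i j)" and y: "y = real (c (i', j')) + real (col i' j')"
  shows "Pcoef n m (lower c (i', j')) (i, j) * (x - y) = Pcoef n m c (i, j) * (x - (y - 1))"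
proof -
  note bd = idx_bounds[OF ij] and bd' = idx_bounds[OF ij']
  have c': "1 \<le> lower c (i', j') (i, j)" using c r by (auto simp: lower_def)
  let ?p = "shifted i c (row i + 1)"
  have l: "shifted i c (row i) (col i j) = x" "?p (col i' j') = y"
    using shifted_cell[OF ij] shifted_cell[OF ij', of i c] x y r by auto
  have "Pcoef n m (lower c (i', j')) (i, j) =
    gt_coef (row i) (?p(col i' j' := y - 1)) (shifted i c (row i - 1)) (shifted i c (row i)) (col i j)"
    unfolding Pcoef_eq_gt_coef[where d="lower c (i', j')", OF ij c']
  proof (rule gt_coef_cong)
    show "col i j \<in> {1..row i}" using bd by simp
    show "shifted i (lower c (i', j')) (row i + 1) k = (?p(col i' j' := y - 1)) k" if "k \<in> {1..row i + 1}" for k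
      using shifted_lower[where c=c and i=i, OF ij' that _ c(2)] bd' y r by simp
    show "shifted i (lower c (i', j')) (row i - 1) k = shifted i c (row i - 1) k" if "k \<in> {1..row i - 1}" for k
    proof -
      have "row i - 1 \<noteq> row i'" "row i - 1 \<le> n - 1" using bd r by auto
      then show ?thesis using shifted_lower[where c=c and i=i, OF ij' that _ c(2)] by simp
    qed
    show "shifted i (lower c (i', j')) (row i) k = shifted i c (row i) k" if "k \<in> {1..row i}" for k
      using shifted_lower[where c=c and i=i, OF ij' that _ c(2)] bd r by simp
  qed
  then show ?thesis
    unfolding Pcoef_eq_gt_coef[where d=c, OF ij c(1)]
    using gt_coef_upd_above[of "col i' j'" "row i" ?p "y - 1" "shifted i c (row i - 1)" "shifted i c (row i)" "col i j"]
      l bd' r by simp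
qed

lemma Pcoef_lower_below:
  assumes ij: "(i, j) \<in> idx n" and ij': "(i', j') \<in> idx n" and c: "1 \<le> c (i, j)" "1 \<le> c (i', j')"
    and r: "row i = row i' + 1"
    and x: "x = real (c (i, j)) + real (col i j)" and y: "y = real (c (i', j')) + real (col i' j')"
  shows "Pcoef n m (lower c (i', j')) (i, j) * (x - y - 1) = Pcoef n m c (i, j) * (x - (y - 1) - 1)"
proof -
  note bd = idx_bounds[OF ij] and bd' = idx_bounds[OF ij']
  have c': "1 \<le> lower c (i', j') (i, j)" using c r by (auto simp: lower_def)
  have r': "row i - 1 = row i'" using r by simp
  let ?q = "shifted i c (row i - 1)"
  have l: "shifted i c (row i) (col i j) = x" "?q (col i' j') = y"
    using shifted_cell[OF ij] shifted_cell[OF ij', of i c] x y r by auto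
  have "Pcoef n m (lower c (i', j')) (i, j) =
    gt_coef (row i) (shifted i c (row i + 1)) (?q(col i' j' := y - 1)) (shifted i c (row i)) (col i j)"
    unfolding Pcoef_eq_gt_coef[where d="lower c (i', j')", OF ij c']
  proof (rule gt_coef_cong)
    show "col i j \<in> {1..row i}" using bd by simp
    show "shifted i (lower c (i', j')) (row i - 1) k = (?q(col i' j' := y - 1)) k" if "k \<in> {1..row i - 1}" for k
      using shifted_lower[where c=c and i=i, OF ij' that _ c(2)] bd' y r' by simp
    show "shifted i (lower c (i', j')) (row i) k = shifted i c (row i) k" if "k \<in> {1..row i}" for k
      using shifted_lower[where c=c and i=i, OF ij' that _ c(2)] bd r by simp
    show "shifted i (lower c (i', j')) (row i + 1) k = shifted i c (row i + 1) k" if "k \<in> {1..row i + 1}" for k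
    proof (cases "row i = n - 1")
      case True
      then have i: "i = n - 1 \<or> i = n" using idx_parity[OF ij] by auto
      have n: "row i + 1 = n" "row i' \<noteq> n - 1" using True n_ge r by simp_all
      show ?thesis using shifted_lower_top[where c=c and i=i and k=k, OF ij' i _ c(2)] that n(2) unfolding n(1) by simp
    next
      case False
      then have "row i + 1 \<le> n - 1" using bd by simp
      then show ?thesis using shifted_lower[where c=c and i=i, OF ij' that _ c(2)] r by simp
    qed
  qed
  then show ?thesis
    unfolding Pcoef_eq_gt_coef[where d=c, OF ij c(1)]
    using gt_coef_upd_below[of "col i' j'" "row i" "shifted i c (row i + 1)" ?q "y - 1" "shifted i c (row i)" "col i j"]
      l bd' r by simp
qed

text \<open>The two ends of the fork do not interact, although they share a row: the doubling in row
  \<open>n\<close> compensates the change within row \<open>n - 1\<close>.\<close>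

lemma Pcoef_lower_top:
  assumes ij: "(i, j) \<in> idx n" and ij': "(i', j') \<in> idx n" and c: "1 \<le> c (i, j)" "1 \<le> c (i', j')"
    and r: "row i = n - 1" "row i' = n - 1" and "i \<noteq> i'"
    and x: "x = real (c (i, j)) + real (col i j)" and y: "y = real (c (i', j')) + real (col i' j')"
    and ne: "x \<noteq> y" "x \<noteq> y - 1" "x \<noteq> y + 1"
  shows "Pcoef n m (lower c (i', j')) (i, j) = Pcoef n m c (i, j)"
proof -
  let ?b = "col i j" and ?b' = "col i' j'"
  note bd = idx_bounds[OF ij] and bd' = idx_bounds[OF ij']
  have c': "1 \<le> lower c (i', j') (i, j)" using c \<open>i \<noteq> i'\<close> by (auto simp: lower_def)
  have i: "i = n - 1 \<or> i = n" using idx_parity[OF ij r(1)] by auto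
  have par: "odd ?b' \<longleftrightarrow> i = n"
    using idx_parity[OF ij r(1)] idx_parity[OF ij' r(2)] \<open>i \<noteq> i'\<close> by auto
  have bb: "?b' \<noteq> ?b" using idx_parity[OF ij r(1)] idx_parity[OF ij' r(2)] \<open>i \<noteq> i'\<close> by auto
  have n: "n - 1 + 1 = n" using n_ge by simp
  have b': "1 \<le> ?b'" "?b' \<le> n - 1" using bd' by auto
  let ?p = "shifted i c n" and ?l = "shifted i c (n - 1)" and ?q = "shifted i c (n - 1 - 1)"
  have l: "?l ?b = x" "?l ?b' = y"
    using shifted_cell[OF ij, of i c] shifted_cell[OF ij', of i c] x y r by auto
  \<comment> \<open>Both copies have the same value, but their columns differ by one, hence
    \<open>y\<close> and \<open>y + 1\<close> after shifting.\<close>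
  have p: "?p ?b' = y" "?p (?b' + 1) = y + 1"
    using entry_above_top[OF i b', of c] par b' gD_cell[OF ij', of c] r y by (auto simp: shifted_def)
  have "Pcoef n m (lower c (i', j')) (i, j) =
    gt_coef (n - 1) (?p(?b' := y - 1, ?b' + 1 := y)) ?q (?l(?b' := y - 1)) ?b"
    unfolding Pcoef_eq_gt_coef[where d="lower c (i', j')", OF ij c'] r(1) n
  proof (rule gt_coef_cong)
    show "?b \<in> {1..n - 1}" using bd r by simp
    show "shifted i (lower c (i', j')) n k = (?p(?b' := y - 1, ?b' + 1 := y)) k" if "k \<in> {1..n - 1 + 1}" for k
      using shifted_lower_top[where c=c and i=i and k=k, OF ij' i _ c(2)] that n r(2) par p by auto
    show "shifted i (lower c (i', j')) (n - 1 - 1) k = ?q k" if "k \<in> {1..n - 1 - 1}" for k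
    proof -
      have "n - 1 - 1 \<noteq> row i'" "n - 1 - 1 \<le> n - 1" using r n_ge by auto
      then show ?thesis using shifted_lower[where c=c and i=i, OF ij' that _ c(2)] by simp
    qed
    show "shifted i (lower c (i', j')) (n - 1) k = (?l(?b' := y - 1)) k" if "k \<in> {1..n - 1}" for k
      using shifted_lower[where c=c and i=i, OF ij' that _ c(2)] r y by simp
  qed
  moreover have "Pcoef n m c (i, j) = gt_coef (n - 1) ?p ?q ?l ?b"
    unfolding Pcoef_eq_gt_coef[where d=c, OF ij c(1)] r(1) n by simp
  moreover have "gt_coef (n - 1) (?p(?b' := y - 1, ?b' + 1 := y)) ?q (?l(?b' := y - 1)) ?b = gt_coef (n - 1) ?p ?q ?l ?b"
  proof (rule ratio_top_row[OF _ _ _ ne])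
    show "gt_coef (n - 1) (?p(?b' := y - 1)) ?q ?l ?b * (x - y) = gt_coef (n - 1) ?p ?q ?l ?b * (x - (y - 1))"
      using gt_coef_upd_above[of ?b' "n - 1" ?p "y - 1" ?q ?l ?b] b' l p by simp
    show "gt_coef (n - 1) (?p(?b' := y - 1, ?b' + 1 := y)) ?q ?l ?b * (x - (y + 1)) =
        gt_coef (n - 1) (?p(?b' := y - 1)) ?q ?l ?b * (x - y)"
      using gt_coef_upd_above[of "?b' + 1" "n - 1" "?p(?b' := y - 1)" y ?q ?l ?b] b' l p by simp
    show "gt_coef (n - 1) (?p(?b' := y - 1, ?b' + 1 := y)) ?q (?l(?b' := y - 1)) ?b * ((x - (y - 1)) * (x - (y - 1) - 1)) =
      gt_coef (n - 1) (?p(?b' := y - 1, ?b' + 1 := y)) ?q ?l ?b * ((x - y) * (x - y - 1))"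
      using gt_coef_upd_same[of ?b' "n - 1" ?b ?l "y - 1"] b' bb l ne by simp
  qed
  ultimately show ?thesis by simp
qed

section \<open>Distances that keep the ratio identities nondegenerate\<close>

lemma row_gap:
  assumes "c \<in> LD n m" "1 \<le> b" "b < b'" "b' \<le> p" "p \<le> n - 1"
  shows "gD n c p b + b + 1 \<le> gD n c p b' + b'"
  using LD_row_mono[OF assms(1), of b b' p] assms by simp

text \<open>Shifted entries of a row differ by at least 1. Applied after lowering the one in the
  larger column, this gives 2 before lowering.\<close>

lemma same_row_distance:
  assumes ij: "(i, j) \<in> idx n" and ij': "(i', j') \<in> idx n" and c: "1 \<le> c (i, j)" "1 \<le> c (i', j')"
    and ne: "(i, j) \<noteq> (i', j')" and r: "row i = row i'"
    and A: "lower c (i', j') \<in> LD n m" and B: "lower c (i, j) \<in> LD n m"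
  shows "c (i, j) + col i j + 2 \<le> c (i', j') + col i' j' \<or> c (i', j') + col i' j' + 2 \<le> c (i, j) + col i j"
proof -
  note bd = idx_bounds[OF ij] and bd' = idx_bounds[OF ij']
  have "col i j \<noteq> col i' j'" using col_eq_iff[OF ij ij'] ne r by auto
  then consider "col i j < col i' j'" | "col i' j' < col i j" by linarith
  then show ?thesis
  proof cases
    case 1
    then show ?thesis
      using row_gap[OF A, of "col i j" "col i' j'" "row i"] bd bd' r c ne
        gD_cell[OF ij, of "lower c (i', j')"] gD_cell[OF ij', of "lower c (i', j')"]
      by (auto simp: lower_def)
  next
    case 2
    then show ?thesis
      using row_gap[OF B, of "col i' j'" "col i j" "row i"] bd bd' r c ne
        gD_cell[OF ij, of "lower c (i, j)"] gD_cell[OF ij', of "lower c (i, j)"]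
      by (auto simp: lower_def)
  qed
qed

text \<open>The asymmetry reflects the columns: with the upper entry strictly to the right, its
  column contributes the extra unit. Exactly the zeros of the factors in
  \<open>ratio_adjacent_rows\<close> are excluded.\<close>

lemma adjacent_row_distance:
  assumes ij: "(i, j) \<in> idx n" and ij': "(i', j') \<in> idx n" and c: "1 \<le> c (i, j)" "1 \<le> c (i', j')"
    and r: "row i' = row i + 1"
    and A: "lower c (i', j') \<in> LD n m" and B: "lower c (i, j) \<in> LD n m"
  shows "c (i, j) + col i j + 2 \<le> c (i', j') + col i' j' \<or> c (i', j') + col i' j' + 1 \<le> c (i, j) + col i j"
proof -
  note bd = idx_bounds[OF ij] and bd' = idx_bounds[OF ij']
  have ii: "i \<noteq> i'" using r by auto
  have le: "row i \<le> n - 2" "row i + 1 \<le> n - 1" using bd' r by auto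
  show ?thesis
  proof (cases "col i' j' \<le> col i j")
    case True
    have "gD n (lower c (i, j)) (row i + 1) (col i' j') \<le> gD n (lower c (i, j)) (row i + 1) (col i j)"
      using LD_row_mono[OF B] True bd bd' le by simp
    also have "\<dots> \<le> gD n (lower c (i, j)) (row i) (col i j)" using LD_D(1)[OF B] bd le by simp
    finally have "c (i', j') \<le> c (i, j) - 1"
      using gD_cell[OF ij, of "lower c (i, j)"] gD_cell[OF ij', of "lower c (i, j)"] r ii
      by (simp add: lower_def)
    then show ?thesis using True c by linarith
  next
    case False
    have "gD n (lower c (i', j')) (row i) (col i j) \<le> gD n (lower c (i', j')) (row i + 1) (col i j + 1)"
      using LD_D(2)[OF A] bd le by simp
    also have "\<dots> \<le> gD n (lower c (i', j')) (row i + 1) (col i' j')"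
      using LD_row_mono[OF A] False bd bd' le r by simp
    finally have "c (i, j) \<le> c (i', j') - 1"
      using gD_cell[OF ij, of "lower c (i', j')"] gD_cell[OF ij', of "lower c (i', j')"] r ii
      by (simp add: lower_def)
    then show ?thesis using False c by linarith
  qed
qed

text \<open>Only the rows matter. For distant rows and for the two ends of the fork each coefficient
  is unchanged; for adjacent rows or equal colors both change, by inverse factors.\<close>

lemma Pcoef_diamond:
  assumes p: "lowerable u (i, j)" and p': "lowerable u (i', j')" and ne: "(i, j) \<noteq> (i', j')"
  shows "Pcoef n m u (i, j) * Pcoef n m u (i', j') =
    Pcoef n m (lower u (i', j')) (i, j) * Pcoef n m (lower u (i, j)) (i', j')"
proof -
  have *: "Pcoef n m u (i, j) * Pcoef n m u (i', j') =
    Pcoef n m (lower u (i', j')) (i, j) * Pcoef n m (lower u (i, j)) (i', j')"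
    if p: "lowerable u (i, j)" and p': "lowerable u (i', j')" and ne: "(i, j) \<noteq> (i', j')"
      and le: "row i \<le> row i'" for i j i' j'
  proof -
    have ij: "(i, j) \<in> idx n" "1 \<le> u (i, j)" and B: "lower u (i, j) \<in> LD n m"
      and ij': "(i', j') \<in> idx n" "1 \<le> u (i', j')" and A: "lower u (i', j') \<in> LD n m"
      using p p' by (auto simp: lowerable_def)
    define x where "x = real (u (i, j)) + real (col i j)"
    define y where "y = real (u (i', j')) + real (col i' j')"
    consider "row i' \<noteq> row i" "row i' \<noteq> row i + 1" | "row i' = row i + 1"
      | "row i' = row i" "i = i'" | "row i' = row i" "i \<noteq> i'" by blast
    then show ?thesis
    proof cases
      case 1
      then show ?thesis
        using Pcoef_lower_far[of i j i' j' u] Pcoef_lower_far[of i' j' i j u] ij ij' le by simp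
    next
      case 2
      have "x + 2 \<le> y \<or> y + 1 \<le> x"
        using adjacent_row_distance[where c=u, OF ij(1) ij'(1) ij(2) ij'(2) 2 A B] unfolding x_def y_def by linarith
      then show ?thesis
        using ratio_adjacent_rows[OF Pcoef_lower_above[where c=u, OF ij(1) ij'(1) ij(2) ij'(2) 2 x_def y_def]
            Pcoef_lower_below[where c=u, OF ij'(1) ij(1) ij'(2) ij(2) 2 y_def x_def]] by force
    next
      case 3
      have d: "x + 2 \<le> y \<or> y + 2 \<le> x"
        using same_row_distance[where c=u, OF ij(1) ij'(1) ij(2) ij'(2) ne 3(1)[symmetric] A B] unfolding x_def y_def by linarith
      have ne': "x \<noteq> y" "x \<noteq> y - 1" "y \<noteq> x - 1" using d by auto
      have jj: "j \<noteq> j'" using ne 3 by simp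
      show ?thesis
        using ratio_same_row[OF Pcoef_lower_same[where c=u, OF ij(1) _ ij(2) _ jj x_def _ ne']
            Pcoef_lower_same[where c=u, OF _ ij(1) _ ij(2) jj[symmetric] _ x_def ne'(1)[symmetric] ne'(3,2)] ne']
          ij' y_def 3(2) by simp
    next
      case 4
      have "x + 2 \<le> y \<or> y + 2 \<le> x"
        using same_row_distance[where c=u, OF ij(1) ij'(1) ij(2) ij'(2) ne 4(1)[symmetric] A B] unfolding x_def y_def by linarith
      then have ne': "x \<noteq> y" "x \<noteq> y - 1" "x \<noteq> y + 1" "y \<noteq> x" "y \<noteq> x - 1" "y \<noteq> x + 1" by auto
      have r: "row i = n - 1" "row i' = n - 1"
        using 4 by (auto simp: row_def split: if_splits)
      show ?thesis
        using Pcoef_lower_top[where c=u, OF ij(1) ij'(1) ij(2) ij'(2) r 4(2) x_def y_def ne'(1-3)]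
          Pcoef_lower_top[where c=u, OF ij'(1) ij(1) ij'(2) ij(2) r(2,1) 4(2)[symmetric] y_def x_def ne'(4-6)] by simp
    qed
  qed
  show ?thesis
  proof (cases "row i \<le> row i'")
    case True
    then show ?thesis using * p p' ne by blast
  next
    case False
    then have "Pcoef n m u (i', j') * Pcoef n m u (i, j) =
      Pcoef n m (lower u (i, j)) (i', j') * Pcoef n m (lower u (i', j')) (i, j)"
      using * p p' ne by (metis nle_le)
    then show ?thesis by (simp add: mult.commute)
  qed
qed

section \<open>Operators and commutators\<close>

text \<open>The defining inequalities compare single entries with each other or with a constant, so
  they survive pointwise maxima.\<close>

lemma LD_max: "c \<in> LD n m \<Longrightarrow> c' \<in> LD n m \<Longrightarrow> (\<lambda>pq. max (c pq) (c' pq)) \<in> LD n m"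
proof -
  assume c: "c \<in> LD n m" "c' \<in> LD n m"
  have g: "gD n (\<lambda>pq. max (c pq) (c' pq)) p q = max (gD n c p q) (gD n c' p q)" for p q
    by (simp add: gD_def)
  have m: "gD n c (n - 1) (n - 1) \<le> m" "gD n c' (n - 1) (n - 1) \<le> m"
    using c by (simp_all add: LD_def is_arr_def)
  have "is_arr n m (\<lambda>pq. max (c pq) (c' pq))"
    unfolding is_arr_def g
  proof (intro conjI allI impI)
    show "max (c pq) (c' pq) = 0" if "pq \<notin> idx n" for pq
      using LD_outside[OF c(1) that] LD_outside[OF c(2) that] by simp
    show "max (gD n c (n - 1) (n - 1)) (gD n c' (n - 1) (n - 1)) \<le> m" using m by simp
    fix p q assume "1 \<le> q \<and> q \<le> p \<and> p \<le> n - 2"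
    then show "max (gD n c (p + 1) q) (gD n c' (p + 1) q) \<le> max (gD n c p q) (gD n c' p q)"
      "max (gD n c p q) (gD n c' p q) \<le> max (gD n c (p + 1) (q + 1)) (gD n c' (p + 1) (q + 1))"
      using LD_D[OF c(1), of q p] LD_D[OF c(2), of q p] by (auto intro!: max.mono)
  qed
  then show ?thesis by (simp add: LD_def)
qed

lemma LD_min: "c \<in> LD n m \<Longrightarrow> c' \<in> LD n m \<Longrightarrow> (\<lambda>pq. min (c pq) (c' pq)) \<in> LD n m"
proof -
  assume c: "c \<in> LD n m" "c' \<in> LD n m"
  have g: "gD n (\<lambda>pq. min (c pq) (c' pq)) p q = min (gD n c p q) (gD n c' p q)" for p q
    by (simp add: gD_def)
  have m: "gD n c (n - 1) (n - 1) \<le> m" "gD n c' (n - 1) (n - 1) \<le> m"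
    using c by (simp_all add: LD_def is_arr_def)
  have "is_arr n m (\<lambda>pq. min (c pq) (c' pq))"
    unfolding is_arr_def g
  proof (intro conjI allI impI)
    show "min (c pq) (c' pq) = 0" if "pq \<notin> idx n" for pq
      using LD_outside[OF c(1) that] LD_outside[OF c(2) that] by simp
    show "min (gD n c (n - 1) (n - 1)) (gD n c' (n - 1) (n - 1)) \<le> m" using m by simp
    fix p q assume "1 \<le> q \<and> q \<le> p \<and> p \<le> n - 2"
    then show "min (gD n c (p + 1) q) (gD n c' (p + 1) q) \<le> min (gD n c p q) (gD n c' p q)"
      "min (gD n c p q) (gD n c' p q) \<le> min (gD n c (p + 1) (q + 1)) (gD n c' (p + 1) (q + 1))"
      using LD_D[OF c(1), of q p] LD_D[OF c(2), of q p] by (auto intro!: min.mono)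
  qed
  then show ?thesis by (simp add: LD_def)
qed

lemma raise_lower_commute: "p \<noteq> q \<Longrightarrow> lower (raise u q) p = raise (lower u p) q"
  by (auto simp: raise_def lower_def fun_upd_twist)

lemma raise_same [simp]: "raise c pos pos = c pos + 1"
  by (simp add: raise_def)

lemma coef_pos: "lowerable c pos \<Longrightarrow> 0 < coef c pos"
  using Pcoef_pos[of c "fst pos" "snd pos"] by (simp add: coef_def)

lemma coef_diamond:
  assumes "lowerable u p" "lowerable u q" "p \<noteq> q" "lowerable (lower u q) p" "lowerable (lower u p) q"
  shows "coef u p * coef u q = coef (lower u q) p * coef (lower u p) q"
  using Pcoef_diamond[of u "fst p" "snd p" "fst q" "snd q"] assms
  by (simp add: coef_def real_sqrt_mult[symmetric])

text \<open>Closure under join and meet makes the two sides vanish simultaneously.\<close>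

lemma coef_swap:
  assumes "p \<noteq> q"
  shows "coef u p * coef (raise (lower u p) q) q = coef (raise u q) q * coef (raise u q) p"
proof -
  define t where "t = raise (lower u p) q"
  define w where "w = raise u q"
  have wp: "w p = u p" and wq: "w q = u q + 1" and tq: "1 \<le> t q"
    using assms by (auto simp: t_def w_def raise_def)
  have lw: "lower w q = u" "lower t q = lower u p" by (simp_all add: t_def w_def)
  have lwp: "lower w p = t" using raise_lower_commute[OF assms] by (simp add: w_def t_def)
  \<comment> \<open>\<open>u\<close> and \<open>t\<close> differ in opposite directions at
    \<open>p\<close> and \<open>q\<close>; their meet and join are the remaining corners of the
    square.\<close>
  have iff: "lower u p \<in> LD n m \<longleftrightarrow> w \<in> LD n m" if "u \<in> LD n m" "t \<in> LD n m" "1 \<le> u p"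
  proof -
    have "(\<lambda>x. min (u x) (t x)) = lower u p" "(\<lambda>x. max (u x) (t x)) = w"
      using assms that(3) by (auto simp: t_def w_def raise_def lower_def fun_eq_iff)
    then show ?thesis using LD_max[OF that(1,2)] LD_min[OF that(1,2)] by simp
  qed
  show ?thesis
  proof (cases "p \<in> idx n \<and> q \<in> idx n \<and> u \<in> LD n m \<and> t \<in> LD n m \<and> 1 \<le> u p \<and> lower u p \<in> LD n m")
    case True
    then have w: "w \<in> LD n m" using iff by simp
    have low: "lowerable u p" "lowerable t q" "lowerable w q" "lowerable w p"
      using True w wp wq lw lwp tq by (auto simp: lowerable_def)
    show ?thesis
      using coef_diamond[OF low(4,3) assms] low lw lwp by (simp add: t_def[symmetric] w_def[symmetric] mult.commute)
  next
    case False
    then have "\<not> (lowerable u p \<and> lowerable t q)" "\<not> (lowerable w q \<and> lowerable w p)"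
      using iff wp lw lwp by (auto simp: lowerable_def)
    then show ?thesis by (auto simp: coef_def t_def[symmetric] w_def[symmetric])
  qed
qed

section \<open>Sums over edges as sums over cells\<close>

lemma in_edges:
  "{t. edgeD n m i t u} = (\<lambda>j. lower u (i, j)) ` {j \<in> cells i. lowerable u (i, j)}"
proof (intro set_eqI iffI)
  fix t assume "t \<in> {t. edgeD n m i t u}"
  then obtain j where "t \<in> LD n m" "u \<in> LD n m" "j \<in> cells i" "u = raise t (i, j)"
    by (auto simp: edgeD_iff)
  then show "t \<in> (\<lambda>j. lower u (i, j)) ` {j \<in> cells i. lowerable u (i, j)}"
    by (intro image_eqI[of _ _ j]) (auto simp: lowerable_def cells_def)
next
  fix t assume "t \<in> (\<lambda>j. lower u (i, j)) ` {j \<in> cells i. lowerable u (i, j)}"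
  then obtain j where j: "j \<in> cells i" "lowerable u (i, j)" "t = lower u (i, j)" by auto
  then have "u = raise t (i, j)" by (simp add: raise_lower lowerable_def)
  then show "t \<in> {t. edgeD n m i t u}" using j by (auto simp: edgeD_iff lowerable_def)
qed

lemma out_edges:
  "{t. edgeD n m i s t} = (\<lambda>j. raise s (i, j)) ` {j \<in> cells i. lowerable (raise s (i, j)) (i, j)}"
proof (intro set_eqI iffI)
  fix t assume "t \<in> {t. edgeD n m i s t}"
  then obtain j where "t \<in> LD n m" "s \<in> LD n m" "j \<in> cells i" "t = raise s (i, j)"
    by (auto simp: edgeD_iff)
  then show "t \<in> (\<lambda>j. raise s (i, j)) ` {j \<in> cells i. lowerable (raise s (i, j)) (i, j)}"
    by (intro image_eqI[of _ _ j]) (auto simp: lowerable_def cells_def)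
next
  fix t assume "t \<in> (\<lambda>j. raise s (i, j)) ` {j \<in> cells i. lowerable (raise s (i, j)) (i, j)}"
  then show "t \<in> {t. edgeD n m i s t}" by (auto simp: edgeD_iff lowerable_def)
qed

lemma raise_inj: "raise s p = raise s q \<Longrightarrow> p = q"
  by (metis edge_pos_raise)

lemma lower_inj:
  assumes "lower u p = lower u q" "1 \<le> u p"
  shows "p = q"
proof (rule ccontr)
  assume "p \<noteq> q"
  then have "lower u q p = u p" by (simp add: lower_def)
  then show False using fun_cong[OF assms(1), of p] assms(2) by (simp add: lower_def)
qed

lemma edge_scalars:
  assumes "lowerable (raise s pos) pos"
  shows "Xorth n m (raise s pos) s = coef (raise s pos) pos" "Yorth n m s (raise s pos) = coef (raise s pos) pos"
  using assms by (simp_all add: Xorth_def Yorth_def edge_pos_raise coef_def)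

text \<open>With \<open>f\<close> abstract and \<open>f 0 v = 0\<close>, one reindexing serves both
  the real sums of the DC relations and the complex operators.\<close>

lemma sum_in_edges:
  fixes f :: "real \<Rightarrow> arr \<Rightarrow> 'a::comm_monoid_add"
  assumes "\<And>v. f 0 v = 0"
  shows "(\<Sum>t\<in>{t. edgeD n m i t u}. f (Xorth n m u t) t) = (\<Sum>j\<in>cells i. f (coef u (i, j)) (lower u (i, j)))"
    and "(\<Sum>t\<in>{t. edgeD n m i t u}. f (Xorth n m u t * Yorth n m t u) t) =
      (\<Sum>j\<in>cells i. f ((coef u (i, j))\<^sup>2) (lower u (i, j)))"
proof -
  let ?J = "{j \<in> cells i. lowerable u (i, j)}"
  have inj: "inj_on (\<lambda>j. lower u (i, j)) ?J"
    by (rule inj_onI) (use lower_inj in \<open>fastforce simp: lowerable_def\<close>)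
  have e: "Xorth n m u (lower u (i, j)) = coef u (i, j)" "Yorth n m (lower u (i, j)) u = coef u (i, j)"
    if "j \<in> ?J" for j
    using edge_scalars[of "lower u (i, j)" "(i, j)"] that by (simp_all add: lowerable_def raise_lower)
  have "(\<Sum>t\<in>{t. edgeD n m i t u}. f (Xorth n m u t) t) = (\<Sum>j\<in>?J. f (coef u (i, j)) (lower u (i, j)))"
    unfolding in_edges sum.reindex[OF inj] by (rule sum.cong) (auto simp: e)
  also have "\<dots> = (\<Sum>j\<in>cells i. f (coef u (i, j)) (lower u (i, j)))"
    by (rule sum.mono_neutral_left) (auto simp: cells_finite coef_def assms)
  finally show "(\<Sum>t\<in>{t. edgeD n m i t u}. f (Xorth n m u t) t) = (\<Sum>j\<in>cells i. f (coef u (i, j)) (lower u (i, j)))" .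
  have "(\<Sum>t\<in>{t. edgeD n m i t u}. f (Xorth n m u t * Yorth n m t u) t) =
      (\<Sum>j\<in>?J. f ((coef u (i, j))\<^sup>2) (lower u (i, j)))"
    unfolding in_edges sum.reindex[OF inj] by (rule sum.cong) (auto simp: e power2_eq_square)
  also have "\<dots> = (\<Sum>j\<in>cells i. f ((coef u (i, j))\<^sup>2) (lower u (i, j)))"
    by (rule sum.mono_neutral_left) (auto simp: cells_finite coef_def assms)
  finally show "(\<Sum>t\<in>{t. edgeD n m i t u}. f (Xorth n m u t * Yorth n m t u) t) =
      (\<Sum>j\<in>cells i. f ((coef u (i, j))\<^sup>2) (lower u (i, j)))" .
qed

lemma sum_out_edges:
  fixes f :: "real \<Rightarrow> arr \<Rightarrow> 'a::comm_monoid_add"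
  assumes "\<And>v. f 0 v = 0"
  shows "(\<Sum>t\<in>{t. edgeD n m i s t}. f (Yorth n m s t) t) =
      (\<Sum>j\<in>cells i. f (coef (raise s (i, j)) (i, j)) (raise s (i, j)))"
    and "(\<Sum>t\<in>{t. edgeD n m i s t}. f (Xorth n m t s * Yorth n m s t) t) =
      (\<Sum>j\<in>cells i. f ((coef (raise s (i, j)) (i, j))\<^sup>2) (raise s (i, j)))"
proof -
  let ?J = "{j \<in> cells i. lowerable (raise s (i, j)) (i, j)}"
  have inj: "inj_on (\<lambda>j. raise s (i, j)) ?J"
    by (rule inj_onI) (use raise_inj in fastforce)
  have e: "Xorth n m (raise s (i, j)) s = coef (raise s (i, j)) (i, j)"
    "Yorth n m s (raise s (i, j)) = coef (raise s (i, j)) (i, j)" if "j \<in> ?J" for j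
    using edge_scalars[of s "(i, j)"] that by simp_all
  have "(\<Sum>t\<in>{t. edgeD n m i s t}. f (Yorth n m s t) t) = (\<Sum>j\<in>?J. f (coef (raise s (i, j)) (i, j)) (raise s (i, j)))"
    unfolding out_edges sum.reindex[OF inj] by (rule sum.cong) (auto simp: e)
  also have "\<dots> = (\<Sum>j\<in>cells i. f (coef (raise s (i, j)) (i, j)) (raise s (i, j)))"
    by (rule sum.mono_neutral_left) (auto simp: cells_finite coef_def assms)
  finally show "(\<Sum>t\<in>{t. edgeD n m i s t}. f (Yorth n m s t) t) =
      (\<Sum>j\<in>cells i. f (coef (raise s (i, j)) (i, j)) (raise s (i, j)))" .
  have "(\<Sum>t\<in>{t. edgeD n m i s t}. f (Xorth n m t s * Yorth n m s t) t) =
      (\<Sum>j\<in>?J. f ((coef (raise s (i, j)) (i, j))\<^sup>2) (raise s (i, j)))"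
    unfolding out_edges sum.reindex[OF inj] by (rule sum.cong) (auto simp: e power2_eq_square)
  also have "\<dots> = (\<Sum>j\<in>cells i. f ((coef (raise s (i, j)) (i, j))\<^sup>2) (raise s (i, j)))"
    by (rule sum.mono_neutral_left) (auto simp: cells_finite coef_def assms)
  finally show "(\<Sum>t\<in>{t. edgeD n m i s t}. f (Xorth n m t s * Yorth n m s t) t) =
      (\<Sum>j\<in>cells i. f ((coef (raise s (i, j)) (i, j))\<^sup>2) (raise s (i, j)))" .
qed

section \<open>The structure condition and the DC relations\<close>

lemma structuredD: "structuredD n m"
  unfolding structuredD_def
proof (intro allI impI ballI)
  fix i s t k assume "i \<in> {1..n} \<and> edgeD n m i s t" and k: "k \<in> {1..n}"
  then obtain j where "s \<in> LD n m" "t \<in> LD n m" "(i, j) \<in> idx n" "t = raise s (i, j)"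
    by (auto simp: edgeD_iff cells_def)
  then show "mD n m k t = mD n m k s + cartanD n i k" using mD_raise k by blast
qed

lemma DC_crossing:
  assumes i: "edgeD n m i r t" "edgeD n m i s u" and j: "edgeD n m j r s" "edgeD n m j t u" and "s \<noteq> t"
  shows "Xorth n m u s * Yorth n m t u = Yorth n m r s * Xorth n m t r"
    and "Xorth n m u t * Yorth n m s u = Yorth n m r t * Xorth n m s r"
proof -
  obtain p where p: "t = raise r p" "p \<in> idx n" using i(1) by (auto simp: edgeD_iff cells_def)
  obtain p' where p': "u = raise s p'" using i(2) by (auto simp: edgeD_iff)
  obtain q where q: "s = raise r q" "q \<in> idx n" using j(1) by (auto simp: edgeD_iff cells_def)
  obtain q' where q': "u = raise t q'" using j(2) by (auto simp: edgeD_iff)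
  have L: "r \<in> LD n m" "s \<in> LD n m" "t \<in> LD n m" "u \<in> LD n m" using i by (auto simp: edgeD_iff)
  have "p \<noteq> q" using \<open>s \<noteq> t\<close> p q by auto
  have u: "raise (raise r q) p' = raise (raise r p) q'" using p p' q q' by simp
  \<comment> \<open>Comparing the two descriptions of \<open>u\<close> at \<open>p\<close> and
    \<open>q\<close> shows that opposite edges raise the same position. Positions rather than colors
    are compared, so \<open>i = j\<close> is covered.\<close>
  have "p' = p" using fun_cong[OF u, of p] \<open>p \<noteq> q\<close> by (auto simp: raise_def split: if_splits)
  moreover have "q' = q" using fun_cong[OF u, of q] \<open>p \<noteq> q\<close> by (auto simp: raise_def split: if_splits)
  ultimately have us: "u = raise s p" and ut: "u = raise t q" using p' q' by auto
  have lows: "lower u p = s" "lower u q = t" "lower s q = r" "lower t p = r"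
    using us ut p q lower_raise by metis+
  have ge: "1 \<le> u p" "1 \<le> u q" "1 \<le> s q" "1 \<le> t p"
    by (subst us, simp add: raise_def) (subst ut, simp add: raise_def, simp_all add: p q raise_def)
  have low: "lowerable u p" "lowerable u q" "lowerable s q" "lowerable t p"
    using L lows ge p(2) q(2) by (auto simp: lowerable_def)
  have e: "Xorth n m u s = coef u p" "Yorth n m s u = coef u p" "Xorth n m u t = coef u q" "Yorth n m t u = coef u q"
    "Xorth n m s r = coef s q" "Yorth n m r s = coef s q" "Xorth n m t r = coef t p" "Yorth n m r t = coef t p"
    using edge_scalars[of s p] edge_scalars[of t q] edge_scalars[of r q] edge_scalars[of r p] low us ut p(1) q(1)
    by metis+
  have "coef u p * coef u q = coef t p * coef s q"
    using coef_diamond[OF low(1,2) \<open>p \<noteq> q\<close>] low lows by simp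
  then show "Xorth n m u s * Yorth n m t u = Yorth n m r s * Xorth n m t r"
    "Xorth n m u t * Yorth n m s u = Yorth n m r t * Xorth n m s r"
    unfolding e by (simp_all add: mult.commute)
qed

lemma coef_sum_mD:
  assumes "t \<in> LD n m" "i \<in> {1..n}"
  shows "(\<Sum>j\<in>cells i. (coef t (i, j))\<^sup>2) - (\<Sum>j\<in>cells i. (coef (raise t (i, j)) (i, j))\<^sup>2) = of_int (mD n m i t)"
  using coef_sum[OF assms] chain_sum_cells[OF assms] by simp

lemma DC_relations: "DC_relations n m (Xorth n m) (Yorth n m)"
proof -
  have "(\<Sum>s\<in>{s. edgeD n m i s t}. Xorth n m t s * Yorth n m s t)
        - (\<Sum>u\<in>{u. edgeD n m i t u}. Xorth n m u t * Yorth n m t u) = of_int (mD n m i t)"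
    if "t \<in> LD n m" "i \<in> {1..n}" for t i
    using coef_sum_mD[OF that] sum_in_edges(2)[where f="\<lambda>r _. r" and i=i and u=t]
      sum_out_edges(2)[where f="\<lambda>r _. r" and i=i and s=t] by simp
  then show ?thesis unfolding DC_relations_def using DC_crossing by blast
qed

section \<open>Commutators\<close>

lemma xop_eq: "xop n m i v u = (\<Sum>j\<in>cells i. complex_of_real (coef u (i, j)) * v (lower u (i, j)))"
proof (cases "u \<in> LD n m")
  case True
  then show ?thesis
    using sum_in_edges(1)[of "\<lambda>r t. complex_of_real r * v t"] by (simp add: xop_def)
next
  case False
  then show ?thesis by (simp add: xop_def coef_def lowerable_def)
qed

lemma yop_eq:
  "yop n m i v s = (\<Sum>j\<in>cells i. complex_of_real (coef (raise s (i, j)) (i, j)) * v (raise s (i, j)))"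
proof (cases "s \<in> LD n m")
  case True
  then show ?thesis
    using sum_out_edges(1)[of "\<lambda>r t. complex_of_real r * v t"] by (simp add: yop_def)
next
  case False
  then show ?thesis by (simp add: yop_def coef_def lowerable_def)
qed

text \<open>Terms at two different positions cancel by \<open>coef_swap\<close>. Terms at one
  position survive only for \<open>i = k\<close>, and their sum is the weight by
  \<open>coef_sum_mD\<close>.\<close>

lemma comm_xy:
  assumes "i \<in> {1..n}" "k \<in> {1..n}"
  shows "opcomm (xop n m i) (yop n m k) v u = (if i = k then hop n m i v u else 0)"
proof -
  define T where "T a b = complex_of_real (coef u (i, a) * coef (raise (lower u (i, a)) (k, b)) (k, b))
      * v (raise (lower u (i, a)) (k, b))" for a b
  define S where "S a b = complex_of_real (coef (raise u (k, b)) (k, b) * coef (raise u (k, b)) (i, a))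
      * v (lower (raise u (k, b)) (i, a))" for a b
  have xy: "xop n m i (yop n m k v) u = (\<Sum>a\<in>cells i. \<Sum>b\<in>cells k. T a b)"
    by (simp add: xop_eq yop_eq T_def sum_distrib_left mult.assoc)
  have "yop n m k (xop n m i v) u = (\<Sum>b\<in>cells k. \<Sum>a\<in>cells i. S a b)"
    by (simp add: xop_eq yop_eq S_def sum_distrib_left mult.assoc)
  then have yx: "yop n m k (xop n m i v) u = (\<Sum>a\<in>cells i. \<Sum>b\<in>cells k. S a b)"
    by (simp add: sum.swap[of S])
  have comm: "opcomm (xop n m i) (yop n m k) v u = (\<Sum>a\<in>cells i. \<Sum>b\<in>cells k. T a b - S a b)"
    by (simp add: opcomm_def xy yx sum_subtractf)
  have off: "T a b = S a b" if "(i, a) \<noteq> (k, b)" for a b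
    unfolding T_def S_def coef_swap[OF that] raise_lower_commute[OF that] ..
  show ?thesis
  proof (cases "i = k")
    case False
    then show ?thesis using comm off by simp
  next
    case True
    have diag: "T a a - S a a = complex_of_real ((coef u (i, a))\<^sup>2 - (coef (raise u (i, a)) (i, a))\<^sup>2) * v u" for a
    proof -
      have "T a a = complex_of_real ((coef u (i, a))\<^sup>2) * v u"
      proof (cases "lowerable u (i, a)")
        case True
        then have "raise (lower u (i, a)) (i, a) = u" by (simp add: raise_lower lowerable_def)
        then show ?thesis using \<open>i = k\<close> by (simp add: T_def power2_eq_square)
      qed (simp add: T_def coef_def)
      moreover have "S a a = complex_of_real ((coef (raise u (i, a)) (i, a))\<^sup>2) * v u"
        using True by (simp add: S_def power2_eq_square)
      ultimately show ?thesis by (simp add: left_diff_distrib)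
    qed
    have "(\<Sum>b\<in>cells k. T a b - S a b) =
        complex_of_real ((coef u (i, a))\<^sup>2 - (coef (raise u (i, a)) (i, a))\<^sup>2) * v u" if "a \<in> cells i" for a
    proof -
      have "(\<Sum>b\<in>cells k. T a b - S a b) = (\<Sum>b\<in>cells k. if b = a then T a a - S a a else 0)"
        by (rule sum.cong) (use off True in auto)
      then show ?thesis using that True diag cells_finite by simp
    qed
    then have "opcomm (xop n m i) (yop n m k) v u =
        (\<Sum>a\<in>cells i. complex_of_real ((coef u (i, a))\<^sup>2 - (coef (raise u (i, a)) (i, a))\<^sup>2) * v u)"
      using comm by simp
    also have "\<dots> = complex_of_real ((\<Sum>a\<in>cells i. (coef u (i, a))\<^sup>2) -
        (\<Sum>a\<in>cells i. (coef (raise u (i, a)) (i, a))\<^sup>2)) * v u"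
      by (simp add: sum_distrib_right sum_subtractf left_diff_distrib)
    also have "\<dots> = hop n m i v u"
    proof (cases "u \<in> LD n m")
      case True
      then show ?thesis unfolding coef_sum_mD[OF True assms(1)] by (simp add: hop_def)
    next
      case False
      then show ?thesis by (simp add: hop_def coef_def lowerable_def)
    qed
    finally show ?thesis using True by simp
  qed
qed

lemma mD_lower:
  assumes "lowerable u (k, j)" "i \<in> {1..n}"
  shows "mD n m i u = mD n m i (lower u (k, j)) + cartanD n i k"
proof -
  have "raise (lower u (k, j)) (k, j) = u" using assms by (simp add: lowerable_def raise_lower)
  then show ?thesis
    using mD_raise[of "lower u (k, j)" k j i] assms cartanD_sym[of i k] by (simp add: lowerable_def)
qed

lemma comm_hx:
  assumes "i \<in> {1..n}"
  shows "opcomm (hop n m i) (xop n m k) v u = of_int (cartanD n i k) * xop n m k v u"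
proof (cases "u \<in> LD n m")
  case True
  have "opcomm (hop n m i) (xop n m k) v u =
    (\<Sum>j\<in>cells k. of_int (mD n m i u) * (complex_of_real (coef u (k, j)) * v (lower u (k, j)))
      - complex_of_real (coef u (k, j)) * hop n m i v (lower u (k, j)))"
    using True by (simp add: opcomm_def hop_def xop_eq sum_distrib_left sum_subtractf)
  also have "\<dots> = (\<Sum>j\<in>cells k. of_int (cartanD n i k) * (complex_of_real (coef u (k, j)) * v (lower u (k, j))))"
  proof (rule sum.cong[OF refl])
    fix j
    show "of_int (mD n m i u) * (complex_of_real (coef u (k, j)) * v (lower u (k, j)))
      - complex_of_real (coef u (k, j)) * hop n m i v (lower u (k, j)) =
      of_int (cartanD n i k) * (complex_of_real (coef u (k, j)) * v (lower u (k, j)))"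
      using mD_lower[of u k j i] assms
      by (cases "lowerable u (k, j)") (auto simp: coef_def hop_def lowerable_def algebra_simps)
  qed
  finally show ?thesis by (simp add: xop_eq sum_distrib_left)
next
  case False
  then show ?thesis by (simp add: opcomm_def hop_def xop_eq coef_def lowerable_def)
qed

lemma comm_hy:
  assumes "i \<in> {1..n}"
  shows "opcomm (hop n m i) (yop n m k) v s = - of_int (cartanD n i k) * yop n m k v s"
proof (cases "s \<in> LD n m")
  case True
  let ?t = "\<lambda>j. raise s (k, j)" and ?c = "\<lambda>j. complex_of_real (coef (raise s (k, j)) (k, j))"
  have "opcomm (hop n m i) (yop n m k) v s =
    (\<Sum>j\<in>cells k. of_int (mD n m i s) * (?c j * v (?t j)) - ?c j * hop n m i v (?t j))"
    using True by (simp add: opcomm_def hop_def yop_eq sum_distrib_left sum_subtractf)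
  also have "\<dots> = (\<Sum>j\<in>cells k. - of_int (cartanD n i k) * (?c j * v (?t j)))"
  proof (rule sum.cong[OF refl])
    fix j
    show "of_int (mD n m i s) * (?c j * v (?t j)) - ?c j * hop n m i v (?t j) =
      - of_int (cartanD n i k) * (?c j * v (?t j))"
      using mD_lower[of "?t j" k j i] assms
      by (cases "lowerable (?t j) (k, j)") (auto simp: coef_def hop_def lowerable_def algebra_simps)
  qed
  finally show ?thesis by (simp add: yop_eq sum_distrib_left)
next
  case False
  then show ?thesis by (simp add: opcomm_def hop_def yop_eq coef_def lowerable_def)
qed

lemma comm_hh: "opcomm (hop n m i) (hop n m k) v u = 0"
  by (simp add: opcomm_def hop_def)

section \<open>Serre relations\<close>

lemma linear_xop: "linear_op (xop n m i)"
  by (simp add: linear_op_def xop_eq sum.distrib sum_distrib_left algebra_simps)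

lemma linear_yop: "linear_op (yop n m i)"
  by (simp add: linear_op_def yop_eq sum.distrib sum_distrib_left algebra_simps)

lemma linear_hop: "linear_op (hop n m i)"
  by (simp add: linear_op_def hop_def algebra_simps)

text \<open>Degree \<open>d\<close> for the rank, phrased through supports: each nonzero value of
  the output stems from a nonzero value of the input \<open>d\<close> ranks below.\<close>

definition homogeneous :: "int \<Rightarrow> op \<Rightarrow> bool" where
  "homogeneous d A \<longleftrightarrow>
     (\<forall>v u. A v u \<noteq> 0 \<longrightarrow> u \<in> LD n m \<and> (\<exists>t\<in>LD n m. wtD n u = wtD n t + d \<and> v t \<noteq> 0))"

lemma wtD_raise:
  assumes "pos \<in> idx n"
  shows "wtD n (raise c pos) = wtD n c + 1"
proof -
  have "wtD n (raise c pos) = (\<Sum>pq\<in>idx n. int (c pq) + (if pq = pos then 1 else 0))"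
    unfolding wtD_def by (rule sum.cong) (auto simp: raise_def)
  then show ?thesis using assms finite_idx by (simp add: wtD_def sum.distrib)
qed

lemma homogeneous_xop: "homogeneous 1 (xop n m i)"
  unfolding homogeneous_def
proof (intro allI impI)
  fix v u assume "xop n m i v u \<noteq> 0"
  then obtain j where j: "j \<in> cells i" "coef u (i, j) \<noteq> 0" "v (lower u (i, j)) \<noteq> 0"
    unfolding xop_eq by (auto elim!: sum.not_neutral_contains_not_neutral)
  then have low: "lowerable u (i, j)" by (auto simp: coef_def split: if_splits)
  then have "wtD n u = wtD n (lower u (i, j)) + 1"
    using wtD_raise[of "(i, j)" "lower u (i, j)"] by (simp add: lowerable_def raise_lower)
  moreover have "u \<in> LD n m" "lower u (i, j) \<in> LD n m" using low by (simp_all add: lowerable_def)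
  ultimately show "u \<in> LD n m \<and> (\<exists>t\<in>LD n m. wtD n u = wtD n t + 1 \<and> v t \<noteq> 0)"
    using j(3) by blast
qed

lemma homogeneous_yop: "homogeneous (- 1) (yop n m i)"
  unfolding homogeneous_def
proof (intro allI impI)
  fix v u assume "yop n m i v u \<noteq> 0"
  then obtain j where j: "j \<in> cells i" "coef (raise u (i, j)) (i, j) \<noteq> 0" "v (raise u (i, j)) \<noteq> 0"
    unfolding yop_eq by (auto elim!: sum.not_neutral_contains_not_neutral)
  then have low: "lowerable (raise u (i, j)) (i, j)" by (auto simp: coef_def split: if_splits)
  then have "wtD n u = wtD n (raise u (i, j)) + - 1"
    using wtD_raise[of "(i, j)" u] by (simp add: lowerable_def)
  moreover have "u \<in> LD n m" "raise u (i, j) \<in> LD n m" using low by (simp_all add: lowerable_def)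
  ultimately show "u \<in> LD n m \<and> (\<exists>t\<in>LD n m. wtD n u = wtD n t + - 1 \<and> v t \<noteq> 0)"
    using j(3) by blast
qed

lemma homogeneous_opcomm:
  assumes "homogeneous d A" "homogeneous e B"
  shows "homogeneous (d + e) (opcomm A B)"
proof -
  have comp: "u \<in> LD n m \<and> (\<exists>t\<in>LD n m. wtD n u = wtD n t + (d + e) \<and> v t \<noteq> 0)"
    if hom: "homogeneous d A" "homogeneous e B" "A (B v) u \<noteq> 0" for d e A B v u
  proof -
    obtain t where t: "u \<in> LD n m" "wtD n u = wtD n t + d" "B v t \<noteq> 0"
      using hom(1,3) unfolding homogeneous_def by blast
    obtain t' where t': "t' \<in> LD n m" "wtD n t = wtD n t' + e" "v t' \<noteq> 0"
      using hom(2) t(3) unfolding homogeneous_def by blast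
    have "wtD n u = wtD n t' + (d + e)" using t(2) t'(2) by simp
    then show ?thesis using t(1) t'(1,3) by blast
  qed
  show ?thesis
    unfolding homogeneous_def
  proof (intro allI impI)
    fix v u assume "opcomm A B v u \<noteq> 0"
    then have "A (B v) u \<noteq> 0 \<or> B (A v) u \<noteq> 0" by (auto simp: opcomm_def)
    then show "u \<in> LD n m \<and> (\<exists>t\<in>LD n m. wtD n u = wtD n t + (d + e) \<and> v t \<noteq> 0)"
      using comp[OF assms] comp[OF assms(2,1)] unfolding add.commute[of e d] by blast
  qed
qed

lemma homogeneous_funpow:
  assumes "homogeneous d A" "homogeneous e B"
  shows "homogeneous (int k * d + e) ((opcomm A ^^ k) B)"
proof (induction k)
  case (Suc k)
  then show ?case using homogeneous_opcomm[OF assms(1) Suc] by (simp add: algebra_simps)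
qed (use assms in simp)

lemma opcomm_nilpotent:
  assumes "homogeneous d A" "homogeneous e B" "\<bar>d\<bar> = 1"
  obtains K where "\<And>v u. (opcomm A ^^ K) B v u = 0"
proof -
  define R where "R = Max (wtD n ` LD n m)"
  have R: "0 \<le> wtD n t \<and> wtD n t \<le> R" if "t \<in> LD n m" for t
    using that finite_LD by (auto simp: R_def wtD_def intro!: Max_ge sum_nonneg)
  \<comment> \<open>Ranks lie between 0 and \<open>R\<close>, and this \<open>K\<close> makes the
    degree \<open>int K * d + e\<close> exceed \<open>R\<close> in absolute value.\<close>
  define K where "K = nat (R + \<bar>e\<bar> + 1)"
  have "(opcomm A ^^ K) B v u = 0" for v u
  proof (rule ccontr)
    assume "(opcomm A ^^ K) B v u \<noteq> 0"
    then obtain t where "u \<in> LD n m" "t \<in> LD n m" "wtD n u = wtD n t + (int K * d + e)"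
      using homogeneous_funpow[OF assms(1,2), of K] unfolding homogeneous_def by blast
    moreover have "d = 1 \<or> d = - 1" using assms(3) by linarith
    ultimately show False using R[of u] R[of t] unfolding K_def by (elim disjE) auto
  qed
  then show thesis by (rule that)
qed

lemma cartanD_nonpos: "i \<noteq> k \<Longrightarrow> cartanD n i k \<le> 0"
  by (simp add: cartanD_def)

lemma cartanD_diag: "cartanD n i i = 2"
  by (simp add: cartanD_def)

lemma serre_x:
  assumes ik: "i \<in> {1..n}" "k \<in> {1..n}" "i \<noteq> k"
  shows "(opcomm (xop n m i) ^^ nat (1 - cartanD n i k)) (xop n m k) v u = 0"
proof -
  define N where "N = nat (- cartanD n i k)"
  have N: "nat (1 - cartanD n i k) = N + 1" "cartanD n i k = - int N"
    using cartanD_nonpos[OF ik(3)] by (auto simp: N_def)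
  obtain K where K: "\<And>v u. (opcomm (xop n m i) ^^ K) (xop n m k) v u = 0"
    using opcomm_nilpotent[OF homogeneous_xop homogeneous_xop] by auto
  have yx: "opcomm (yop n m i) (xop n m k) v u = 0" for v u
    using comm_xy[OF ik(2,1), of v u] ik(3) opcomm_swap[of "yop n m i" "xop n m k" v u] by simp
  have xy: "opcomm (xop n m i) (yop n m i) v u = hop n m i v u" for v u
    using comm_xy[OF ik(1,1)] by simp
  show ?thesis unfolding N(1)
    by (rule serre_from_lowest_weight[OF linear_xop[of i] linear_yop[of i] linear_hop[of i] linear_xop[of k], where K=K])
      (simp_all add: xy comm_hx[OF ik(1)] cartanD_diag N(2) yx K)
qed

lemma serre_y:
  assumes ik: "i \<in> {1..n}" "k \<in> {1..n}" "i \<noteq> k"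
  shows "(opcomm (yop n m i) ^^ nat (1 - cartanD n i k)) (yop n m k) v u = 0"
proof -
  define N where "N = nat (- cartanD n i k)"
  have N: "nat (1 - cartanD n i k) = N + 1" "cartanD n i k = - int N"
    using cartanD_nonpos[OF ik(3)] by (auto simp: N_def)
  obtain K where K: "\<And>v u. (opcomm (yop n m i) ^^ K) (yop n m k) v u = 0"
    using opcomm_nilpotent[OF homogeneous_yop homogeneous_yop] by auto
  \<comment> \<open>Exchanging \<open>x\<close> and \<open>y\<close> gives a triple again once
    \<open>h\<close> is negated; \<open>y k\<close> then takes the part of the lowest weight
    vector.\<close>
  define h where "h = (\<lambda>v z. - 1 * hop n m i v z)"
  have h: "linear_op h" using linear_hop[of i] by (simp add: linear_op_def h_def algebra_simps)
  have yx: "opcomm (yop n m i) (xop n m i) v u = h v u" for v u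
    using comm_xy[OF ik(1,1), of v u] opcomm_swap[of "yop n m i" "xop n m i" v u] by (simp add: h_def)
  have hy: "opcomm h (yop n m l) v u = of_int (cartanD n i l) * yop n m l v u" for l v u
    using opcomm_scale_left[OF linear_yop, of h "-1" "hop n m i" l v u] comm_hy[OF ik(1), of l v u]
    by (simp add: h_def)
  have xy: "opcomm (xop n m i) (yop n m k) v u = 0" for v u
    using comm_xy[OF ik(1,2)] ik(3) by simp
  show ?thesis unfolding N(1)
    by (rule serre_from_lowest_weight[OF linear_yop[of i] linear_xop[of i] h linear_yop[of k], where K=K])
      (simp_all add: xy yx hy cartanD_diag N(2) K)
qed

lemma serre_rep: "serre_rep n (VL n m) (xop n m) (yop n m) (hop n m)"
proof -
  have add: "A (\<lambda>z. v z + w z) = (\<lambda>z. A v z + A w z)" if "linear_op A" for A v w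
    by (rule ext) (rule linear_op_add[OF that])
  have scale: "A (scaleV c v) = scaleV c (A v)" if "linear_op A" for A v c
    unfolding scaleV_def by (rule ext) (rule linear_op_scale[OF that])
  have VL: "xop n m i v \<in> VL n m" "yop n m i v \<in> VL n m" "hop n m i v \<in> VL n m" for i v
    by (simp_all add: VL_def xop_def yop_def hop_def)
  have hh: "opcomm (hop n m i) (hop n m k) v = (\<lambda>_. 0)" for i k v
    by (rule ext) (rule comm_hh)
  have hx: "opcomm (hop n m i) (xop n m k) v = scaleV (of_int (cartanD n i k)) (xop n m k v)"
    if "i \<in> {1..n}" for i k v
    using comm_hx[OF that] by (simp add: scaleV_def fun_eq_iff)
  have hy: "opcomm (hop n m i) (yop n m k) v = scaleV (- of_int (cartanD n i k)) (yop n m k v)"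
    if "i \<in> {1..n}" for i k v
    using comm_hy[OF that] by (simp add: scaleV_def fun_eq_iff)
  have xy: "opcomm (xop n m i) (yop n m k) v = (if i = k then hop n m i v else (\<lambda>_. 0))"
    if "i \<in> {1..n}" "k \<in> {1..n}" for i k v
    using comm_xy[OF that] by (simp add: fun_eq_iff)
  have sx: "(opcomm (xop n m i) ^^ nat (1 - cartanD n i k)) (xop n m k) v = (\<lambda>_. 0)"
    if "i \<in> {1..n}" "k \<in> {1..n}" "i \<noteq> k" for i k v
    by (rule ext) (rule serre_x[OF that])
  have sy: "(opcomm (yop n m i) ^^ nat (1 - cartanD n i k)) (yop n m k) v = (\<lambda>_. 0)"
    if "i \<in> {1..n}" "k \<in> {1..n}" "i \<noteq> k" for i k v
    by (rule ext) (rule serre_y[OF that])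
  show ?thesis
    unfolding serre_rep_def
    by (intro conjI ballI allI impI)
      (assumption | rule VL add[OF linear_xop] add[OF linear_yop] add[OF linear_hop]
        scale[OF linear_xop] scale[OF linear_yop] scale[OF linear_hop] hh hx hy xy sx sy)+
qed

section \<open>Highest weight and irreducibility\<close>

definition top_arr :: arr where
  "top_arr = (\<lambda>pq. if pq \<in> idx n then m else 0)"

lemma gD_top_arr:
  assumes "1 \<le> q" "q \<le> p" "p \<le> n - 1"
  shows "gD n top_arr p q = m"
proof -
  obtain i j where "(i, j) \<in> idx n" "row i = p" "col i j = q" using cell_exists[OF assms] by blast
  then show ?thesis using gD_cell[of i j top_arr] by (simp add: top_arr_def)
qed

lemma top_arr_in_LD: "top_arr \<in> LD n m"
proof -
  have "is_arr n m top_arr"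
    unfolding is_arr_def
  proof (intro conjI allI impI)
    fix p q assume pq: "1 \<le> q \<and> q \<le> p \<and> p \<le> n - 2"
    then have "p + 1 \<le> n - 1" using n_ge by linarith
    then show "gD n top_arr (p + 1) q \<le> gD n top_arr p q" "gD n top_arr p q \<le> gD n top_arr (p + 1) (q + 1)"
      using pq by (simp_all add: gD_top_arr)
  next
    show "gD n top_arr (n - 1) (n - 1) \<le> m" using gD_top_arr[of "n - 1" "n - 1"] n_ge by simp
  qed (simp add: top_arr_def)
  then show ?thesis by (simp add: LD_def)
qed

lemma xop_top_arr: "xop n m i (vb top_arr) u = 0"
proof -
  have "coef u (i, j) = 0 \<or> vb top_arr (lower u (i, j)) = 0" for j
  proof (rule ccontr)
    assume "\<not> ?thesis"
    then have "lowerable u (i, j)" "lower u (i, j) = top_arr" by (auto simp: coef_def vb_def split: if_splits)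
    moreover from this(2) have "lower u (i, j) (i, j) = top_arr (i, j)" by simp
    moreover have "lower u (i, j) (i, j) = u (i, j) - 1" by (simp add: lower_def)
    ultimately have "u (i, j) - 1 = m" "1 \<le> u (i, j)" "u (i, j) \<le> m"
      using LD_le_m_pos[of u "(i, j)"] unfolding lowerable_def top_arr_def by auto
    then show False by linarith
  qed
  then show ?thesis unfolding xop_eq by (intro sum.neutral) auto
qed

lemma row_sum_top_arr: "p \<le> n - 1 \<Longrightarrow> row_sum i top_arr p = int p * int m"
  by (simp add: row_sum_def entry_low gD_top_arr)

text \<open>The row sums \<open>p * m\<close> are linear in \<open>p\<close>, so second differences
  vanish, except that row \<open>n\<close> as seen by color \<open>n - 1\<close> starts with 0 and
  thus misses one \<open>m\<close>.\<close>

lemma mD_top_arr: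
  assumes i: "i \<in> {1..n}"
  shows "mD n m i top_arr = (if i = n - 1 then int m else 0)"
proof -
  note rb = row_bounds[OF i]
  have low: "row_sum i top_arr (row i) = int (row i) * int m" "row_sum i top_arr (row i - 1) = int (row i - 1) * int m"
  proof -
    have "row i \<le> n - 1" "row i - 1 \<le> n - 1" using rb by auto
    then show "row_sum i top_arr (row i) = int (row i) * int m"
      "row_sum i top_arr (row i - 1) = int (row i - 1) * int m" by (simp_all only: row_sum_top_arr)
  qed
  show ?thesis
  proof (cases "row i = n - 1")
    case False
    then have "row i + 1 \<le> n - 1" "i \<noteq> n - 1" using rb by (auto simp: row_def)
    then show ?thesis
      unfolding mD_eq_row_sums[OF top_arr_in_LD i] low row_sum_top_arr[OF \<open>row i + 1 \<le> n - 1\<close>]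
      using rb by (simp add: of_nat_diff algebra_simps)
  next
    case True
    then have i': "i = n - 1 \<or> i = n" using i by (auto simp: row_def split: if_splits)
    have n: "row i + 1 = n" and nn: "n - Suc 0 \<noteq> n" using True n_ge by simp_all
    have e: "entry i top_arr n k = (if i \<noteq> n \<and> k = 1 then 0 else m)" if "k \<in> {1..n}" for k
    proof -
      have "k \<noteq> n \<Longrightarrow> gD n top_arr (n - 1) k = m" "k \<noteq> 1 \<Longrightarrow> gD n top_arr (n - 1) (k - 1) = m"
        using that by (auto intro!: gD_top_arr)
      then show ?thesis using entry_top[OF i', of k top_arr] that n_ge by auto
    qed
    have "row_sum i top_arr n = (\<Sum>k=1..n. int m - (if k = 1 then if i \<noteq> n then int m else 0 else 0))"
      unfolding row_sum_def by (rule sum.cong) (auto simp: e)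
    also have "\<dots> = int n * int m - (if i \<noteq> n then int m else 0)"
      using n_ge by (simp add: sum_subtractf)
    finally have "row_sum i top_arr n = int n * int m - (if i \<noteq> n then int m else 0)" .
    then show ?thesis
      unfolding mD_eq_row_sums[OF top_arr_in_LD i] low n
      using True i' n_ge nn by (auto simp: of_nat_diff algebra_simps)
  qed
qed

lemma has_highest_weight:
  "has_highest_weight n (VL n m) (xop n m) (hop n m) (\<lambda>i. if i = n - 1 then int m else 0)"
  unfolding has_highest_weight_def
proof (intro bexI[of _ "vb top_arr"] conjI ballI)
  show "vb top_arr \<in> VL n m" using top_arr_in_LD by (auto simp: VL_def vb_def)
  show "vb top_arr \<noteq> (\<lambda>_. 0)" by (auto simp: vb_def fun_eq_iff)
  fix i assume i: "i \<in> {1..n}"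
  show "xop n m i (vb top_arr) = (\<lambda>_. 0)" by (simp add: xop_top_arr fun_eq_iff)
  show "hop n m i (vb top_arr) = scaleV (of_int (if i = n - 1 then int m else 0)) (vb top_arr)"
  proof
    fix x
    show "hop n m i (vb top_arr) x = scaleV (of_int (if i = n - 1 then int m else 0)) (vb top_arr) x"
      using mD_top_arr[OF i] top_arr_in_LD by (cases "x = top_arr") (simp_all add: hop_def scaleV_def vb_def)
  qed
qed

text \<open>A constant row \<open>n\<close> lets the equation along diagonals cover row
  \<open>n - 1\<close> as well.\<close>

definition padded :: "arr \<Rightarrow> nat \<Rightarrow> nat \<Rightarrow> nat" where
  "padded t p q = (if p = n then m else gD n t p q)"

text \<open>If rows below \<open>k\<close> are maximal given the next row, they determine all entries of row \<open>k\<close>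
  but the first one, so no two members of the support contribute to the same coefficient of \<open>x\<^sub>i w\<close>.\<close>

lemma killed_not_raisable:
  assumes kill: "\<And>u. xop n m i w u = 0"
    and rows: "\<And>t p q. w t \<noteq> 0 \<Longrightarrow> 1 \<le> q \<Longrightarrow> q \<le> p \<Longrightarrow> p < row i \<Longrightarrow> gD n t p q = gD n t (p + 1) (q + 1)"
    and t: "w t \<noteq> 0" "t \<in> LD n m" and ij: "(i, j) \<in> idx n"
  shows "raise t (i, j) \<notin> LD n m"
proof
  assume u: "raise t (i, j) \<in> LD n m"
  define u where "u = raise t (i, j)"
  have low: "lowerable u (i, j)" using t u ij by (simp add: lowerable_def u_def)
  note bd = idx_bounds[OF ij]
  have zero: "coef u (i, j') * w (lower u (i, j')) = 0" if "j' \<in> cells i - {j}" for j'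
  proof (rule ccontr)
    assume ne: "\<not> ?thesis"
    define t' where "t' = lower u (i, j')"
    have ij': "(i, j') \<in> idx n" using that by (simp add: cells_def)
    have t': "w t' \<noteq> 0" "lowerable u (i, j')" using ne by (auto simp: coef_def t'_def split: if_splits)
    then have ut': "u = raise t' (i, j')" by (simp add: t'_def raise_lower lowerable_def)
    have bb: "col i j \<noteq> col i j'" using col_eq_iff[OF ij ij'] that by auto
    have eq: "gD n t (row i) q = gD n t' (row i) q" if q: "2 \<le> q" "q \<le> row i" for q
    proof -
      have q': "1 \<le> q - 1" "q - 1 \<le> row i - 1" "row i - 1 < row i" "row i - 1 + 1 = row i" "q - 1 + 1 = q"
        "row i - 1 \<le> n - 1" "q - 1 \<in> {1..row i - 1}" "row i - 1 \<noteq> row i"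
        using q bd by auto
      have "gD n t (row i - 1) (q - 1) = gD n u (row i - 1) (q - 1)"
        unfolding u_def using gD_raise[where c=t, OF ij q'(7,6)] q'(8) by simp
      also have "\<dots> = gD n t' (row i - 1) (q - 1)"
        unfolding ut' using gD_raise[where c=t', OF ij' q'(7,6)] q'(8) by simp
      finally show ?thesis
        using rows[OF t(1) q'(1,2,3)] rows[OF t'(1) q'(1,2,3)] unfolding q'(4,5) by simp
    qed
    have u1: "gD n u (row i) q = gD n t (row i) q + (if q = col i j then 1 else 0)" if "q \<in> {1..row i}" for q
      unfolding u_def using gD_raise[where c=t, OF ij that bd(5)] by simp
    have u2: "gD n u (row i) q = gD n t' (row i) q + (if q = col i j' then 1 else 0)" if "q \<in> {1..row i}" for q
      unfolding ut' using gD_raise[where c=t', OF ij' that bd(5)] by simp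
    note bd' = idx_bounds[OF ij']
    \<comment> \<open>Two distinct columns cannot both be the first. In one beyond the first,
      \<open>t\<close> and \<open>t'\<close> agree by \<open>eq\<close>, yet differ by one because
      \<open>u\<close> raises only one of them there.\<close>
    consider "2 \<le> col i j" | "2 \<le> col i j'" using bb bd bd' by linarith
    then show False
    proof cases
      case 1
      then show False using eq[of "col i j"] u1[of "col i j"] u2[of "col i j"] bb bd by simp
    next
      case 2
      then show False using eq[of "col i j'"] u1[of "col i j'"] u2[of "col i j'"] bb bd' by simp
    qed
  qed
  have "xop n m i w u = coef u (i, j) * w (lower u (i, j)) +
      (\<Sum>j'\<in>cells i - {j}. coef u (i, j') * w (lower u (i, j')))"
    unfolding xop_eq using ij by (intro sum.remove cells_finite) (simp add: cells_def)
  also have "(\<Sum>j'\<in>cells i - {j}. coef u (i, j') * w (lower u (i, j'))) = 0"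
    using zero by (intro sum.neutral ballI)
  also have "coef u (i, j) * w (lower u (i, j)) + 0 = coef u (i, j) * w t"
    by (simp add: u_def)
  finally show False using kill[of u] coef_pos[OF low] t(1) by simp
qed

text \<open>Induction upwards over the rows: in the support no entry of the row can be raised, so
  each equals its upper bound, a minimum of two neighbours, and either neighbour leads to the same
  equation.\<close>

lemma killed_rows:
  assumes kill: "\<And>i u. i \<in> {1..n} \<Longrightarrow> xop n m i w u = 0" and w: "w \<in> VL n m"
  shows "k \<le> n - 1 \<Longrightarrow> w t \<noteq> 0 \<Longrightarrow> 1 \<le> q \<Longrightarrow> q \<le> p \<Longrightarrow> p \<le> k \<Longrightarrow> gD n t p q = padded t (p + 1) (q + 1)"
proof (induction k arbitrary: t p q)
  case 0
  then show ?case by simp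
next
  case (Suc k)
  let ?a = "Suc k"
  have ad: "?a \<le> n - 1" "?a - 1 = k" using Suc.prems by auto
  have IH: "gD n t p q = gD n t (p + 1) (q + 1)" if "w t \<noteq> 0" "1 \<le> q" "q \<le> p" "p < ?a" for t p q
  proof -
    have "p + 1 \<noteq> n" using that ad by auto
    then show ?thesis using Suc.IH[of t q p] that ad by (simp add: padded_def)
  qed
  have t: "t \<in> LD n m" using Suc.prems(2) w by (auto simp: VL_def)
  \<comment> \<open>The color is existential because in row \<open>n - 1\<close> it alternates with
    the parity of \<open>q\<close>.\<close>
  have tight: "(q = ?a \<longrightarrow> (\<exists>i. gD n t ?a q = entry i t (?a + 1) (q + 1) \<and> (?a = n - 1 \<longrightarrow> i = n - 1 \<and> odd q \<or> i = n \<and> even q))) \<and>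
     (q \<noteq> ?a \<longrightarrow> (\<exists>i. (gD n t ?a q = entry i t (?a + 1) (q + 1) \<or> gD n t ?a q = gD n t k q)
        \<and> (?a = n - 1 \<longrightarrow> i = n - 1 \<and> odd q \<or> i = n \<and> even q)))"
    if q: "1 \<le> q" "q \<le> ?a" for q
  proof -
    obtain i j where ij: "(i, j) \<in> idx n" "row i = ?a" "col i j = q"
      using cell_exists[OF q ad(1)] by blast
    have i: "i \<in> {1..n}" using idx_bounds[OF ij(1)] by simp
    have "raise t (i, j) \<notin> LD n m"
      using killed_not_raisable[OF kill[OF i] _ Suc.prems(2) t ij(1)] IH unfolding ij(2) by blast
    then have "\<not> t (i, j) < up i t q" using raise_in_LD_iff[OF t ij(1)] ij(3) by simp
    then have "gD n t ?a q = up i t q"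
      using cell_box(2)[OF t ij(1)] gD_cell[OF ij(1), of t] ij(2,3) by simp
    moreover have "?a = n - 1 \<longrightarrow> i = n - 1 \<and> odd q \<or> i = n \<and> even q"
      using idx_parity[OF ij(1)] ij by simp
    moreover have "entry i t (?a - 1) q = gD n t k q" using ad by (simp add: entry_low)
    ultimately show ?thesis unfolding up_def ij(2) min_def by (auto split: if_splits)
  qed
  show ?case
  proof (cases "p = ?a")
    case False
    then show ?thesis using Suc.IH[of t q p] Suc.prems by simp
  next
    case p: True
    show ?thesis
    proof (cases "?a = n - 1")
      case False
      then have le: "?a + 1 \<le> n - 1" "?a \<le> n - 2" "?a + 1 \<noteq> n" using ad by auto
      have "gD n t ?a q = gD n t (?a + 1) (q + 1)"
      proof (cases "gD n t ?a q = gD n t (?a + 1) (q + 1)")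
        case ne: False
        have el: "entry i t (?a + 1) (q + 1) = gD n t (?a + 1) (q + 1)" for i
          by (rule entry_low[OF le(1)])
        have "1 \<le> q" "q \<le> ?a" using Suc.prems p by auto
        from tight[OF this] have k: "q \<noteq> ?a" "gD n t ?a q = gD n t k q"
          using ne unfolding el by blast+
        \<comment> \<open>If the bound comes from the row below, then the entry equals its right
          neighbour, and interlacing squeezes the entry at \<open>(?a + 1, q + 1)\<close> between
          the two.\<close>
        then have "gD n t k q = gD n t ?a (q + 1)" using IH[of t q k] Suc.prems p by simp
        moreover have "gD n t (?a + 1) (q + 1) \<le> gD n t ?a (q + 1)"
          using LD_D(1)[OF t, of "q + 1" ?a] k Suc.prems p le by simp
        moreover have "gD n t ?a q \<le> gD n t (?a + 1) (q + 1)"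
          using LD_D(2)[OF t, of q ?a] Suc.prems p le by simp
        ultimately show ?thesis using k by simp
      qed
      then show ?thesis using p le by (simp add: padded_def)
    next
      case a: True
      have n: "?a + 1 = n" using a n_ge by simp
      \<comment> \<open>In row \<open>n - 1\<close> both possible bounds are the right neighbour, or
        \<open>m\<close> in the last column, so \<open>m\<close> spreads from right to left.\<close>
      have step: "gD n t ?a q = (if q = ?a then m else gD n t ?a (q + 1))" if q: "1 \<le> q" "q \<le> ?a" for q
      proof -
        have e: "entry i t n (q + 1) = (if q + 1 = n then m else gD n t (n - 1) (q + 1))"
          if "i = n - 1 \<and> odd q \<or> i = n \<and> even q" for i
          using entry_above_top(2)[of i q t] that q a n_ge by auto
        have r: "q \<noteq> ?a \<Longrightarrow> gD n t k q = gD n t ?a (q + 1)" using IH[OF Suc.prems(2), of q k] q by simp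
        have qn: "q + 1 = n \<longleftrightarrow> q = ?a" using n by auto
        show ?thesis
        proof (cases "q = ?a")
          case True
          then obtain i where "gD n t ?a q = entry i t n (q + 1)" "i = n - 1 \<and> odd q \<or> i = n \<and> even q"
            using tight[OF q] a unfolding n by blast
          then show ?thesis using e[of i] qn True by simp
        next
          case False
          then obtain i where "gD n t ?a q = entry i t n (q + 1) \<or> gD n t ?a q = gD n t k q"
            "i = n - 1 \<and> odd q \<or> i = n \<and> even q"
            using tight[OF q] a unfolding n by blast
          then show ?thesis using e[of i] r qn False unfolding a[symmetric] by auto
        qed
      qed
      have "gD n t ?a q = m" if "1 \<le> q" "q \<le> ?a" for q
        using that(2,1)
      proof (induction q rule: inc_induct)
        case base
        then show ?case using step[of ?a] by simp
      next
        case (step q')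
        then show ?case using \<open>\<And>q. 1 \<le> q \<Longrightarrow> q \<le> ?a \<Longrightarrow> gD n t ?a q = (if q = ?a then m else gD n t ?a (q + 1))\<close>[of q'] by simp
      qed
      then show ?thesis using p n Suc.prems by (simp add: padded_def)
    qed
  qed
qed

text \<open>Row \<open>n - 1\<close> is constantly \<open>m\<close>, and the equations along
  diagonals carry this value down to every row.\<close>

lemma killed_support:
  assumes kill: "\<And>i u. i \<in> {1..n} \<Longrightarrow> xop n m i w u = 0" and w: "w \<in> VL n m" and t: "w t \<noteq> 0"
  shows "t = top_arr"
proof -
  have tL: "t \<in> LD n m" using t w by (auto simp: VL_def)
  have g: "gD n t p q = m" if "1 \<le> q" "q \<le> p" "p \<le> n - 1" for p q
    using that(3,1,2)
  proof (induction p arbitrary: q rule: inc_induct)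
    case base
    then show ?case using killed_rows[OF kill w order_refl t, of q "n - 1"] n_ge by (simp add: padded_def)
  next
    case (step p)
    then show ?case using killed_rows[OF kill w order_refl t, of q p] by (simp add: padded_def)
  qed
  show ?thesis
  proof
    fix pq show "t pq = top_arr pq"
    proof (cases "pq \<in> idx n")
      case True
      obtain i j where ij: "pq = (i, j)" by fastforce
      then show ?thesis
        using True gD_cell[of i j t] g[of "col i j" "row i"] idx_bounds[of i j] by (simp add: top_arr_def)
    next
      case False
      then show ?thesis using LD_outside[OF tL] by (simp add: top_arr_def)
    qed
  qed
qed

text \<open>Extremal choice: a nonzero \<open>w\<close> in \<open>W\<close> whose support starts at
  the highest possible rank is killed by every \<open>x\<close> operator, since a nonzero image
  would start one rank higher.\<close>

lemma top_vector_in_submodule: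
  assumes sub: "W \<subseteq> VL n m" and scale: "\<And>c v. v \<in> W \<Longrightarrow> scaleV c v \<in> W"
    and x: "\<And>i w. i \<in> {1..n} \<Longrightarrow> w \<in> W \<Longrightarrow> xop n m i w \<in> W" and ne: "w \<in> W" "w \<noteq> (\<lambda>_. 0)"
  shows "vb top_arr \<in> W"
proof -
  define P where "P k \<longleftrightarrow> (\<exists>w\<in>W. w \<noteq> (\<lambda>_. 0) \<and> (\<forall>t. w t \<noteq> 0 \<longrightarrow> int k \<le> wtD n t))" for k
  define R where "R = Max (wtD n ` LD n m)"
  have R: "wtD n t \<le> R" if "t \<in> LD n m" for t using that finite_LD by (auto simp: R_def intro: Max_ge)
  have "\<forall>t. int 0 \<le> wtD n t" by (simp add: wtD_def sum_nonneg)
  then have "P 0" unfolding P_def using ne by blast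
  have bound: "\<forall>k. P k \<longrightarrow> k \<le> nat R"
  proof (intro allI impI)
    fix k assume "P k"
    then obtain w where w: "w \<in> W" "w \<noteq> (\<lambda>_. 0)" "\<forall>t. w t \<noteq> 0 \<longrightarrow> int k \<le> wtD n t"
      unfolding P_def by blast
    then obtain t where "w t \<noteq> 0" by metis
    then have "w \<in> W" "w t \<noteq> 0" "int k \<le> wtD n t" using w by blast+
    moreover from this have "t \<in> LD n m" using sub by (auto simp: VL_def)
    ultimately show "k \<le> nat R" using R[of t] by linarith
  qed
  define g where "g = Greatest P"
  have g_max: "P k \<Longrightarrow> k \<le> g" for k
    unfolding g_def using bound Greatest_le_nat[of P k "nat R"] by blast
  have "P g" unfolding g_def using \<open>P 0\<close> bound GreatestI_nat[of P 0 "nat R"] by blast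
  then obtain w where w: "w \<in> W" "w \<noteq> (\<lambda>_. 0)" "\<forall>t. w t \<noteq> 0 \<longrightarrow> int g \<le> wtD n t"
    unfolding P_def by blast
  have kill: "xop n m i w u = 0" if "i \<in> {1..n}" for i u
  proof (rule ccontr)
    assume "xop n m i w u \<noteq> 0"
    then have "xop n m i w \<noteq> (\<lambda>_. 0)" by metis
    moreover have "int (Suc g) \<le> wtD n t" if ne: "xop n m i w t \<noteq> 0" for t
    proof -
      obtain t' where "wtD n t = wtD n t' + 1" "w t' \<noteq> 0"
        using homogeneous_xop[of i] ne unfolding homogeneous_def by blast
      then show ?thesis using w(3) by fastforce
    qed
    ultimately have "P (Suc g)" unfolding P_def using x[OF that w(1)] by blast
    then show False using g_max[of "Suc g"] by simp
  qed
  have wV: "w \<in> VL n m" using w sub by auto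
  have supp: "w t = 0" if "t \<noteq> top_arr" for t using killed_support[OF kill wV] that by blast
  then have top: "w top_arr \<noteq> 0" using w(2) by metis
  have "scaleV (1 / w top_arr) w = vb top_arr"
  proof
    show "scaleV (1 / w top_arr) w t = vb top_arr t" for t
      using supp top by (cases "t = top_arr") (simp_all add: scaleV_def vb_def)
  qed
  then show ?thesis using scale[OF w(1)] by metis
qed

text \<open>The pairing is bilinear, without conjugation. The substitution
  \<open>u = raise t (i, j)\<close> matches the terms, because both operators carry the same
  coefficient on an edge.\<close>

lemma xop_yop_adjoint:
  "(\<Sum>u\<in>LD n m. v u * xop n m i w u) = (\<Sum>u\<in>LD n m. yop n m i v u * w u)"
proof -
  have "(\<Sum>u\<in>LD n m. v u * xop n m i w u) =
      (\<Sum>j\<in>cells i. \<Sum>u\<in>LD n m. v u * (complex_of_real (coef u (i, j)) * w (lower u (i, j))))"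
    unfolding xop_eq sum_distrib_left by (rule sum.swap)
  also have "\<dots> = (\<Sum>j\<in>cells i. \<Sum>t\<in>LD n m. complex_of_real (coef (raise t (i, j)) (i, j)) * v (raise t (i, j)) * w t)"
  proof (rule sum.cong[OF refl])
    fix j :: nat
    let ?p = "(i, j)"
    have "(\<Sum>u\<in>LD n m. v u * (complex_of_real (coef u ?p) * w (lower u ?p))) =
        (\<Sum>u\<in>{u. lowerable u ?p}. v u * (complex_of_real (coef u ?p) * w (lower u ?p)))"
      by (rule sum.mono_neutral_right) (auto simp: finite_LD coef_def lowerable_def)
    also have "\<dots> = (\<Sum>t\<in>{t. lowerable (raise t ?p) ?p}. complex_of_real (coef (raise t ?p) ?p) * v (raise t ?p) * w t)"
      by (rule sum.reindex_bij_witness[of _ "\<lambda>t. raise t ?p" "\<lambda>u. lower u ?p"])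
        (auto simp: lowerable_def raise_lower)
    also have "\<dots> = (\<Sum>t\<in>LD n m. complex_of_real (coef (raise t ?p) ?p) * v (raise t ?p) * w t)"
      by (rule sum.mono_neutral_left) (auto simp: finite_LD coef_def lowerable_def)
    finally show "(\<Sum>u\<in>LD n m. v u * (complex_of_real (coef u ?p) * w (lower u ?p))) =
      (\<Sum>t\<in>LD n m. complex_of_real (coef (raise t ?p) ?p) * v (raise t ?p) * w t)" .
  qed
  also have "\<dots> = (\<Sum>u\<in>LD n m. yop n m i v u * w u)"
    unfolding yop_eq sum_distrib_right by (rule sum.swap)
  finally show ?thesis .
qed

text \<open>The basis is orthonormal for a form under which \<open>x\<^sub>i\<close> and \<open>y\<^sub>i\<close> are adjoint. A proper
  nonzero submodule and its orthogonal complement would both contain the top vector.\<close>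

lemma irreducible_rep: "irreducible_rep n (VL n m) (xop n m) (yop n m) (hop n m)"
  unfolding irreducible_rep_def
proof (intro conjI allI impI)
  have "vb top_arr \<in> VL n m" using top_arr_in_LD by (auto simp: VL_def vb_def)
  moreover have "vb top_arr \<noteq> (\<lambda>_. 0)" by (auto simp: vb_def fun_eq_iff)
  ultimately show "VL n m \<noteq> {\<lambda>_. 0}" by auto
  fix W
  assume W: "is_subspace W \<and> W \<subseteq> VL n m \<and>
    (\<forall>i\<in>{1..n}. \<forall>w\<in>W. xop n m i w \<in> W \<and> yop n m i w \<in> W \<and> hop n m i w \<in> W)"
  then have sub: "(\<lambda>_. 0) \<in> W" "\<And>v w. v \<in> W \<Longrightarrow> w \<in> W \<Longrightarrow> (\<lambda>z. v z + w z) \<in> W"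
    "\<And>c v. v \<in> W \<Longrightarrow> scaleV c v \<in> W" "W \<subseteq> VL n m"
    and ops: "\<And>i w. i \<in> {1..n} \<Longrightarrow> w \<in> W \<Longrightarrow> xop n m i w \<in> W" "\<And>i w. i \<in> {1..n} \<Longrightarrow> w \<in> W \<Longrightarrow> yop n m i w \<in> W"
    by (auto simp: is_subspace_def)
  show "W = {\<lambda>_. 0} \<or> W = VL n m"
  proof (rule ccontr)
    assume neg: "\<not> ?thesis"
    then obtain w where "w \<in> W" "w \<noteq> (\<lambda>_. 0)" using sub(1) by blast
    then have topW: "vb top_arr \<in> W" using top_vector_in_submodule[OF sub(4,3) ops(1)] by blast
    obtain u where u: "u \<in> VL n m" "u \<notin> W" using neg sub(4) by blast
    have "\<exists>g. (\<forall>w\<in>W. (\<Sum>x\<in>LD n m. w x * g x) = 0) \<and> (\<Sum>x\<in>LD n m. u x * g x) \<noteq> 0"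
      using sub u by (intro separating_functional finite_LD) (auto simp: VL_def scaleV_def)
    then obtain g where g: "\<And>w. w \<in> W \<Longrightarrow> (\<Sum>x\<in>LD n m. w x * g x) = 0" "(\<Sum>x\<in>LD n m. u x * g x) \<noteq> 0"
      by blast
    \<comment> \<open>The functional may be nonzero off \<open>LD n m\<close>; cutting it off gives
      a vector of the module with the same pairings.\<close>
    define g' where "g' = (\<lambda>x. if x \<in> LD n m then g x else 0)"
    define N where "N = {v \<in> VL n m. \<forall>w\<in>W. (\<Sum>x\<in>LD n m. w x * v x) = 0}"
    have "g' \<in> N" using g(1) by (simp add: N_def VL_def g'_def)
    moreover have "g' \<noteq> (\<lambda>_. 0)"
    proof
      assume "g' = (\<lambda>_. 0)"
      then have "g x = 0" if "x \<in> LD n m" for x using that by (metis g'_def)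
      then show False using g(2) by simp
    qed
    moreover have "scaleV c v \<in> N" if "v \<in> N" for c v
    proof -
      have "(\<Sum>x\<in>LD n m. w x * (c * v x)) = c * (\<Sum>x\<in>LD n m. w x * v x)" for w
        by (simp add: sum_distrib_left mult.left_commute)
      then show ?thesis using that by (simp add: N_def VL_def scaleV_def)
    qed
    \<comment> \<open>Adjointness turns stability of \<open>W\<close> under \<open>y\<close> into
      stability of \<open>N\<close> under \<open>x\<close>, all that
      \<open>top_vector_in_submodule\<close> asks for besides scaling.\<close>
    moreover have "xop n m i v \<in> N" if "i \<in> {1..n}" "v \<in> N" for i v
      using that ops(2) by (auto simp: N_def xop_yop_adjoint) (auto simp: VL_def xop_def)
    moreover have "N \<subseteq> VL n m" by (auto simp: N_def)
    \<comment> \<open>A bilinear complement may meet \<open>W\<close>; the contradiction is that the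
      top vector lies in both although it pairs with itself to 1.\<close>
    ultimately have "vb top_arr \<in> N" using top_vector_in_submodule[of N g'] by blast
    then have "(\<Sum>x\<in>LD n m. vb top_arr x * vb top_arr x) = 0" using topW by (simp add: N_def)
    moreover have "(\<Sum>x\<in>LD n m. vb top_arr x * vb top_arr x) = (\<Sum>x\<in>LD n m. if x = top_arr then 1 else 0)"
      by (rule sum.cong) (auto simp: vb_def)
    ultimately show False using top_arr_in_LD finite_LD by simp
  qed
qed

section \<open>Weight basis and representation diagram\<close>

lemma basis_expansion:
  assumes "v \<in> VL n m"
  shows "v = (\<lambda>x. \<Sum>t\<in>LD n m. v t * vb t x)"
proof
  fix x
  have "(\<Sum>t\<in>LD n m. v t * vb t x) = (\<Sum>t\<in>LD n m. if t = x then v x else 0)"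
    by (rule sum.cong) (auto simp: vb_def)
  then show "v x = (\<Sum>t\<in>LD n m. v t * vb t x)" using assms finite_LD by (auto simp: VL_def)
qed

lemma hop_vb:
  assumes "t \<in> LD n m"
  shows "hop n m i (vb t) = scaleV (of_int (mD n m i t)) (vb t)"
proof
  show "hop n m i (vb t) x = scaleV (of_int (mD n m i t)) (vb t) x" for x
    using assms by (cases "x = t") (simp_all add: hop_def vb_def scaleV_def)
qed

text \<open>Strict positivity of the coefficients makes the supporting graph equal to the poset,
  with no edge lost.\<close>

lemma Xorth_Yorth_nonzero:
  assumes "edgeD n m i s t"
  shows "Xorth n m t s \<noteq> 0" "Yorth n m s t \<noteq> 0"
proof -
  obtain j where j: "s \<in> LD n m" "t \<in> LD n m" "j \<in> cells i" "t = raise s (i, j)"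
    using assms by (auto simp: edgeD_iff)
  then have low: "lowerable (raise s (i, j)) (i, j)" by (simp add: lowerable_def cells_def)
  then show "Xorth n m t s \<noteq> 0" "Yorth n m s t \<noteq> 0"
    using edge_scalars[OF low] coef_pos[OF low] j(4) by simp_all
qed

lemma xop_vb:
  assumes "t \<in> LD n m"
  shows "xop n m i (vb s) t = (if edgeD n m i s t then complex_of_real (Xorth n m t s) else 0)"
proof -
  have fin: "finite {t'. edgeD n m i t' t}"
    by (rule finite_subset[OF _ finite_LD]) (auto simp: edgeD_iff)
  have "xop n m i (vb s) t =
      (\<Sum>t'\<in>{t'. edgeD n m i t' t}. if t' = s then complex_of_real (Xorth n m t s) else 0)"
    unfolding xop_def using assms by (auto simp: vb_def intro!: sum.cong)
  then show ?thesis using fin by simp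
qed

lemma yop_vb:
  assumes "s \<in> LD n m"
  shows "yop n m i (vb t) s = (if edgeD n m i s t then complex_of_real (Yorth n m s t) else 0)"
proof -
  have fin: "finite {t'. edgeD n m i s t'}"
    by (rule finite_subset[OF _ finite_LD]) (auto simp: edgeD_iff)
  have "yop n m i (vb t) s =
      (\<Sum>t'\<in>{t'. edgeD n m i s t'}. if t' = t then complex_of_real (Yorth n m s t) else 0)"
    unfolding yop_def using assms by (auto simp: vb_def intro!: sum.cong)
  then show ?thesis using fin by simp
qed

end

theorem theorem7p1:
  fixes n m :: nat
  assumes "n \<ge> 4" and "m \<ge> 1"
  shows "structuredD n m
    \<and> DC_relations n m (Xorth n m) (Yorth n m)
    \<and> serre_rep n (VL n m) (xop n m) (yop n m) (hop n m)
    \<and> irreducible_rep n (VL n m) (xop n m) (yop n m) (hop n m)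
    \<and> has_highest_weight n (VL n m) (xop n m) (hop n m) (\<lambda>i. if i = n - 1 then int m else 0)
    \<and> (\<forall>v\<in>VL n m. v = (\<lambda>x. \<Sum>t\<in>LD n m. v t * vb t x))
    \<and> (\<forall>t\<in>LD n m. \<forall>i\<in>{1..n}. hop n m i (vb t) = scaleV (of_int (mD n m i t)) (vb t))
    \<and> (\<forall>i\<in>{1..n}. \<forall>s\<in>LD n m. \<forall>t\<in>LD n m.
         (edgeD n m i s t \<longleftrightarrow> xop n m i (vb s) t \<noteq> 0 \<or> yop n m i (vb t) s \<noteq> 0)
         \<and> (edgeD n m i s t \<longrightarrow>
              xop n m i (vb s) t = complex_of_real (Xorth n m t s)
              \<and> yop n m i (vb t) s = complex_of_real (Yorth n m s t)))"
proof -
  interpret orth_array n m by unfold_locales fact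
  have "(edgeD n m i s t \<longleftrightarrow> xop n m i (vb s) t \<noteq> 0 \<or> yop n m i (vb t) s \<noteq> 0)
         \<and> (edgeD n m i s t \<longrightarrow>
              xop n m i (vb s) t = complex_of_real (Xorth n m t s)
              \<and> yop n m i (vb t) s = complex_of_real (Yorth n m s t))"
    if "s \<in> LD n m" "t \<in> LD n m" for i s t
    using xop_vb[OF that(2), of i s] yop_vb[OF that(1), of i t] Xorth_Yorth_nonzero[of i s t] by auto
  then show ?thesis
    using structuredD DC_relations serre_rep irreducible_rep has_highest_weight basis_expansion hop_vb
    by blast
qed

end
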